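(* Let $N\ge 2$ and let $\Omega$ be a bounded domain in $\mathbb{R}^N$. Then, for any positive integer $k$, the $k$-th eigenvalue $\lambda_k(\Omega,\alpha)$ of the clamped plate problem $$\Delta^2u+\alpha\Delta u=\lambda u\ \text{ in }\Omega,\qquad u=\frac{\partial u}{\partial \nu}=0\ \text{ on }\partial\Omega,$$ satisfies $$\lambda_k(\Omega,\alpha)=-\frac{\alpha^2}{4}+o(\alpha^2)\qquad\text{as }\alpha\to+\infty.$$ Moreover, $$\lambda_1(\Omega,\alpha)=-\frac{\alpha^2}{4}+O(\alpha)\qquad\text{as }\alpha\to+\infty.$$
   Context: Here $\alpha\in\mathbb{R}$ is a parameter and $\nu$ is the outward unit normal. The eigenvalue problem is understood in weak form: $u\in H^2_0(\Omega)\setminus\{0\}$ and $\int_\Omega \Delta u\,\Delta\phi-\alpha\nabla u\cdot\nabla\phi\,dx=\lambda\int_\Omega u\phi\,dx$ for all $\phi\in H^2_0(\Omega)$. Its eigenvalues, repeated according to multiplicity, form a sequence $\lambda_1(\Omega,\alpha)\le\lambda_2(\Omega,\alpha)\le\dots\to+\infty$ and are characterized by $$\lambda_k(\Omega,\alpha)=\min_{\substack{V\subset H_0^2(\Omega)\\ \dim V=k}}\ \max_{0\neq u\in V}\frac{\int_\Omega (\Delta u)^2-\alpha|\nabla u|^2\,dx}{\int_\Omega u^2\,dx}.$$ *)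

theory Defs
  imports "HOL-Analysis.Analysis" "HOL-Library.Landau_Symbols"
begin

section \<open>Test functions\<close>

definition partial :: "'a::euclidean_space \<Rightarrow> ('a \<Rightarrow> real) \<Rightarrow> 'a \<Rightarrow> real"
  where "partial b f x = frechet_derivative f (at x) b"

primrec C_k :: "nat \<Rightarrow> ('a::euclidean_space \<Rightarrow> real) \<Rightarrow> bool"
  where
    "C_k 0 f \<longleftrightarrow> continuous_on UNIV f"
  | "C_k (Suc n) f \<longleftrightarrow> f differentiable_on UNIV \<and> (\<forall>b\<in>Basis. C_k n (partial b f))"

definition test_functions :: "'a::euclidean_space set \<Rightarrow> ('a \<Rightarrow> real) set"
  where "test_functions \<Omega> =
    {\<phi>. (\<forall>n. C_k n \<phi>) \<and> compact (closure {x. \<phi> x \<noteq> 0}) \<and> closure {x. \<phi> x \<noteq> 0} \<subseteq> \<Omega>}"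

section \<open>Sobolev spaces\<close>

text \<open>Elements of the function spaces below are functions on the whole space, of which only the
  values on \<open>\<Omega>\<close> up to null sets matter; equality in these spaces is equality almost everywhere
  on \<open>\<Omega>\<close>.\<close>

definition L2 :: "'a::euclidean_space set \<Rightarrow> ('a \<Rightarrow> real) set"
  where "L2 \<Omega> =
    {u \<in> borel_measurable (lebesgue_on \<Omega>). integrable (lebesgue_on \<Omega>) (\<lambda>x. (u x)\<^sup>2)}"

definition is_weak_partial ::
    "'a::euclidean_space set \<Rightarrow> 'a \<Rightarrow> ('a \<Rightarrow> real) \<Rightarrow> ('a \<Rightarrow> real) \<Rightarrow> bool"
  where "is_weak_partial \<Omega> b u v \<longleftrightarrow>
    (\<forall>\<phi>\<in>test_functions \<Omega>.
      (LINT x|lebesgue_on \<Omega>. u x * partial b \<phi> x) = - (LINT x|lebesgue_on \<Omega>. v x * \<phi> x))"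

text \<open>The weak partial derivative is unique only up to null sets, so \<open>weak_partial\<close> selects a
  representative; it is meaningful only for \<open>u\<close> in \<open>H1\<close>.\<close>

definition weak_partial :: "'a::euclidean_space set \<Rightarrow> 'a \<Rightarrow> ('a \<Rightarrow> real) \<Rightarrow> 'a \<Rightarrow> real"
  where "weak_partial \<Omega> b u = (SOME v. v \<in> L2 \<Omega> \<and> is_weak_partial \<Omega> b u v)"

definition H1 :: "'a::euclidean_space set \<Rightarrow> ('a \<Rightarrow> real) set"
  where "H1 \<Omega> = {u \<in> L2 \<Omega>. \<forall>b\<in>Basis. \<exists>v\<in>L2 \<Omega>. is_weak_partial \<Omega> b u v}"

definition H2 :: "'a::euclidean_space set \<Rightarrow> ('a \<Rightarrow> real) set"
  where "H2 \<Omega> = {u \<in> H1 \<Omega>. \<forall>b\<in>Basis. weak_partial \<Omega> b u \<in> H1 \<Omega>}"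

definition H2_norm :: "'a::euclidean_space set \<Rightarrow> ('a \<Rightarrow> real) \<Rightarrow> real"
  where "H2_norm \<Omega> u = sqrt (
      (LINT x|lebesgue_on \<Omega>. (u x)\<^sup>2)
    + (\<Sum>b\<in>Basis. LINT x|lebesgue_on \<Omega>. (weak_partial \<Omega> b u x)\<^sup>2)
    + (\<Sum>b\<in>Basis. \<Sum>c\<in>Basis.
        LINT x|lebesgue_on \<Omega>. (weak_partial \<Omega> c (weak_partial \<Omega> b u) x)\<^sup>2))"

definition H20 :: "'a::euclidean_space set \<Rightarrow> ('a \<Rightarrow> real) set"
  where "H20 \<Omega> = {u \<in> H2 \<Omega>. \<exists>\<phi>. (\<forall>n::nat. \<phi> n \<in> test_functions \<Omega>) \<and>
    (\<lambda>n. H2_norm \<Omega> (\<lambda>x. u x - \<phi> n x)) \<longlonglongrightarrow> 0}"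

definition weak_gradient :: "'a::euclidean_space set \<Rightarrow> ('a \<Rightarrow> real) \<Rightarrow> 'a \<Rightarrow> 'a"
  where "weak_gradient \<Omega> u x = (\<Sum>b\<in>Basis. weak_partial \<Omega> b u x *\<^sub>R b)"

definition weak_laplacian :: "'a::euclidean_space set \<Rightarrow> ('a \<Rightarrow> real) \<Rightarrow> 'a \<Rightarrow> real"
  where "weak_laplacian \<Omega> u x = (\<Sum>b\<in>Basis. weak_partial \<Omega> b (weak_partial \<Omega> b u) x)"

section \<open>The clamped plate eigenvalues\<close>

text \<open>This set also contains the zero function; \<open>\<mu>\<close> is an eigenvalue iff it contains a function
  that is not almost everywhere zero on \<open>\<Omega>\<close>.\<close>

definition clamped_eigenspace ::
    "'a::euclidean_space set \<Rightarrow> real \<Rightarrow> real \<Rightarrow> ('a \<Rightarrow> real) set"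
  where "clamped_eigenspace \<Omega> \<alpha> \<mu> = {u \<in> H20 \<Omega>. \<forall>\<phi>\<in>H20 \<Omega>.
    (LINT x|lebesgue_on \<Omega>. weak_laplacian \<Omega> u x * weak_laplacian \<Omega> \<phi> x
        - \<alpha> * (weak_gradient \<Omega> u x \<bullet> weak_gradient \<Omega> \<phi> x))
    = \<mu> * (LINT x|lebesgue_on \<Omega>. u x * \<phi> x)}"

text \<open>Dimension of a space of functions modulo almost everywhere equality: existence of a basis
  with \<open>m\<close> elements.\<close>

definition has_ae_dim :: "'a::euclidean_space set \<Rightarrow> ('a \<Rightarrow> real) set \<Rightarrow> nat \<Rightarrow> bool"
  where "has_ae_dim \<Omega> V m \<longleftrightarrow> (\<exists>w :: nat \<Rightarrow> 'a \<Rightarrow> real.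
    (\<forall>i<m. w i \<in> V) \<and>
    (\<forall>c. (AE x in lebesgue_on \<Omega>. (\<Sum>i<m. c i * w i x) = 0) \<longrightarrow> (\<forall>i<m. c i = 0)) \<and>
    (\<forall>v\<in>V. \<exists>c. AE x in lebesgue_on \<Omega>. v x = (\<Sum>i<m. c i * w i x)))"

text \<open>Every real \<open>\<mu>\<close> occurs exactly as often as its multiplicity; in particular, numbers that are
  not eigenvalues do not occur. The sequence is indexed from \<open>0\<close>.\<close>

definition clamped_eigenvalue_sequence ::
    "'a::euclidean_space set \<Rightarrow> real \<Rightarrow> (nat \<Rightarrow> real) \<Rightarrow> bool"
  where "clamped_eigenvalue_sequence \<Omega> \<alpha> s \<longleftrightarrow>
    mono s \<and> filterlim s at_top sequentially \<and>
    (\<forall>\<mu>. finite {j. s j = \<mu>} \<and>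
      has_ae_dim \<Omega> (clamped_eigenspace \<Omega> \<alpha> \<mu>) (card {j. s j = \<mu>}))"

text \<open>The \<open>k\<close>-th eigenvalue, with \<open>k\<close> counted from \<open>1\<close>.\<close>

definition clamped_eigenvalue :: "'a::euclidean_space set \<Rightarrow> real \<Rightarrow> nat \<Rightarrow> real"
  where "clamped_eigenvalue \<Omega> \<alpha> k = (THE s. clamped_eigenvalue_sequence \<Omega> \<alpha> s) (k - 1)"

end

theory Submission
  imports Defs "HOL-Library.Function_Algebras" "HOL-Library.Diagonal_Subsequence"
    "HOL-Computational_Algebra.Polynomial" "HOL-Complex_Analysis.Great_Picard"
    "HOL-Real_Asymp.Real_Asymp"
begin

text \<open>Put \<open>Q(u) = \<integral> (\<Delta>u)\<^sup>2 - \<alpha> |\<nabla>u|\<^sup>2\<close> for \<open>u\<close> in the Sobolev space \<open>H\<^sup>2\<^sub>0\<close> of the domain. Since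
  \<open>\<integral> |\<nabla>u|\<^sup>2 = - \<integral> u \<Delta>u\<close>, completing the square gives \<open>Q(u) + \<alpha>\<^sup>2/4 \<integral> u\<^sup>2 = \<integral> ((\<Delta> + \<alpha>/2) u)\<^sup>2\<close>.
  Hence every eigenvalue is at least \<open>- \<alpha>\<^sup>2/4\<close>, and an upper bound for the \<open>k\<close>-th one follows
  from a \<open>k\<close>-dimensional space of functions which \<open>\<Delta> + \<alpha>/2\<close> makes small. Plane waves of
  frequency \<open>\<omega> = \<surd>(\<alpha>/2)\<close> are annihilated by \<open>\<Delta> + \<alpha>/2\<close>. If such a wave is multiplied by a fixed
  bump \<open>\<eta>\<close>, every term of the result has a derivative on \<open>\<eta>\<close>, so its \<open>L\<^sup>2\<close> norm is only of order
  \<open>\<omega>\<close>, and \<open>\<integral> ((\<Delta> + \<alpha>/2) u)\<^sup>2\<close> is at most of order \<open>\<alpha>\<close>. Taking \<open>k\<close> bumps with disjoint supports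
  decouples the modulated bumps in all quadratic forms involved. Therefore the \<open>k\<close>-th eigenvalue
  lies between \<open>- \<alpha>\<^sup>2/4\<close> and \<open>- \<alpha>\<^sup>2/4 + C\<^sub>k (1 + \<alpha>)\<close> for every \<open>k\<close> (lemma
  \<open>clamped_eigenvalue_bounds\<close>), which contains both asymptotic statements.

  The eigenvalues are defined through the sequence of all eigenvalues with their multiplicities,
  so it has to be shown that this sequence exists and is unique. Existence rests on a spectral
  theorem for two quadratic forms \<open>A \<ge> B\<close> (locale \<open>compact_form_pair\<close>) such that the space is
  complete for \<open>A\<close> and \<open>A\<close>-bounded sequences have \<open>B\<close>-Cauchy subsequences. Eigenvectors are
  found by minimising \<open>A/B\<close> on the \<open>B\<close>-orthogonal complement of the previous ones. By the
  parallelogram law a \<open>B\<close>-Cauchy minimising sequence is \<open>A\<close>-Cauchy, so no weak convergence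
  enters.

  Here \<open>B\<close> is the \<open>L\<^sup>2\<close> inner product and \<open>A\<close> is \<open>\<integral> (\<Delta> + \<alpha>/2)u (\<Delta> + \<alpha>/2)v + \<integral> u v\<close>. Completeness
  holds because \<open>A\<close> is equivalent to the square of the \<open>H\<^sup>2\<close> norm (the Hessian satisfies
  \<open>\<integral> |D\<^sup>2u|\<^sup>2 = \<integral> (\<Delta>u)\<^sup>2\<close>), \<open>L\<^sup>2\<close> is complete, and weak derivatives pass to \<open>L\<^sup>2\<close> limits; that
  weak derivatives are unique almost everywhere is the fundamental lemma of the calculus of
  variations. Compactness is Rellich's theorem, proved by averaging over small balls and the
  theorem of Arzela and Ascoli.\<close>

section \<open>A linear system\<close>

text \<open>Gaussian elimination. A column \<open>p\<close> with a nonzero entry in the last row is used to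
  eliminate that row. A nontrivial solution for the remaining rows and columns is extended by
  the value at \<open>p\<close> that the last row prescribes.\<close>

lemma homogeneous_system_nontrivial_solution:
  fixes M :: "nat \<Rightarrow> nat \<Rightarrow> real"
  assumes "m < n"
  shows "\<exists>c. (\<exists>j<n. c j \<noteq> 0) \<and> (\<forall>i<m. (\<Sum>j<n. M i j * c j) = 0)"
  using assms
proof (induction m arbitrary: n M)
  case 0
  then show ?case by (intro exI[of _ "\<lambda>_. 1"]) auto
next
  case (Suc m)
  then obtain n' where n: "n = Suc n'" "m < n'" by (cases n) auto
  show ?case
  proof (cases "\<exists>p<n. M m p \<noteq> 0")
    case False
    from Suc.IH[of n M] Suc.prems obtain c where
      "\<exists>j<n. c j \<noteq> 0" "\<forall>i<m. (\<Sum>j<n. M i j * c j) = 0" by auto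
    with False show ?thesis
      by (intro exI[of _ c]) (auto simp: less_Suc_eq)
  next
    case True
    then obtain p where p: "p < n" "M m p \<noteq> 0" by blast
    \<comment> \<open>\<open>\<sigma>\<close> enumerates the columns other than \<open>p\<close>.\<close>
    define \<sigma> where "\<sigma> j = (if j < p then j else Suc j)" for j
    have \<sigma>: "bij_betw \<sigma> {..<n'} ({..<n} - {p})"
      by (rule bij_betw_byWitness[where f' = "\<lambda>j. if j < p then j else j - 1"])
        (use p n in \<open>auto simp: \<sigma>_def\<close>)
    define M' where "M' i j = M i (\<sigma> j) - M i p * M m (\<sigma> j) / M m p" for i j
    from Suc.IH[OF n(2), of M'] obtain c where
      c: "\<exists>j<n'. c j \<noteq> 0" "\<forall>i<m. (\<Sum>j<n'. M' i j * c j) = 0" by auto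
    define d where "d j = (if j = p then - (\<Sum>j<n'. M m (\<sigma> j) * c j) / M m p
      else c (inv_into {..<n'} \<sigma> j))" for j
    have inv: "inv_into {..<n'} \<sigma> (\<sigma> j) = j" if "j < n'" for j
      using \<sigma> that by (auto simp: bij_betw_def)
    have \<sigma>p: "\<sigma> j \<noteq> p" for j by (auto simp: \<sigma>_def)
    have d\<sigma>: "d (\<sigma> j) = c j" if "j < n'" for j
      using inv[OF that] \<sigma>p by (simp add: d_def)
    have split: "(\<Sum>j<n. M i j * d j) = M i p * d p + (\<Sum>j<n'. M i (\<sigma> j) * c j)" for i
    proof -
      have "(\<Sum>j<n. M i j * d j) = M i p * d p + (\<Sum>j\<in>{..<n} - {p}. M i j * d j)"
        using p(1) by (subst sum.remove[of _ p]) auto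
      also have "(\<Sum>j\<in>{..<n} - {p}. M i j * d j) = (\<Sum>j<n'. M i (\<sigma> j) * d (\<sigma> j))"
        by (rule sum.reindex_bij_betw[OF \<sigma>, symmetric])
      also have "\<dots> = (\<Sum>j<n'. M i (\<sigma> j) * c j)"
        by (intro sum.cong) (auto simp: d\<sigma>)
      finally show ?thesis .
    qed
    have dp: "d p = - (\<Sum>j<n'. M m (\<sigma> j) * c j) / M m p" by (simp add: d_def)
    have "(\<Sum>j<n. M i j * d j) = 0" if "i < Suc m" for i
    proof (cases "i = m")
      case True
      then show ?thesis using p by (simp add: split dp)
    next
      case False
      then have "(\<Sum>j<n'. M' i j * c j) = 0" using that c by auto
      moreover have "(\<Sum>j<n'. M' i j * c j) =
          (\<Sum>j<n'. M i (\<sigma> j) * c j) - M i p / M m p * (\<Sum>j<n'. M m (\<sigma> j) * c j)"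
        by (simp add: M'_def left_diff_distrib sum_subtractf sum_distrib_left mult.assoc)
      ultimately show ?thesis unfolding split dp by simp
    qed
    moreover obtain j where "j < n'" "c j \<noteq> 0" using c by blast
    then have "d (\<sigma> j) \<noteq> 0" "\<sigma> j < n" using d\<sigma> \<sigma> by (auto simp: bij_betw_def)
    ultimately show ?thesis by blast
  qed
qed

section \<open>Eigenvalues of a compact pair of quadratic forms\<close>

text \<open>The forms below are only given on a subspace of functions and vanish on functions that are
  zero almost everywhere. They are therefore neither inner products on a type nor definite.\<close>

locale semidefinite_form =
  fixes V :: "'v::real_vector set" and F :: "'v \<Rightarrow> 'v \<Rightarrow> real"
  assumes subspace: "subspace V"
    and add_left: "\<lbrakk>u \<in> V; v \<in> V; w \<in> V\<rbrakk> \<Longrightarrow> F (u + v) w = F u w + F v w"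
    and scale_left: "\<lbrakk>u \<in> V; w \<in> V\<rbrakk> \<Longrightarrow> F (c *\<^sub>R u) w = c * F u w"
    and sym: "\<lbrakk>u \<in> V; v \<in> V\<rbrakk> \<Longrightarrow> F u v = F v u"
    and nonneg: "u \<in> V \<Longrightarrow> 0 \<le> F u u"
begin

lemmas closed [simp, intro] = subspace_add[OF subspace] subspace_diff[OF subspace]
  subspace_scale[OF subspace] subspace_0[OF subspace]

lemma sum_closed [simp, intro]: "(\<And>i. i \<in> I \<Longrightarrow> f i \<in> V) \<Longrightarrow> (\<Sum>i\<in>I. f i) \<in> V"
  by (rule subspace_sum[OF subspace])

lemma diff_left: "\<lbrakk>u \<in> V; v \<in> V; w \<in> V\<rbrakk> \<Longrightarrow> F (u - v) w = F u w - F v w"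
  using add_left[of u "(-1) *\<^sub>R v" w] scale_left[of v w "-1"] closed(3)[of v "-1"] by simp

lemma add_right: "\<lbrakk>u \<in> V; v \<in> V; w \<in> V\<rbrakk> \<Longrightarrow> F w (u + v) = F w u + F w v"
  by (simp add: sym[of w] add_left)

lemma diff_right: "\<lbrakk>u \<in> V; v \<in> V; w \<in> V\<rbrakk> \<Longrightarrow> F w (u - v) = F w u - F w v"
  by (simp add: sym[of w] diff_left)

lemma scale_right: "\<lbrakk>u \<in> V; w \<in> V\<rbrakk> \<Longrightarrow> F w (c *\<^sub>R u) = c * F w u"
  by (simp add: sym[of w] scale_left)

lemma zero_left: "w \<in> V \<Longrightarrow> F 0 w = 0"
  using scale_left[of 0 w 0] by simp

lemma sum_left:
  "\<lbrakk>\<And>i. i \<in> I \<Longrightarrow> f i \<in> V; w \<in> V\<rbrakk> \<Longrightarrow> F (\<Sum>i\<in>I. c i *\<^sub>R f i) w = (\<Sum>i\<in>I. c i * F (f i) w)"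
  by (induction I rule: infinite_finite_induct)
    (auto simp: zero_left add_left scale_left)

lemma sum_right:
  "\<lbrakk>\<And>i. i \<in> I \<Longrightarrow> f i \<in> V; w \<in> V\<rbrakk> \<Longrightarrow> F w (\<Sum>i\<in>I. c i *\<^sub>R f i) = (\<Sum>i\<in>I. c i * F w (f i))"
  by (simp add: sym[of w] sum_left)

lemmas bilin = add_left add_right diff_left diff_right scale_left scale_right

lemma Cauchy_Schwarz:
  assumes u: "u \<in> V" and v: "v \<in> V"
  shows "(F u v)\<^sup>2 \<le> F u u * F v v"
proof -
  have q: "0 \<le> F u u + 2 * t * F u v + t\<^sup>2 * F v v" for t
  proof -
    have "F (u + t *\<^sub>R v) (u + t *\<^sub>R v) = F u u + 2 * t * F u v + t\<^sup>2 * F v v"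
      using u v sym[OF u v] by (simp add: bilin power2_eq_square algebra_simps)
    then show ?thesis using nonneg[of "u + t *\<^sub>R v"] u v by simp
  qed
  show ?thesis
  \<comment> \<open>If \<open>F v v\<close> vanishes, the polynomial in \<open>t\<close> is affine; being bounded below, it is constant.\<close>
  proof (cases "F v v = 0")
    case True
    show ?thesis
    proof (cases "F u v = 0")
      case False
      from q[of "- (F u u + 1) / (2 * F u v)"] False True show ?thesis by (simp add: field_simps)
    qed (use True in simp)
  next
    case False
    then have pos: "F v v > 0" using nonneg[OF v] by simp
    from q[of "- F u v / F v v"] pos have "0 \<le> F u u - (F u v)\<^sup>2 / F v v"
      by (simp add: power2_eq_square field_simps)
    then show ?thesis using pos by (simp add: field_simps)
  qed
qed

lemma quad_sum_le:
  assumes "u \<in> V" "v \<in> V"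
  shows "F (u + v) (u + v) \<le> 2 * F u u + 2 * F v v"
proof -
  have "0 \<le> F (u - v) (u - v)" using assms by (intro nonneg) auto
  then show ?thesis using assms sym[of u v] by (simp add: bilin)
qed

lemma quad_diff_le:
  assumes "u \<in> V" "v \<in> V"
  shows "F (u - v) (u - v) \<le> 2 * F u u + 2 * F v v"
proof -
  have "0 \<le> F (u + v) (u + v)" using assms by (intro nonneg) auto
  then show ?thesis using assms sym[of u v] by (simp add: bilin)
qed

lemma tendsto_form_left:
  assumes s: "\<And>n. s n \<in> V" and u: "u \<in> V" and w: "w \<in> V"
    and lim: "(\<lambda>n. F (s n - u) (s n - u)) \<longlonglongrightarrow> 0"
  shows "(\<lambda>n. F (s n) w) \<longlonglongrightarrow> F u w"
proof -
  have "(\<lambda>n. (F (s n - u) w)\<^sup>2) \<longlonglongrightarrow> 0"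
  proof (rule Lim_null_comparison)
    show "\<forall>\<^sub>F n in sequentially. norm ((F (s n - u) w)\<^sup>2) \<le> F (s n - u) (s n - u) * F w w"
      using s u w by (auto intro!: always_eventually Cauchy_Schwarz)
    show "(\<lambda>n. F (s n - u) (s n - u) * F w w) \<longlonglongrightarrow> 0"
      using lim by (rule tendsto_mult_left_zero)
  qed
  then have "(\<lambda>n. F (s n - u) w) \<longlonglongrightarrow> 0"
    by (auto simp: tendsto_rabs_zero_iff dest: tendsto_real_sqrt)
  then have "(\<lambda>n. F (s n) w - F u w) \<longlonglongrightarrow> 0" using s u w by (simp add: diff_left)
  then show ?thesis by (rule LIM_zero_cancel)
qed

lemma tendsto_form:
  assumes s: "\<And>n. s n \<in> V" and u: "u \<in> V" and lims: "(\<lambda>n. F (s n - u) (s n - u)) \<longlonglongrightarrow> 0"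
    and t: "\<And>n. t n \<in> V" and v: "v \<in> V" and limt: "(\<lambda>n. F (t n - v) (t n - v)) \<longlonglongrightarrow> 0"
  shows "(\<lambda>n. F (s n) (t n)) \<longlonglongrightarrow> F u v"
proof -
  have "(\<lambda>n. (F (s n - u) (t n - v))\<^sup>2) \<longlonglongrightarrow> 0"
  proof (rule Lim_null_comparison)
    show "\<forall>\<^sub>F n in sequentially. norm ((F (s n - u) (t n - v))\<^sup>2)
        \<le> F (s n - u) (s n - u) * F (t n - v) (t n - v)"
      using s u t v by (auto intro!: always_eventually Cauchy_Schwarz)
    show "(\<lambda>n. F (s n - u) (s n - u) * F (t n - v) (t n - v)) \<longlonglongrightarrow> 0"
      using tendsto_mult[OF lims limt] by simp
  qed
  then have "(\<lambda>n. F (s n - u) (t n - v)) \<longlonglongrightarrow> 0"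
    by (auto simp: tendsto_rabs_zero_iff dest: tendsto_real_sqrt)
  moreover have "(\<lambda>n. F (s n) v) \<longlonglongrightarrow> F u v" using tendsto_form_left[OF s u v lims] .
  moreover have "(\<lambda>n. F u (t n)) \<longlonglongrightarrow> F u v"
    using tendsto_form_left[OF t v u limt] t u v by (simp add: sym[of u])
  ultimately have "(\<lambda>n. F (s n - u) (t n - v) + F (s n) v + F u (t n) - F u v) \<longlonglongrightarrow> 0 + F u v
      + F u v - F u v"
    by (intro tendsto_intros)
  then show ?thesis using s u t v by (simp add: bilin)
qed

end

text \<open>The situation of an energy \<open>A\<close> and a norm \<open>B\<close> for which the eigenvalue problem
  \<open>A u v = \<mu> B u v\<close> for all \<open>v\<close> has discrete spectrum: the form domain is complete for \<open>A\<close>, and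
  it embeds compactly into the completion for \<open>B\<close>. The last assumption says that the space has
  infinite dimension modulo the null vectors of \<open>B\<close>.\<close>

locale compact_form_pair =
  A: semidefinite_form V A + B: semidefinite_form V B
  for V :: "'v::real_vector set" and A B +
  assumes B_le_A: "u \<in> V \<Longrightarrow> B u u \<le> A u u"
    and A_complete: "\<lbrakk>\<And>n. s n \<in> V; \<And>e. e > 0 \<Longrightarrow> \<exists>N. \<forall>i\<ge>N. \<forall>j\<ge>N. A (s i - s j) (s i - s j) < e\<rbrakk>
      \<Longrightarrow> \<exists>u\<in>V. (\<lambda>n. A (s n - u) (s n - u)) \<longlonglongrightarrow> 0"
    and A_B_compact: "\<lbrakk>\<And>n. s n \<in> V; \<And>n. A (s n) (s n) \<le> M\<rbrakk>
      \<Longrightarrow> \<exists>r::nat \<Rightarrow> nat. strict_mono r \<and>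
        (\<forall>e>0. \<exists>N. \<forall>i\<ge>N. \<forall>j\<ge>N. B (s (r i) - s (r j)) (s (r i) - s (r j)) < e)"
    and infinite_dim: "\<exists>f::nat \<Rightarrow> 'v. (\<forall>i<n. f i \<in> V) \<and>
      (\<forall>c. B (\<Sum>i<n. c i *\<^sub>R f i) (\<Sum>i<n. c i *\<^sub>R f i) = 0 \<longrightarrow> (\<forall>i<n. c i = 0))"
begin

definition orth :: "(nat \<Rightarrow> 'v) \<Rightarrow> nat \<Rightarrow> 'v set"
  where "orth e k = {v \<in> V. \<forall>j<k. B v (e j) = 0}"

lemma orth_subspace:
  assumes "\<And>j. j < k \<Longrightarrow> e j \<in> V"
  shows "subspace (orth e k)"
  using assms by (auto simp: orth_def subspace_def B.bilin B.zero_left)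

text \<open>Orthogonality to \<open>k\<close> vectors imposes \<open>k\<close> linear equations on the \<open>k + 1\<close> coefficients.
  This is the dimension count behind the min-max principle.\<close>

lemma orth_nontrivial:
  assumes e: "\<And>j. j < k \<Longrightarrow> e j \<in> V" and f: "\<And>i. i < Suc k \<Longrightarrow> f i \<in> V"
  shows "\<exists>c. (\<exists>i<Suc k. c i \<noteq> 0) \<and> (\<Sum>i<Suc k. c i *\<^sub>R f i) \<in> orth e k"
proof -
  obtain c where c: "\<exists>i<Suc k. c i \<noteq> 0" "\<And>j. j < k \<Longrightarrow> (\<Sum>i<Suc k. B (f i) (e j) * c i) = 0"
    using homogeneous_system_nontrivial_solution[of k "Suc k" "\<lambda>j i. B (f i) (e j)"] by auto
  have "B (\<Sum>i<Suc k. c i *\<^sub>R f i) (e j) = 0" if "j < k" for j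
  proof -
    have "B (\<Sum>i<Suc k. c i *\<^sub>R f i) (e j) = (\<Sum>i<Suc k. c i * B (f i) (e j))"
      using e f that by (intro B.sum_left) auto
    then show ?thesis using c(2)[OF that] by (simp add: mult.commute)
  qed
  then have "(\<Sum>i<Suc k. c i *\<^sub>R f i) \<in> orth e k"
    using f by (auto simp: orth_def simp del: sum.lessThan_Suc)
  with c(1) show ?thesis by blast
qed

text \<open>The direct method. Compactness makes a minimising sequence \<open>B\<close>-Cauchy after passing to a
  subsequence. The sum of two of its late members has \<open>B\<close>-norm close to that of twice a unit
  vector, and its Rayleigh quotient is not below the infimum, so the parallelogram law leaves no
  room for the \<open>A\<close>-norm of the difference: the sequence is also \<open>A\<close>-Cauchy.\<close>

lemma rayleigh_minimizer:
  assumes e: "\<And>j. j < k \<Longrightarrow> e j \<in> V"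
  shows "\<exists>u\<in>orth e k. B u u = 1 \<and> (\<forall>v\<in>orth e k. A u u * B v v \<le> A v v)"
proof -
  let ?W = "orth e k"
  have WV: "w \<in> V" if "w \<in> ?W" for w using that by (simp add: orth_def)
  have sW: "subspace ?W" by (rule orth_subspace[OF e])
  have normalise: "\<exists>w'\<in>?W. B w' w' = 1 \<and> A w' w' = A w w / B w w" if "w \<in> ?W" "B w w > 0" for w
  proof -
    let ?w = "(1 / sqrt (B w w)) *\<^sub>R w"
    have "?w \<in> ?W" using that subspace_scale[OF sW] by blast
    moreover have "B ?w ?w = 1" "A ?w ?w = A w w / B w w"
      using that WV[OF that(1)] by (simp_all add: B.bilin A.bilin)
    ultimately show ?thesis by blast
  qed
  obtain f where f: "\<And>i. i < Suc k \<Longrightarrow> f i \<in> V" and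
    find: "\<And>c. B (\<Sum>i<Suc k. c i *\<^sub>R f i) (\<Sum>i<Suc k. c i *\<^sub>R f i) = 0 \<Longrightarrow> (\<forall>i<Suc k. c i = 0)"
    using infinite_dim[of "Suc k"] by blast
  obtain c where c: "\<exists>i<Suc k. c i \<noteq> 0" "(\<Sum>i<Suc k. c i *\<^sub>R f i) \<in> ?W"
    using orth_nontrivial[where k = k and e = e and f = f] e f by blast
  have "B (\<Sum>i<Suc k. c i *\<^sub>R f i) (\<Sum>i<Suc k. c i *\<^sub>R f i) > 0"
    using find[of c] c B.nonneg[OF WV[OF c(2)]] by (metis less_le)
  with normalise[OF c(2)] obtain w0 where w0: "w0 \<in> ?W" "B w0 w0 = 1" by blast
  define S where "S = {A v v |v. v \<in> ?W \<and> B v v = 1}"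
  define m where "m = Inf S"
  have S: "S \<noteq> {}" "bdd_below S"
    using w0 WV by (auto simp: S_def intro!: bdd_belowI[of _ 0] A.nonneg)
  have low: "m * B v v \<le> A v v" if "v \<in> ?W" for v
  proof (cases "B v v = 0")
    case True
    then show ?thesis using A.nonneg WV that by simp
  next
    case False
    then have pos: "B v v > 0" using B.nonneg WV[OF that] by (metis less_le)
    from normalise[OF that pos] have "A v v / B v v \<in> S"
      unfolding S_def by (smt (verit) mem_Collect_eq)
    then have "m \<le> A v v / B v v" unfolding m_def by (rule cInf_lower[OF _ S(2)])
    then show ?thesis using pos by (simp add: field_simps)
  qed
  have "\<exists>v\<in>?W. B v v = 1 \<and> A v v < m + 1 / real (Suc n)" for n
  proof -
    have "\<exists>x\<in>S. x < m + 1 / real (Suc n)"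
      using cInf_less_iff[OF S, of "m + 1 / real (Suc n)"] by (simp add: m_def)
    then show ?thesis by (auto simp: S_def)
  qed
  then obtain s where s: "\<And>n. s n \<in> ?W" "\<And>n. B (s n) (s n) = 1"
    "\<And>n. A (s n) (s n) < m + 1 / real (Suc n)" by metis
  have "A (s n) (s n) \<le> m + 1" for n
  proof -
    have "1 / real (Suc n) \<le> 1" by simp
    then show ?thesis using s(3)[of n] by linarith
  qed
  from A_B_compact[where s = s and M = "m + 1", OF WV[OF s(1)] this] obtain r :: "nat \<Rightarrow> nat"
      where r: "strict_mono r"
    "\<And>e. e > 0 \<Longrightarrow> \<exists>N. \<forall>i\<ge>N. \<forall>j\<ge>N. B (s (r i) - s (r j)) (s (r i) - s (r j)) < e" by blast
  define t where "t n = s (r n)" for n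
  have t: "t n \<in> ?W" "t n \<in> V" "B (t n) (t n) = 1" "m \<le> A (t n) (t n)"
      "A (t n) (t n) \<le> m + 1 / real (Suc n)" for n
  proof -
    show "t n \<in> ?W" "t n \<in> V" "B (t n) (t n) = 1" using s WV by (auto simp: t_def)
    then show "m \<le> A (t n) (t n)" using low[of "t n"] by simp
    have "n \<le> r n" using r(1) by (rule seq_suble)
    then have "1 / real (Suc (r n)) \<le> 1 / real (Suc n)" by (simp add: frac_le)
    then show "A (t n) (t n) \<le> m + 1 / real (Suc n)" using s(3)[of "r n"] by (simp add: t_def)
  qed
  have m0: "0 \<le> m" unfolding m_def
    using S WV A.nonneg by (intro cInf_greatest) (auto simp: S_def)
  \<comment> \<open>Parallelogram law for \<open>A\<close> and \<open>B\<close>, with \<open>low\<close> applied to the sum of both vectors.\<close>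
  have para: "A (t i - t j) (t i - t j) \<le> 2 / real (Suc i) + 2 / real (Suc j)
      + m * B (t i - t j) (t i - t j)" for i j
  proof -
    have "m * B (t i + t j) (t i + t j) \<le> A (t i + t j) (t i + t j)"
      using t subspace_add[OF sW] by (intro low) auto
    moreover have "A (t i + t j) (t i + t j) + A (t i - t j) (t i - t j)
        = 2 * A (t i) (t i) + 2 * A (t j) (t j)"
      using t(2)[of i] t(2)[of j] by (simp add: A.bilin)
    moreover have "B (t i + t j) (t i + t j) = 4 - B (t i - t j) (t i - t j)"
      using t(2)[of i] t(2)[of j] t(3) by (simp add: B.bilin)
    ultimately show ?thesis using t(5)[of i] t(5)[of j]
      by (simp add: right_diff_distrib)
  qed
  have "\<exists>N. \<forall>i\<ge>N. \<forall>j\<ge>N. A (t i - t j) (t i - t j) < e" if "e > 0" for e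
  proof -
    have "0 < e / (2 * (m + 1))" using m0 that by simp
    from r(2)[OF this] obtain N1 where
      N1: "\<forall>i\<ge>N1. \<forall>j\<ge>N1. B (t i - t j) (t i - t j) < e / (2 * (m + 1))"
      unfolding t_def by blast
    have "0 < e / 8" using that by simp
    from reals_Archimedean[OF this] obtain N2 where N2: "inverse (real (Suc N2)) < e / 8" by blast
    show ?thesis
    proof (intro exI[of _ "max N1 N2"] allI impI)
      fix i j assume ij: "max N1 N2 \<le> i" "max N1 N2 \<le> j"
      then have "2 / real (Suc i) \<le> 2 / real (Suc N2)" "2 / real (Suc j) \<le> 2 / real (Suc N2)"
        by (auto intro!: divide_left_mono)
      moreover have "2 / real (Suc N2) < e / 4" using N2 by (simp add: inverse_eq_divide)
      moreover have "m * B (t i - t j) (t i - t j) \<le> e / 2"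
      proof -
        have "m * B (t i - t j) (t i - t j) \<le> (m + 1) * (e / (2 * (m + 1)))"
          using N1 ij m0 t B.nonneg[of "t i - t j"] by (intro mult_mono) (auto simp: less_imp_le)
        also have "\<dots> = e / 2" using m0 by (simp add: field_simps)
        finally show ?thesis .
      qed
      ultimately show "A (t i - t j) (t i - t j) < e" using para[of i j] by linarith
    qed
  qed
  from A_complete[where s = t, OF t(2) this] obtain u where u: "u \<in> V"
    and Alim: "(\<lambda>n. A (t n - u) (t n - u)) \<longlonglongrightarrow> 0" by blast
  have Blim: "(\<lambda>n. B (t n - u) (t n - u)) \<longlonglongrightarrow> 0"
    using t u B_le_A B.nonneg
    by (intro Lim_null_comparison[OF _ Alim]) (auto intro!: always_eventually)
  have "B u (e j) = 0" if "j < k" for j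
  proof -
    have "(\<lambda>n. B (t n) (e j)) \<longlonglongrightarrow> B u (e j)"
      using B.tendsto_form_left[OF t(2) u e[OF that] Blim] .
    moreover have "(\<lambda>n. B (t n) (e j)) = (\<lambda>n. 0)" using t(1) that by (auto simp: orth_def)
    ultimately show ?thesis using LIMSEQ_unique tendsto_const by metis
  qed
  then have uW: "u \<in> ?W" using u by (simp add: orth_def)
  have "(\<lambda>n. B (t n) (t n)) \<longlonglongrightarrow> B u u"
    using B.tendsto_form[OF t(2) u Blim t(2) u Blim] .
  then have Bu: "B u u = 1" using t(3) by (simp add: LIMSEQ_const_iff)
  have "(\<lambda>n. A (t n) (t n)) \<longlonglongrightarrow> A u u"
    using A.tendsto_form[OF t(2) u Alim t(2) u Alim] .
  moreover have "(\<lambda>n. m + 1 / real (Suc n)) \<longlonglongrightarrow> m + 0"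
    by (intro tendsto_intros LIMSEQ_Suc[OF lim_1_over_n])
  ultimately have "A u u \<le> m" using t(5) by (intro LIMSEQ_le) auto
  then show ?thesis using low uW Bu B.nonneg WV
    by (intro bexI[of _ u]) (auto intro: order_trans[OF mult_right_mono])
qed

text \<open>Each \<open>e k\<close> minimises the Rayleigh quotient on the orthogonal complement of its
  predecessors. On that complement \<open>A - m k B\<close> is semidefinite and vanishes at \<open>e k\<close>, so the
  Cauchy-Schwarz inequality yields the eigenvalue equation there; on the predecessors it holds
  by symmetry. If the values \<open>m k\<close> were bounded, compactness would give a \<open>B\<close>-Cauchy sequence of
  orthonormal vectors.\<close>

theorem spectral:
  "\<exists>e m. (\<forall>k. e k \<in> V) \<and> (\<forall>i j. B (e i) (e j) = (if i = j then 1 else 0)) \<and>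
    (\<forall>k. \<forall>v\<in>V. A (e k) v = m k * B (e k) v) \<and>
    mono m \<and> filterlim m at_top sequentially \<and>
    (\<forall>k. \<forall>v\<in>orth e k. m k * B v v \<le> A v v)"
proof -
  define P where "P e k u \<longleftrightarrow> u \<in> orth e k \<and> B u u = 1 \<and> (\<forall>v\<in>orth e k. A u u * B v v \<le> A v v)"
    for e k u
  have "\<exists>e. \<forall>k. P e k (e k)"
  \<comment> \<open>The choice of \<open>e k\<close> depends on the earlier vectors only.\<close>
  proof (rule dependent_wf_choice[OF wf_less])
    fix k and f g :: "nat \<Rightarrow> 'v" and u
    assume "\<And>j. (j, k) \<in> {(x, y). x < y} \<Longrightarrow> f j = g j"
    then have "orth f k = orth g k" by (auto simp: orth_def)
    then show "P f k u = P g k u" by (simp add: P_def)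
  next
    fix k and f :: "nat \<Rightarrow> 'v"
    assume "\<And>j. (j, k) \<in> {(x, y). x < y} \<Longrightarrow> P f j (f j)"
    then have "f j \<in> V" if "j < k" for j using that by (auto simp: P_def orth_def)
    from rayleigh_minimizer[where e = f and k = k] this show "\<exists>u. P f k u" unfolding P_def by blast
  qed
  then obtain e where e: "\<And>k. P e k (e k)" by blast
  define m where "m k = A (e k) (e k)" for k
  have eV: "e k \<in> V" for k using e[of k] by (simp add: P_def orth_def)
  have norm: "B (e k) (e k) = 1" for k using e[of k] by (simp add: P_def)
  have low: "m k * B v v \<le> A v v" if "v \<in> orth e k" for k v
    using e[of k] that by (simp add: P_def m_def)
  have lt: "B (e k) (e j) = 0" if "j < k" for j k using e[of k] that by (simp add: P_def orth_def)
  have ortho: "B (e i) (e j) = (if i = j then 1 else 0)" for i j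
    using lt[of i j] lt[of j i] norm B.sym[OF eV eV, of i j]
        by (cases i j rule: linorder_cases) auto
  have "m k \<le> m (Suc k)" for k
  proof -
    have "e (Suc k) \<in> orth e k" using eV lt by (auto simp: orth_def)
    from low[OF this] show ?thesis by (simp add: norm m_def)
  qed
  then have mono: "mono m" by (simp add: mono_iff_le_Suc)
  have EL: "A (e k) v = m k * B (e k) v" if "v \<in> V" for k v
    using that
  proof (induction k arbitrary: v rule: less_induct)
    case (less k)
    have WV: "w \<in> V" if "w \<in> orth e k" for w using that by (simp add: orth_def)
    interpret D: semidefinite_form "orth e k" "\<lambda>u v. A u v - m k * B u v"
    proof
      show "subspace (orth e k)" by (rule orth_subspace[OF eV])
      show "A u v - m k * B u v = A v u - m k * B v u" if "u \<in> orth e k" "v \<in> orth e k" for u v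
        using WV that by (simp add: A.sym[of u] B.sym[of u])
    qed (use WV low in \<open>auto simp: A.bilin B.bilin algebra_simps\<close>)
    have ek: "e k \<in> orth e k" using eV lt by (auto simp: orth_def)
    have on_orth: "A (e k) w = m k * B (e k) w" if "w \<in> orth e k" for w
      using D.Cauchy_Schwarz[OF ek that] by (simp add: m_def norm)
    define p where "p = (\<Sum>j<k. B v (e j) *\<^sub>R e j)"
    have pV: "p \<in> V" using eV by (auto simp: p_def)
    have "B p (e j) = B v (e j)" if "j < k" for j
    proof -
      have "B p (e j) = (\<Sum>i<k. B v (e i) * B (e i) (e j))" unfolding p_def
        using eV by (intro B.sum_left) auto
      also have "\<dots> = (\<Sum>i<k. if i = j then B v (e j) else 0)"
        by (intro sum.cong) (auto simp: ortho)
      also have "\<dots> = B v (e j)" using that by simp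
      finally show ?thesis .
    qed
    then have "v - p \<in> orth e k" using less.prems pV eV by (auto simp: orth_def B.bilin)
    from on_orth[OF this] have "A (e k) v - A (e k) p = m k * (B (e k) v - B (e k) p)"
      using less.prems pV eV by (simp add: A.bilin B.bilin)
    moreover have "A (e k) (e j) = 0" if "j < k" for j
      using less.IH[OF that eV[of k]] lt[OF that] A.sym[OF eV eV, of j k] B.sym[OF eV eV, of j k]
      by simp
    then have "A (e k) p = 0" "B (e k) p = 0"
      using eV lt by (simp_all add: p_def A.sum_right B.sum_right)
    ultimately show ?case by simp
  qed
  have "\<exists>k. K < m k" for K
  proof (rule ccontr)
    assume "\<not> (\<exists>k. K < m k)"
    then have "A (e k) (e k) \<le> K" for k by (auto simp: m_def not_less)
    from A_B_compact[where s = e and M = K, OF eV this] obtain r :: "nat \<Rightarrow> nat"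
        where r: "strict_mono r"
      "\<And>c. c > 0 \<Longrightarrow> \<exists>N. \<forall>i\<ge>N. \<forall>j\<ge>N. B (e (r i) - e (r j)) (e (r i) - e (r j)) < c" by blast
    from r(2)[of 1] obtain N where
      "\<forall>i\<ge>N. \<forall>j\<ge>N. B (e (r i) - e (r j)) (e (r i) - e (r j)) < 1" by auto
    then have "B (e (r N) - e (r (Suc N))) (e (r N) - e (r (Suc N))) < 1"
      by (meson le_refl le_SucI)
    moreover have "r N \<noteq> r (Suc N)" using r(1) by
        (auto simp: strict_mono_Suc_iff dest: less_not_refl3)
    ultimately show False using eV by (simp add: B.bilin ortho)
  qed
  then have "filterlim m at_top sequentially"
    using mono unfolding filterlim_at_top eventually_sequentially
    by (meson less_imp_le monoD order_trans)
  then show ?thesis using eV ortho EL mono low by blast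
qed

text \<open>Completeness of the eigenvectors. What remains of an eigenvector after projecting to the
  span of the \<open>e j\<close> of the same eigenvalue is an eigenvector that is orthogonal to all \<open>e k\<close>.
  Its Rayleigh quotient \<open>\<mu>\<close> would then be at least \<open>m k\<close> for every \<open>k\<close>, unless it is null, but
  \<open>m\<close> is unbounded.\<close>

lemma eigenvector_expansion:
  assumes e: "\<And>k. e k \<in> V" "\<And>i j. B (e i) (e j) = (if i = j then 1 else 0)"
    and EL: "\<And>k v. v \<in> V \<Longrightarrow> A (e k) v = m k * B (e k) v"
    and m: "filterlim m at_top sequentially" "\<And>k v. v \<in> orth e k \<Longrightarrow> m k * B v v \<le> A v v"
    and u: "u \<in> V" "\<And>v. v \<in> V \<Longrightarrow> A u v = \<mu> * B u v"
  shows "finite {j. m j = \<mu>}"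
    and "B (u - (\<Sum>j\<in>{j. m j = \<mu>}. B u (e j) *\<^sub>R e j)) (u - (\<Sum>j\<in>{j. m j = \<mu>}. B u (e j) *\<^sub>R e j))
        = 0"
proof -
  let ?S = "{j. m j = \<mu>}"
  have "\<forall>\<^sub>F k in sequentially. \<mu> + 1 \<le> m k" using m(1) by (auto simp: filterlim_at_top)
  then obtain N where N: "\<And>k. k \<ge> N \<Longrightarrow> \<mu> + 1 \<le> m k" by (auto simp: eventually_sequentially)
  have "?S \<subseteq> {..<N}" using N by (force simp: not_less[symmetric])
  then show fin: "finite ?S" by (rule finite_subset) simp
  define p where "p = (\<Sum>j\<in>?S. B u (e j) *\<^sub>R e j)"
  have pV: "p \<in> V" unfolding p_def using e by blast
  define r where "r = u - p"
  have rV: "r \<in> V" unfolding r_def using u pV by (intro B.closed)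
  have Ap: "A p v = \<mu> * B p v" if "v \<in> V" for v
  proof -
    have "A p v = (\<Sum>j\<in>?S. B u (e j) * A (e j) v)"
      unfolding p_def using e that by (intro A.sum_left)
    also have "\<dots> = (\<Sum>j\<in>?S. \<mu> * (B u (e j) * B (e j) v))"
      using EL[OF that] by (intro sum.cong) auto
    also have "\<dots> = \<mu> * B p v"
      unfolding p_def using e that by (subst B.sum_left) (auto simp: sum_distrib_left)
    finally show ?thesis .
  qed
  have Ar: "A r v = \<mu> * B r v" if "v \<in> V" for v
    using that u pV Ap[OF that] unfolding r_def by (simp add: A.diff_left B.diff_left
        right_diff_distrib)
  have re: "B r (e k) = 0" for k
  proof (cases "k \<in> ?S")
    case True
    have "B p (e k) = (\<Sum>j\<in>?S. B u (e j) * B (e j) (e k))"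
      unfolding p_def using e by (intro B.sum_left)
    also have "\<dots> = (\<Sum>j\<in>?S. if j = k then B u (e k) else 0)"
      by (intro sum.cong) (auto simp: e(2))
    also have "\<dots> = B u (e k)" using True fin by simp
    finally show ?thesis unfolding r_def using u pV e by (simp add: B.diff_left)
  next
    case False
    have "\<mu> * B r (e k) = m k * B r (e k)"
      using Ar[OF e(1)] EL[OF rV] A.sym[OF rV e(1)] B.sym[OF rV e(1)] by metis
    then show ?thesis using False by simp
  qed
  then have "r \<in> orth e N" using rV by (simp add: orth_def)
  then have "m N * B r r \<le> \<mu> * B r r" using m(2) Ar[OF rV] by metis
  moreover have "0 \<le> B r r" using B.nonneg[OF rV] .
  then have "(\<mu> + 1) * B r r \<le> m N * B r r" using N[of N] by (intro mult_right_mono) auto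
  ultimately have "B r r = 0" using \<open>0 \<le> B r r\<close> by (simp add: distrib_right)
  then show "B (u - (\<Sum>j\<in>?S. B u (e j) *\<^sub>R e j)) (u - (\<Sum>j\<in>?S. B u (e j) *\<^sub>R e j)) = 0"
    by (simp add: r_def p_def)
qed

text \<open>The upper half of the min-max principle, for a test space with a basis that is orthogonal
  for both forms: some nonzero vector of the test space is orthogonal to \<open>e j\<close> for all \<open>j < k\<close>.\<close>

lemma eigenvalue_upper_bound:
  assumes e: "\<And>j. e j \<in> V" and low: "\<And>v. v \<in> orth e k \<Longrightarrow> m * B v v \<le> A v v"
    and f: "\<And>i. i \<le> k \<Longrightarrow> f i \<in> V"
    and orthA: "\<And>i j. \<lbrakk>i \<le> k; j \<le> k; i \<noteq> j\<rbrakk> \<Longrightarrow> A (f i) (f j) = 0"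
    and orthB: "\<And>i j. \<lbrakk>i \<le> k; j \<le> k; i \<noteq> j\<rbrakk> \<Longrightarrow> B (f i) (f j) = 0"
    and pos: "\<And>i. i \<le> k \<Longrightarrow> B (f i) (f i) > 0"
    and bound: "\<And>i. i \<le> k \<Longrightarrow> A (f i) (f i) \<le> C * B (f i) (f i)"
  shows "m \<le> C"
proof -
  obtain c where c: "\<exists>i<Suc k. c i \<noteq> 0" "(\<Sum>i<Suc k. c i *\<^sub>R f i) \<in> orth e k"
    using orth_nontrivial[where k = k and e = e and f = f] e f by
        (auto simp: less_Suc_eq_le simp del: sum.lessThan_Suc)
  define u where "u = (\<Sum>i<Suc k. c i *\<^sub>R f i)"
  have uV: "u \<in> V" using c(2) by (simp add: u_def orth_def)
  have quad: "F u u = (\<Sum>i<Suc k. (c i)\<^sup>2 * F (f i) (f i))"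
    if F: "semidefinite_form V F"
      and o: "\<And>i j. \<lbrakk>i \<le> k; j \<le> k; i \<noteq> j\<rbrakk> \<Longrightarrow> F (f i) (f j) = 0" for F
  proof -
    interpret F: semidefinite_form V F by fact
    have 1: "F (f i) u = c i * F (f i) (f i)" if "i < Suc k" for i
    proof -
      have "F (f i) u = (\<Sum>j<Suc k. c j * F (f i) (f j))"
        unfolding u_def using f that by (intro F.sum_right) auto
      also have "\<dots> = (\<Sum>j<Suc k. if i = j then c i * F (f i) (f i) else 0)"
        using o that by (intro sum.cong) auto
      finally show ?thesis using that by simp
    qed
    have "F u u = (\<Sum>i<Suc k. c i * F (f i) u)"
      using F.sum_left[of "{..<Suc k}" f u c] f uV by (simp add: u_def del: sum.lessThan_Suc)
    also have "\<dots> = (\<Sum>i<Suc k. (c i)\<^sup>2 * F (f i) (f i))"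
      using 1 by (intro sum.cong) (auto simp: power2_eq_square)
    finally show ?thesis .
  qed
  have QA: "A u u = (\<Sum>i<Suc k. (c i)\<^sup>2 * A (f i) (f i))"
    by (rule quad[OF A.semidefinite_form_axioms orthA])
  have QB: "B u u = (\<Sum>i<Suc k. (c i)\<^sup>2 * B (f i) (f i))"
    by (rule quad[OF B.semidefinite_form_axioms orthB])
  obtain i where i: "i < Suc k" "c i \<noteq> 0" using c by blast
  have "B u u > 0" unfolding QB
  proof (rule sum_pos2[OF _ _ ])
    show "i \<in> {..<Suc k}" using i by simp
    show "0 < (c i)\<^sup>2 * B (f i) (f i)" using i pos[of i] by simp
    show "0 \<le> (c i)\<^sup>2 * B (f i) (f i)" if "i \<in> {..<Suc k}" for i
      using pos[of i] that by simp
  qed simp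
  moreover have "A u u \<le> C * B u u" unfolding QA QB sum_distrib_left
  proof (rule sum_mono)
    fix i assume "i \<in> {..<Suc k}"
    then have "(c i)\<^sup>2 * A (f i) (f i) \<le> (c i)\<^sup>2 * (C * B (f i) (f i))"
      by (intro mult_left_mono bound) auto
    then show "(c i)\<^sup>2 * A (f i) (f i) \<le> C * ((c i)\<^sup>2 * B (f i) (f i))"
      by (simp add: mult.left_commute)
  qed
  moreover have "m * B u u \<le> A u u" using low c(2) by (simp add: u_def)
  ultimately show ?thesis by (meson mult_right_le_imp_le order_trans)
qed

end

section \<open>Calculus of smooth functions\<close>

lemma partial_eq: "(f has_derivative f') (at x) \<Longrightarrow> partial b f x = f' b"
  unfolding partial_def using frechet_derivative_at by metis

lemma C_k_differentiable: "C_k (Suc n) f \<Longrightarrow> f differentiable (at x)"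
  by (auto simp: differentiable_on_def)

lemma C_k_has_derivative: "C_k (Suc n) f \<Longrightarrow> (f has_derivative (\<lambda>v. partial v f x)) (at x)"
  unfolding partial_def using C_k_differentiable frechet_derivative_works by fastforce

lemma C_k_Suc_I:
  assumes "\<And>x. (f has_derivative f' x) (at x)" "\<And>b. b \<in> Basis \<Longrightarrow> C_k n (\<lambda>x. f' x b)"
  shows "C_k (Suc n) f"
proof -
  have "partial b f = (\<lambda>x. f' x b)" for b
    using partial_eq[OF assms(1)] by blast
  then show ?thesis using assms
    by (auto simp: differentiable_on_def differentiable_def intro: has_derivative_at_withinI)
qed

lemma C_k_SucD: "C_k (Suc n) f \<Longrightarrow> C_k n f"
proof (induction n arbitrary: f)
  case 0
  then show ?case by (simp add: differentiable_imp_continuous_on)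
qed auto

lemma C_k_const: "C_k n (\<lambda>_. c)"
proof (induction n arbitrary: c)
  case (Suc n)
  show ?case by (rule C_k_Suc_I[where f' = "\<lambda>_ _. 0"]) (auto intro: Suc)
qed simp

lemma C_k_add: "C_k n f \<Longrightarrow> C_k n g \<Longrightarrow> C_k n (\<lambda>x. f x + g x)"
proof (induction n arbitrary: f g)
  case (Suc n)
  show ?case
    by (rule C_k_Suc_I[OF has_derivative_add[OF C_k_has_derivative[OF Suc.prems(1)]
            C_k_has_derivative[OF Suc.prems(2)]]])
      (use Suc in auto)
qed (auto intro: continuous_intros)

lemma C_k_mult: "C_k n f \<Longrightarrow> C_k n g \<Longrightarrow> C_k n (\<lambda>x. f x * g x)"
proof (induction n arbitrary: f g)
  case (Suc n)
  show ?case
    by (rule C_k_Suc_I[OF has_derivative_mult[OF C_k_has_derivative[OF Suc.prems(1)]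
            C_k_has_derivative[OF Suc.prems(2)]]])
      (intro C_k_add Suc.IH C_k_SucD[OF Suc.prems(1)] C_k_SucD[OF Suc.prems(2)];
        use Suc.prems in simp)
qed (auto intro: continuous_intros)

lemma C_k_inner: "C_k n (\<lambda>x. x \<bullet> b)"
proof (cases n)
  case (Suc m)
  show ?thesis unfolding Suc
    by (rule C_k_Suc_I[where f' = "\<lambda>_ v. v \<bullet> b"])
      (auto intro!: C_k_const derivative_eq_intros)
qed (auto intro: continuous_intros)

lemma C_k_sum: "(\<And>i. i \<in> I \<Longrightarrow> C_k n (f i)) \<Longrightarrow> C_k n (\<lambda>x. \<Sum>i\<in>I. f i x)"
  by (induction I rule: infinite_finite_induct) (auto intro: C_k_const C_k_add)

lemma C_k_prod: "(\<And>i. i \<in> I \<Longrightarrow> C_k n (f i)) \<Longrightarrow> C_k n (\<lambda>x. \<Prod>i\<in>I. f i x)"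
  by (induction I rule: infinite_finite_induct) (auto intro: C_k_const C_k_mult)

lemma C_k_diff: "C_k n f \<Longrightarrow> C_k n g \<Longrightarrow> C_k n (\<lambda>x. f x - g x)"
  using C_k_add[of n f "\<lambda>x. (-1) * g x"] C_k_mult[OF C_k_const[of n "-1"], of g] by simp

text \<open>The chain rule produces \<open>G (Suc n)\<close> from \<open>G n\<close>, so the induction needs the outer function
  together with all its derivatives.\<close>

lemma C_k_compose:
  fixes G :: "nat \<Rightarrow> real \<Rightarrow> real"
  assumes G: "\<And>n t. (G n has_real_derivative G (Suc n) t) (at t)" and q: "C_k k q"
  shows "C_k k (\<lambda>x. G n (q x))"
  using q
proof (induction k arbitrary: n q)
  case 0
  have "continuous_on UNIV (G n)"
    using G DERIV_isCont continuous_at_imp_continuous_on by blast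
  with 0 show ?case by (simp add: continuous_on_compose2[of UNIV "G n" UNIV q])
next
  case (Suc k)
  have "((\<lambda>x. G n (q x)) has_derivative (\<lambda>v. G (Suc n) (q x) * partial v q x)) (at x)" for x
    using has_derivative_compose[OF C_k_has_derivative[OF Suc.prems]
        G[of n "q x", unfolded has_field_derivative_def]]
    by simp
  then show ?case
    by (rule C_k_Suc_I) (intro C_k_mult Suc.IH C_k_SucD[OF Suc.prems]; use Suc.prems in simp)
qed

lemma partial_add:
  "C_k (Suc 0) f \<Longrightarrow> C_k (Suc 0) g \<Longrightarrow> partial b (\<lambda>x. f x + g x) x = partial b f x + partial b g x"
  by (rule partial_eq[OF has_derivative_add]) (rule C_k_has_derivative, assumption)+

lemma partial_mult:
  "C_k (Suc 0) f \<Longrightarrow> C_k (Suc 0) g \<Longrightarrow>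
    partial b (\<lambda>x. f x * g x) x = f x * partial b g x + partial b f x * g x"
  by (rule partial_eq[OF has_derivative_mult]) (rule C_k_has_derivative, assumption)+

lemma partial_scale: "C_k (Suc 0) f \<Longrightarrow> partial b (\<lambda>x. c * f x) x = c * partial b f x"
  by (rule partial_eq[OF has_derivative_mult_right]) (rule C_k_has_derivative, assumption)

section \<open>Test functions\<close>

lemma test_functionI:
  assumes "\<And>n. C_k n \<phi>" "compact K" "K \<subseteq> \<Omega>" "\<And>x. x \<notin> K \<Longrightarrow> \<phi> x = 0"
  shows "\<phi> \<in> test_functions \<Omega>"
proof -
  have "closure {x. \<phi> x \<noteq> 0} \<subseteq> K"
    using assms by (intro closure_minimal compact_imp_closed) auto
  then show ?thesis
    using assms closed_Int_compact[OF closed_closure, of K "{x. \<phi> x \<noteq> 0}"]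
    by (auto simp: test_functions_def inf.absorb1)
qed

lemma test_function_smooth: "\<phi> \<in> test_functions \<Omega> \<Longrightarrow> C_k n \<phi>"
  by (simp add: test_functions_def)

lemma test_function_support:
  assumes "\<phi> \<in> test_functions \<Omega>"
  obtains K where "compact K" "K \<subseteq> \<Omega>" "\<And>x. x \<notin> K \<Longrightarrow> \<phi> x = 0"
proof (rule that)
  show "compact (closure {x. \<phi> x \<noteq> 0})" "closure {x. \<phi> x \<noteq> 0} \<subseteq> \<Omega>"
    using assms by (auto simp: test_functions_def)
  show "\<phi> x = 0" if "x \<notin> closure {x. \<phi> x \<noteq> 0}" for x
    using that closure_subset[of "{x. \<phi> x \<noteq> 0}"] by blast
qed

lemma test_function_zero: "(\<lambda>_. 0) \<in> test_functions \<Omega>"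
  by (rule test_functionI[where K = "{}"]) (auto simp: C_k_const)

lemma test_function_add:
  assumes "\<phi> \<in> test_functions \<Omega>" "\<psi> \<in> test_functions \<Omega>"
  shows "(\<lambda>x. \<phi> x + \<psi> x) \<in> test_functions \<Omega>"
proof -
  obtain K where K: "compact K" "K \<subseteq> \<Omega>" "\<And>x. x \<notin> K \<Longrightarrow> \<phi> x = 0"
    using test_function_support[OF assms(1)] by metis
  obtain L where L: "compact L" "L \<subseteq> \<Omega>" "\<And>x. x \<notin> L \<Longrightarrow> \<psi> x = 0"
    using test_function_support[OF assms(2)] by metis
  show ?thesis
    by (rule test_functionI[OF C_k_add[OF assms[THEN test_function_smooth]]
          compact_Un[OF K(1) L(1)]])
      (use K L in auto)
qed

lemma test_function_mult:
  assumes "\<And>n. C_k n f" "\<psi> \<in> test_functions \<Omega>"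
  shows "(\<lambda>x. f x * \<psi> x) \<in> test_functions \<Omega>"
proof -
  obtain L where L: "compact L" "L \<subseteq> \<Omega>" "\<And>x. x \<notin> L \<Longrightarrow> \<psi> x = 0"
    using test_function_support[OF assms(2)] by metis
  show ?thesis
    by (rule test_functionI[OF C_k_mult[OF assms(1) test_function_smooth[OF assms(2)]] L(1,2)])
      (simp add: L(3))
qed

lemma test_function_scale:
  "\<psi> \<in> test_functions \<Omega> \<Longrightarrow> (\<lambda>x. c * \<psi> x) \<in> test_functions \<Omega>"
  by (rule test_function_mult[OF C_k_const])

lemma test_function_diff:
  assumes "\<phi> \<in> test_functions \<Omega>" "\<psi> \<in> test_functions \<Omega>"
  shows "(\<lambda>x. \<phi> x - \<psi> x) \<in> test_functions \<Omega>"
  using test_function_add[OF assms(1) test_function_scale[OF assms(2), of "-1"]] by simp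

lemma partial_eq_0_off_support:
  assumes "compact K" "\<And>x. x \<notin> K \<Longrightarrow> \<phi> x = 0" "x \<notin> K"
  shows "partial b \<phi> x = 0"
proof (rule partial_eq)
  have "open (- K)" using compact_imp_closed[OF assms(1)] by (simp add: open_Compl)
  moreover have "((\<lambda>_. 0::real) has_derivative (\<lambda>_. 0)) (at x)" by simp
  ultimately show "(\<phi> has_derivative (\<lambda>_. 0)) (at x)"
    by (elim has_derivative_transform_within_open[where s = "- K"]) (use assms in auto)
qed

lemma test_function_partial:
  assumes "\<phi> \<in> test_functions \<Omega>" "b \<in> Basis"
  shows "partial b \<phi> \<in> test_functions \<Omega>"
proof -
  obtain L where L: "compact L" "L \<subseteq> \<Omega>" "\<And>x. x \<notin> L \<Longrightarrow> \<phi> x = 0"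
    using test_function_support[OF assms(1)] by metis
  have "C_k n (partial b \<phi>)" for n
    using test_function_smooth[OF assms(1), of "Suc n"] assms(2) by simp
  then show ?thesis
    by (rule test_functionI[OF _ L(1,2)]) (rule partial_eq_0_off_support[OF L(1,3)])
qed

section \<open>Smooth bumps\<close>

text \<open>The functions \<open>p(1/t) exp(-1/t)\<close>, extended by zero to \<open>t \<le> 0\<close>. This class contains the
  usual smooth transition function and is closed under differentiation.\<close>

definition flat_exp :: "real poly \<Rightarrow> real \<Rightarrow> real"
  where "flat_exp p t = (if t > 0 then poly p (1 / t) * exp (- (1 / t)) else 0)"

lemma poly_times_exp_minus_tendsto_0: "((\<lambda>y. poly p y * exp (- y)) \<longlongrightarrow> (0::real)) at_top"
proof -
  have "((\<lambda>y. \<Sum>i\<le>degree p. coeff p i * (y ^ i / exp y)) \<longlongrightarrow> (\<Sum>i\<le>degree p. coeff p i * 0)) at_top"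
    by (intro tendsto_intros tendsto_power_div_exp_0)
  moreover have "(\<lambda>y. \<Sum>i\<le>degree p. coeff p i * (y ^ i / exp y)) = (\<lambda>y. poly p y * exp (- y))"
    by (auto simp: poly_altdef sum_distrib_right sum_distrib_left exp_minus divide_inverse mult_ac)
  ultimately show ?thesis by simp
qed

lemma flat_exp_deriv:
  "(flat_exp p has_real_derivative flat_exp ([:0, 0, 1:] * (p - pderiv p)) t) (at t)"
proof (cases t "0::real" rule: linorder_cases)
  case greater
  have d: "((\<lambda>t. 1 / t) has_real_derivative - ((1 / t) * (1 / t))) (at t)"
    using greater DERIV_inverse[of t] by (simp add: inverse_eq_divide power2_eq_square)
  have "((\<lambda>t. poly p (1 / t) * exp (- (1 / t))) has_real_derivative
      flat_exp ([:0, 0, 1:] * (p - pderiv p)) t) (at t)"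
    by (rule DERIV_cong[OF DERIV_mult[OF DERIV_chain2[OF poly_DERIV d]
            DERIV_chain2[OF DERIV_exp DERIV_minus[OF d]]]])
      (use greater in \<open>simp add: flat_exp_def algebra_simps\<close>)
  moreover have "open {0::real<..}" by simp
  ultimately show ?thesis
    using greater
    by (elim has_field_derivative_transform_within_open[where S = "{0<..}"])
        (auto simp: flat_exp_def)
next
  case less
  have "((\<lambda>t. 0) has_real_derivative flat_exp ([:0, 0, 1:] * (p - pderiv p)) t) (at t)"
    using less by (simp add: flat_exp_def)
  then show ?thesis
    using less
    by (elim has_field_derivative_transform_within_open[where S = "{..<0}"])
        (auto simp: flat_exp_def)
next
  case equal
  have "((\<lambda>h. flat_exp p h / h) \<longlongrightarrow> 0) (at 0)"
  proof (rule filterlim_split_at)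
    have "((\<lambda>h. 0) \<longlongrightarrow> (0::real)) (at_left 0)" by simp
    then show "((\<lambda>h. flat_exp p h / h) \<longlongrightarrow> 0) (at_left 0)"
      by (rule Lim_transform_eventually) (auto simp: eventually_at_filter flat_exp_def)
    have "((\<lambda>h. poly ([:0, 1:] * p) (inverse h) * exp (- (inverse h))) \<longlongrightarrow> 0) (at_right (0::real))"
      by (rule filterlim_compose[OF poly_times_exp_minus_tendsto_0 filterlim_inverse_at_top_right])
    then show "((\<lambda>h. flat_exp p h / h) \<longlongrightarrow> 0) (at_right 0)"
      by (rule Lim_transform_eventually)
        (auto simp: eventually_at_filter flat_exp_def field_simps)
  qed
  then show ?thesis using equal by (simp add: DERIV_def flat_exp_def)
qed

definition bump :: "real \<Rightarrow> real"
  where "bump = flat_exp 1"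

lemma bump_eq: "bump t = (if t > 0 then exp (- (1 / t)) else 0)"
  by (simp add: bump_def flat_exp_def)

lemma bump_nonneg: "bump t \<ge> 0" and bump_le_1: "bump t \<le> 1"
  by (auto simp: bump_eq)

lemma bump_zero_iff: "bump t = 0 \<longleftrightarrow> t \<le> 0"
  by (auto simp: bump_eq)

lemma C_k_bump: "C_k k q \<Longrightarrow> C_k k (\<lambda>x. bump (q x))"
proof -
  define P where "P n = ((\<lambda>p. [:0, 0, 1:] * (p - pderiv p)) ^^ n) (1::real poly)" for n
  show "C_k k q \<Longrightarrow> C_k k (\<lambda>x. bump (q x))"
    using C_k_compose[of "\<lambda>n. flat_exp (P n)" k q 0] flat_exp_deriv
    by (simp add: P_def bump_def)
qed

lemma C_k_cos:
  assumes q: "C_k k q"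
  shows "C_k k (\<lambda>x. cos (q x))"
proof -
  have "((\<lambda>s. cos (s + real n * (pi / 2))) has_real_derivative cos (t
      + real (Suc n) * (pi / 2))) (at t)"
    for n t
  proof -
    have "t + real (Suc n) * (pi / 2) = (t + real n * (pi / 2)) + pi / 2" by
        (simp add: algebra_simps)
    then have "cos (t + real (Suc n) * (pi / 2)) = - sin (t + real n * (pi / 2))"
      by (simp only: cos_add) simp
    then show ?thesis by (auto intro!: derivative_eq_intros)
  qed
  from C_k_compose[where G = "\<lambda>n t. cos (t + real n * (pi / 2))" and n = 0, OF this q]
  show ?thesis by simp
qed

definition ball_bump :: "'a::euclidean_space \<Rightarrow> real \<Rightarrow> 'a \<Rightarrow> real"
  where "ball_bump a r x = bump (r\<^sup>2 - (norm (x - a))\<^sup>2)"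

lemma ball_bump_nonzero_iff: "r > 0 \<Longrightarrow> ball_bump a r x \<noteq> 0 \<longleftrightarrow> x \<in> ball a r"
  using power_mono_iff[of r "norm (x - a)" 2]
  by (auto simp: ball_bump_def bump_zero_iff dist_norm norm_minus_commute)

lemma ball_bump_test_function:
  assumes "r > 0" "cball a r \<subseteq> \<Omega>"
  shows "ball_bump a r \<in> test_functions \<Omega>"
proof (rule test_functionI[OF _ compact_cball assms(2)])
  have "(norm (x - a))\<^sup>2 = (\<Sum>b\<in>Basis. ((x - a) \<bullet> b) * ((x - a) \<bullet> b))" for x :: 'a
    by (simp add: power2_norm_eq_inner euclidean_inner[of "x - a" "x - a"])
  then have "ball_bump a r = (\<lambda>x. bump (r\<^sup>2 - (\<Sum>b\<in>Basis. (x \<bullet> b - a \<bullet> b) * (x \<bullet> b - a \<bullet> b))))"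
    by (simp add: ball_bump_def[abs_def] inner_diff_left)
  then show "C_k n (ball_bump a r)" for n
    by (auto intro!: C_k_bump C_k_diff C_k_const C_k_sum C_k_mult C_k_inner)
  show "ball_bump a r x = 0" if "x \<notin> cball a r" for x
    using ball_bump_nonzero_iff[OF assms(1), of a x] that by auto
qed

text \<open>If \<open>q\<close> is smooth and nonnegative, then \<open>bump (n q)\<close> converges pointwise to the indicator
  function of \<open>{q > 0}\<close>. For an open box a suitable \<open>q\<close> is a product of bumps in the
  coordinates.\<close>

lemma box_bumps:
  fixes a b :: "'a::euclidean_space"
  assumes sub: "cbox a b \<subseteq> \<Omega>"
  obtains \<phi> :: "nat \<Rightarrow> 'a \<Rightarrow> real" where "\<And>n. \<phi> n \<in> test_functions \<Omega>"
    "\<And>n x. \<bar>\<phi> n x\<bar> \<le> 1" "\<And>x. (\<lambda>n. \<phi> n x) \<longlonglongrightarrow> indicator (box a b) x"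
proof (cases "box a b = {}")
  case True
  show thesis
    by (rule that[of "\<lambda>_ _. 0"]) (use True in \<open>auto simp: test_function_zero\<close>)
next
  case False
  then have ab: "a \<bullet> i < b \<bullet> i" if "i \<in> Basis" for i using that by (auto simp: box_ne_empty)
  define q where "q x = (\<Prod>i\<in>Basis. bump ((x \<bullet> i - a \<bullet> i) * (b \<bullet> i - x \<bullet> i)))" for x
  have nn: "q x \<ge> 0" for x by (auto simp: q_def intro: prod_nonneg bump_nonneg)
  have q: "q x > 0 \<longleftrightarrow> x \<in> box a b" for x
  proof -
    have "q x = 0 \<longleftrightarrow> (\<exists>i\<in>Basis. (x \<bullet> i - a \<bullet> i) * (b \<bullet> i - x \<bullet> i) \<le> 0)"
      by (simp add: q_def bump_zero_iff)
    also have "\<dots> \<longleftrightarrow> x \<notin> box a b"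
    proof -
      have "(s - l) * (u - s) \<le> 0 \<longleftrightarrow> \<not> (l < s \<and> s < u)" if "l < u" for l u s :: real
        using that by (auto simp: mult_le_0_iff)
      then show ?thesis using ab by (simp add: mem_box)
    qed
    finally show ?thesis using nn[of x] by auto
  qed
  have Cq: "C_k k q" for k unfolding q_def
    by (intro C_k_prod C_k_bump C_k_mult C_k_diff C_k_inner C_k_const)
  show thesis
  proof (rule that[of "\<lambda>n x. bump (real n * q x)"])
    show "(\<lambda>x. bump (real n * q x)) \<in> test_functions \<Omega>" for n
    proof (rule test_functionI[OF _ compact_cbox sub])
      show "C_k k (\<lambda>x. bump (real n * q x))" for k
        by (intro C_k_bump C_k_mult C_k_const Cq)
      show "bump (real n * q x) = 0" if "x \<notin> cbox a b" for x
      proof -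
        have "x \<notin> box a b" using that box_subset_cbox by blast
        then have "q x = 0" using q[of x] nn[of x] by simp
        then show ?thesis by (simp add: bump_zero_iff)
      qed
    qed
    show "\<bar>bump (real n * q x)\<bar> \<le> 1" for n x using bump_nonneg bump_le_1 by simp
    show "(\<lambda>n. bump (real n * q x)) \<longlonglongrightarrow> indicator (box a b) x" for x
    proof (cases "x \<in> box a b")
      case True
      then have pos: "q x > 0" using q by blast
      have "(\<lambda>n. exp (- (inverse (q x) * (1 / real n)))) \<longlonglongrightarrow> exp (- (inverse (q x) * 0))"
        by (intro tendsto_intros lim_1_over_n)
      then have "(\<lambda>n. exp (- (inverse (q x) * (1 / real n)))) \<longlonglongrightarrow> indicator (box a b) x"
        using True by simp
      then show ?thesis
        by (rule Lim_transform_eventually)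
          (use pos in \<open>auto simp: bump_eq divide_inverse mult_ac intro!: eventually_mono[OF
              eventually_gt_at_top[of 0]]\<close>)
    next
      case False
      then have "q x = 0" using q[of x] nn[of x] by simp
      then show ?thesis using False by (simp add: bump_zero_iff bump_eq)
    qed
  qed
qed

text \<open>The pointwise vector space structure makes the forms locale applicable to function spaces.\<close>

instantiation "fun" :: (type, real_vector) real_vector
begin

definition scaleR_fun :: "real \<Rightarrow> ('a \<Rightarrow> 'b) \<Rightarrow> 'a \<Rightarrow> 'b"
  where "scaleR_fun c f = (\<lambda>x. c *\<^sub>R f x)"

instance
  by standard (simp_all add: scaleR_fun_def plus_fun_def fun_eq_iff scaleR_add_right
      scaleR_add_left)

end

lemma scaleR_fun_apply [simp]: "(c *\<^sub>R f) x = c *\<^sub>R f x"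
  by (simp add: scaleR_fun_def)

lemma sum_fun_apply: "(\<Sum>i\<in>I. f i) x = (\<Sum>i\<in>I. f i x)"
  by (induction I rule: infinite_finite_induct) (simp_all)

section \<open>Square integrable functions\<close>

definition square_integrable :: "'a measure \<Rightarrow> ('a \<Rightarrow> real) set"
  where "square_integrable M = {u \<in> borel_measurable M. integrable M (\<lambda>x. (u x)\<^sup>2)}"

definition inner_L2 :: "'a measure \<Rightarrow> ('a \<Rightarrow> real) \<Rightarrow> ('a \<Rightarrow> real) \<Rightarrow> real"
  where "inner_L2 M u v = (LINT x|M. u x * v x)"

abbreviation sqnorm :: "'a measure \<Rightarrow> ('a \<Rightarrow> real) \<Rightarrow> real"
  where "sqnorm M u \<equiv> inner_L2 M u u"

lemma inner_L2_self: "sqnorm M u = (LINT x|M. (u x)\<^sup>2)"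
  by (simp add: inner_L2_def power2_eq_square)

lemma square_integrable_measurable [measurable_dest]:
  "u \<in> square_integrable M \<Longrightarrow> u \<in> borel_measurable M"
  by (simp add: square_integrable_def)

lemma integrable_product:
  assumes [measurable]: "u \<in> square_integrable M" "v \<in> square_integrable M"
  shows "integrable M (\<lambda>x. u x * v x)"
proof (rule Bochner_Integration.integrable_bound)
  show "integrable M (\<lambda>x. (u x)\<^sup>2 + (v x)\<^sup>2)"
    using assms by (auto simp: square_integrable_def)
  have "\<bar>s * t\<bar> \<le> s\<^sup>2 + t\<^sup>2" for s t :: real
  proof -
    have "0 \<le> (s - t)\<^sup>2" "0 \<le> (s + t)\<^sup>2" "0 \<le> s\<^sup>2" "0 \<le> t\<^sup>2" by simp_all
    then show ?thesis unfolding power2_diff power2_sum by linarith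
  qed
  then show "AE x in M. norm (u x * v x) \<le> norm ((u x)\<^sup>2 + (v x)\<^sup>2)"
    by simp
qed measurable

lemma square_integrable_lincomb:
  assumes [measurable]: "u \<in> square_integrable M" "v \<in> square_integrable M"
  shows "(\<lambda>x. c * u x + d * v x) \<in> square_integrable M"
proof -
  have "integrable M (\<lambda>x. c\<^sup>2 * (u x)\<^sup>2 + d\<^sup>2 * (v x)\<^sup>2 + 2 * c * d * (u x * v x))"
    using assms integrable_product[OF assms] by (auto simp: square_integrable_def)
  then have "integrable M (\<lambda>x. (c * u x + d * v x)\<^sup>2)"
    by (simp add: power2_eq_square algebra_simps)
  then show ?thesis by (simp add: square_integrable_def)
qed

lemma subspace_square_integrable: "subspace (square_integrable M)"
proof -
  have "u + v \<in> square_integrable M" if "u \<in> square_integrable M" "v \<in> square_integrable M" for u v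
    using square_integrable_lincomb[OF that, of 1 1] by (simp add: plus_fun_def)
  moreover have "c *\<^sub>R u \<in> square_integrable M" if "u \<in> square_integrable M" for u c
    using square_integrable_lincomb[OF that that, of c 0] by (simp add: scaleR_fun_def)
  moreover have "0 \<in> square_integrable M" by (simp add: square_integrable_def zero_fun_def)
  ultimately show ?thesis by (simp add: subspace_def)
qed

interpretation L2: semidefinite_form "square_integrable M" "inner_L2 M" for M
proof
  fix u v w assume uvw: "u \<in> square_integrable M" "v \<in> square_integrable M" "w \<in> square_integrable
      M"
  then show "inner_L2 M (u + v) w = inner_L2 M u w + inner_L2 M v w"
    by (simp add: inner_L2_def distrib_right integrable_product)
next
  fix u v assume "u \<in> square_integrable M" "v \<in> square_integrable M"
  show "inner_L2 M u v = inner_L2 M v u" by (simp add: inner_L2_def mult.commute)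
qed (auto simp: subspace_square_integrable inner_L2_def mult.assoc)

lemma inner_L2_AE_cong:
  assumes "AE x in M. u x = u' x" "AE x in M. v x = v' x"
    and [measurable]: "u \<in> borel_measurable M" "u' \<in> borel_measurable M"
      "v \<in> borel_measurable M" "v' \<in> borel_measurable M"
  shows "inner_L2 M u v = inner_L2 M u' v'"
  unfolding inner_L2_def using assms(1,2) by (intro integral_cong_AE) auto

lemma inner_L2_self_eq_0_iff:
  assumes "u \<in> square_integrable M"
  shows "sqnorm M u = 0 \<longleftrightarrow> (AE x in M. u x = 0)"
  unfolding inner_L2_self using assms
  by (subst integral_nonneg_eq_0_iff_AE) (auto simp: square_integrable_def)

text \<open>On a finite measure space an \<open>L\<^sup>2\<close>-Cauchy sequence is \<open>L\<^sup>1\<close>-Cauchy and therefore has a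
  subsequence that converges almost everywhere. Fatou's lemma bounds the distance to its limit.\<close>

lemma L2_complete:
  assumes "finite_measure M" and s: "\<And>n. s n \<in> square_integrable M"
    and cauchy: "\<And>e. e > 0 \<Longrightarrow> \<exists>N. \<forall>i\<ge>N. \<forall>j\<ge>N. sqnorm M (s i - s j) < e"
  shows "\<exists>u\<in>square_integrable M. (\<lambda>n. sqnorm M (s n - u)) \<longlonglongrightarrow> 0"
proof -
  interpret finite_measure M by fact
  have sm [measurable]: "s n \<in> borel_measurable M" for n using s
      by (rule square_integrable_measurable)
  have one: "(\<lambda>_. 1) \<in> square_integrable M" by (simp add: square_integrable_def)
  have L1: "integrable M u" if "u \<in> square_integrable M" for u
    using integrable_product[OF that one] by simp
  have diff: "s i - s j \<in> square_integrable M" for i j using s by blast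
  have absd: "(\<lambda>x. \<bar>u x\<bar>) \<in> square_integrable M" if "u \<in> square_integrable M" for u
    using that by (auto simp: square_integrable_def intro: borel_measurable_abs)
  define K where "K = sqnorm M (\<lambda>_. 1) + 1"
  have K: "K > 0" using L2.nonneg[OF one] by (simp add: K_def)
  have "\<exists>N. \<forall>i\<ge>N. \<forall>j\<ge>N. (LINT x|M. norm (s i x - s j x)) < e" if "e > 0" for e
  proof -
    have "0 < e\<^sup>2 / K" using K that by simp
    from cauchy[OF this] obtain N where
      N: "\<And>i j. \<lbrakk>i \<ge> N; j \<ge> N\<rbrakk> \<Longrightarrow> sqnorm M (s i - s j) < e\<^sup>2 / K" by blast
    have "(LINT x|M. norm (s i x - s j x)) < e" if ij: "i \<ge> N" "j \<ge> N" for i j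
    proof -
      have "(LINT x|M. norm (s i x - s j x))\<^sup>2 = (inner_L2 M (\<lambda>x. \<bar>(s i - s j) x\<bar>) (\<lambda>_. 1))\<^sup>2"
        by (simp add: inner_L2_def)
      also have "\<dots> \<le> sqnorm M (\<lambda>x. \<bar>(s i - s j) x\<bar>) * sqnorm M (\<lambda>_. 1)"
        by (rule L2.Cauchy_Schwarz[OF absd[OF diff] one])
      also have "\<dots> \<le> sqnorm M (s i - s j) * K"
        unfolding K_def inner_L2_self power2_abs by (rule mult_left_mono) auto
      also have "\<dots> < e\<^sup>2" using N[OF ij] K by (simp add: field_simps)
      finally show ?thesis using \<open>e > 0\<close> by (simp add: power_less_imp_less_base)
    qed
    then show ?thesis by blast
  qed
  then obtain r where r: "strict_mono r" "AE x in M. Cauchy (\<lambda>i. s (r i) x)"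
    using cauchy_L1_AE_cauchy_subseq[of M s] L1[OF s] by blast
  define u where "u x = lim (\<lambda>i. s (r i) x)" for x
  have um [measurable]: "u \<in> borel_measurable M" unfolding u_def[abs_def] by measurable
  have conv: "AE x in M. (\<lambda>i. s (r i) x) \<longlonglongrightarrow> u x"
    using r(2) by eventually_elim (simp add: u_def Cauchy_convergent_iff convergent_LIMSEQ_iff)
  have bound: "(\<integral>\<^sup>+x. ennreal ((s i x - u x)\<^sup>2) \<partial>M) \<le> ennreal e"
    if N: "\<forall>i\<ge>N. \<forall>j\<ge>N. sqnorm M (s i - s j) < e" and i: "i \<ge> N" for i N e
  proof -
    have "AE x in M. ennreal ((s i x - u x)\<^sup>2) = liminf (\<lambda>n. ennreal ((s i x - s (r n) x)\<^sup>2))"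
      using conv
    proof eventually_elim
      case (elim x)
      then have "(\<lambda>n. ennreal ((s i x - s (r n) x)\<^sup>2)) \<longlonglongrightarrow> ennreal ((s i x - u x)\<^sup>2)"
        by (intro tendsto_ennrealI tendsto_intros)
      then show ?case by (intro lim_imp_Liminf[symmetric]) simp_all
    qed
    then have "(\<integral>\<^sup>+x. ennreal ((s i x - u x)\<^sup>2) \<partial>M)
        = (\<integral>\<^sup>+x. liminf (\<lambda>n. ennreal ((s i x - s (r n) x)\<^sup>2)) \<partial>M)"
      by (rule nn_integral_cong_AE)
    also have "\<dots> \<le> liminf (\<lambda>n. \<integral>\<^sup>+x. ennreal ((s i x - s (r n) x)\<^sup>2) \<partial>M)"
      by (intro nn_integral_liminf) measurable
    also have "\<dots> \<le> ennreal e"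
    proof (rule Liminf_le)
      have "(\<integral>\<^sup>+x. ennreal ((s i x - s (r n) x)\<^sup>2) \<partial>M) \<le> ennreal e" if "n \<ge> N" for n
      proof -
        have "r n \<ge> N" using that seq_suble[OF r(1), of n] by simp
        moreover have "(\<integral>\<^sup>+x. ennreal ((s i x - s (r n) x)\<^sup>2) \<partial>M)
            = ennreal (sqnorm M (s i - s (r n)))"
          using diff[of i "r n"] unfolding inner_L2_self
          by (subst nn_integral_eq_integral) (auto simp: square_integrable_def)
        moreover have "sqnorm M (s i - s (r n)) \<le> e"
          using N i \<open>r n \<ge> N\<close> by (simp add: less_imp_le)
        ultimately show ?thesis by (simp add: ennreal_leI)
      qed
      then show "\<forall>\<^sub>F n in sequentially. (\<integral>\<^sup>+x. ennreal ((s i x - s (r n) x)\<^sup>2) \<partial>M) \<le> ennreal e"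
        by (auto simp: eventually_sequentially)
    qed simp
    finally show ?thesis .
  qed
  have usq: "s i - u \<in> square_integrable M \<and> sqnorm M (s i - u) \<le> e"
    if N: "\<forall>i\<ge>N. \<forall>j\<ge>N. sqnorm M (s i - s j) < e" and i: "i \<ge> N" and "e > 0" for i N e
  proof -
    have b: "(\<integral>\<^sup>+x. ennreal (((s i - u) x)\<^sup>2) \<partial>M) \<le> ennreal e" using bound[OF N i] by simp
    have "integrable M (\<lambda>x. ((s i - u) x)\<^sup>2)"
      by (rule integrableI_bounded) (use le_less_trans[OF b ennreal_less_top] in \<open>auto simp:
          fun_diff_def\<close>)
    moreover have "sqnorm M (s i - u) \<le> e"
      unfolding inner_L2_self using b \<open>e > 0\<close>
      by (intro integral_real_bounded) (auto simp: fun_diff_def)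
    ultimately show ?thesis by (auto simp: square_integrable_def fun_diff_def)
  qed
  obtain N1 where N1: "\<forall>i\<ge>N1. \<forall>j\<ge>N1. sqnorm M (s i - s j) < 1"
    using cauchy[of 1] by auto
  have "s N1 - u \<in> square_integrable M" using usq[OF N1 order_refl] by simp
  then have "s N1 - (s N1 - u) \<in> square_integrable M" by (rule L2.closed(2)[OF s])
  then have u: "u \<in> square_integrable M" by simp
  moreover have "(\<lambda>n. sqnorm M (s n - u)) \<longlonglongrightarrow> 0"
  proof (rule LIMSEQ_I)
    fix e :: real assume "e > 0"
    then have e2: "e / 2 > 0" by simp
    from cauchy[OF this] obtain N where
      N: "\<forall>i\<ge>N. \<forall>j\<ge>N. sqnorm M (s i - s j) < e / 2" by blast
    show "\<exists>N. \<forall>n\<ge>N. norm (sqnorm M (s n - u) - 0) < e"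
    proof (intro exI[of _ N] allI impI)
      fix n assume "n \<ge> N"
      from usq[OF N this e2] show "norm (sqnorm M (s n - u) - 0) < e"
        using L2.nonneg[of "s n - u" M] \<open>e > 0\<close> by auto
    qed
  qed
  ultimately show ?thesis by blast
qed

section \<open>Integration of test functions\<close>

lemma test_functions_UNIV: "\<phi> \<in> test_functions \<Omega> \<Longrightarrow> \<phi> \<in> test_functions UNIV"
  by (auto simp: test_functions_def)

lemma test_function_continuous: "\<phi> \<in> test_functions \<Omega> \<Longrightarrow> continuous_on UNIV \<phi>"
  using test_function_smooth[of \<phi> \<Omega> 0] by simp

lemma test_function_borel [measurable_dest]: "\<phi> \<in> test_functions \<Omega> \<Longrightarrow> \<phi> \<in> borel_measurable borel"
  by (intro borel_measurable_continuous_onI test_function_continuous)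

lemma test_function_integrable:
  assumes "\<phi> \<in> test_functions \<Omega>"
  shows "integrable lborel \<phi>"
proof -
  obtain K where K: "compact K" "K \<subseteq> \<Omega>" "\<And>x. x \<notin> K \<Longrightarrow> \<phi> x = 0"
    using test_function_support[OF assms] by metis
  have "integrable lborel (\<lambda>x. indicator K x *\<^sub>R \<phi> x)"
    using test_function_continuous[OF assms]
    by (intro borel_integrable_compact K(1)) (rule continuous_on_subset, auto)
  moreover have "(\<lambda>x. indicator K x *\<^sub>R \<phi> x) = \<phi>"
  proof
    show "indicator K x *\<^sub>R \<phi> x = \<phi> x" for x using K(3)[of x] by (cases "x \<in> K") auto
  qed
  ultimately show ?thesis by simp
qed

lemma test_function_bounded:
  assumes "\<phi> \<in> test_functions \<Omega>"
  obtains C where "C \<ge> 0" "\<And>x. \<bar>\<phi> x\<bar> \<le> C"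
proof -
  obtain K where K: "compact K" "K \<subseteq> \<Omega>" "\<And>x. x \<notin> K \<Longrightarrow> \<phi> x = 0"
    using test_function_support[OF assms] by metis
  have "bounded (\<phi> ` K)"
    using K(1) continuous_on_subset[OF test_function_continuous[OF assms]]
    by (intro compact_imp_bounded compact_continuous_image) auto
  then obtain C where C: "C > 0" "\<And>x. x \<in> K \<Longrightarrow> \<bar>\<phi> x\<bar> \<le> C"
    unfolding bounded_pos by auto
  show ?thesis
  proof (rule that)
    show "C \<ge> 0" using C by simp
    show "\<bar>\<phi> x\<bar> \<le> C" for x using C K(3)[of x] by (cases "x \<in> K") auto
  qed
qed

lemma line_derivative:
  assumes "\<And>n. C_k n \<phi>"
  shows "((\<lambda>t. \<phi> (x + t *\<^sub>R c)) has_real_derivative partial c \<phi> (x + t *\<^sub>R c)) (at t)"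
proof -
  have "(\<phi> has_derivative (\<lambda>v. partial v \<phi> (x + t *\<^sub>R c))) (at (x + t *\<^sub>R c))"
    using C_k_has_derivative assms by blast
  moreover from this have lin: "linear (\<lambda>v. partial v \<phi> (x + t *\<^sub>R c))"
    by (rule has_derivative_linear)
  moreover have "((\<lambda>t. x + t *\<^sub>R c) has_derivative (\<lambda>t. t *\<^sub>R c)) (at t)"
    by (auto intro!: derivative_eq_intros)
  ultimately have "((\<lambda>t. \<phi> (x + t *\<^sub>R c)) has_derivative (\<lambda>s. partial (s *\<^sub>R c) \<phi> (x
      + t *\<^sub>R c))) (at t)"
    using has_derivative_compose[of "\<lambda>t. x + t *\<^sub>R c" "\<lambda>t. t *\<^sub>R c" t UNIV \<phi>] by simp
  then show ?thesis
    using linear_scale[OF lin] by (simp add: has_field_derivative_def mult.commute[of _ "partial c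
        \<phi> _"])
qed

lemma integral_translate:
  fixes f :: "'a::euclidean_space \<Rightarrow> real"
  assumes "f \<in> borel_measurable borel"
  shows "(LINT x|lborel. f (x + c)) = (LINT x|lborel. f x)"
proof -
  have "(LINT x|lborel. f x) = (LINT x|distr lborel borel ((+) c). f x)"
    by (simp add: lborel_distr_plus)
  also have "\<dots> = (LINT x|lborel. f (c + x))"
    using assms by (subst integral_distr) auto
  finally show ?thesis by (simp add: add.commute)
qed

text \<open>Dominated convergence. By the mean value theorem the quotients are bounded by the maximum
  of the derivative, and as the steps have length at most one, they vanish outside a ball whose
  radius exceeds that of the support by one.\<close>

lemma difference_quotient_integral:
  fixes \<phi> :: "'a::euclidean_space \<Rightarrow> real"
  assumes \<phi>: "\<phi> \<in> test_functions UNIV" and c: "c \<in> Basis" and g: "continuous_on UNIV g"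
  shows "(\<lambda>n. LINT x|lborel. real n * (\<phi> (x + (1 / real n) *\<^sub>R c) - \<phi> x) * g x)
    \<longlonglongrightarrow> (LINT x|lborel. partial c \<phi> x * g x)"
proof -
  obtain K where K: "compact K" "\<And>x. x \<notin> K \<Longrightarrow> \<phi> x = 0"
    using test_function_support[OF \<phi>] by metis
  obtain R where R: "\<And>x. x \<in> K \<Longrightarrow> norm x \<le> R"
    using compact_imp_bounded[OF K(1)] unfolding bounded_iff by blast
  obtain C where C: "C \<ge> 0" "\<And>x. \<bar>partial c \<phi> x\<bar> \<le> C"
    using test_function_bounded[OF test_function_partial[OF \<phi> c]] by metis
  define B where "B = cball (0::'a) (R + 1)"
  have gB: "integrable lborel (\<lambda>x. indicator B x *\<^sub>R g x)"
    unfolding B_def using g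
    by (intro borel_integrable_compact compact_cball) (rule continuous_on_subset, auto)
  have [measurable]: "\<phi> \<in> borel_measurable borel" "g \<in> borel_measurable borel"
      "partial c \<phi> \<in> borel_measurable borel"
    using test_function_borel[OF \<phi>] test_function_borel[OF test_function_partial[OF \<phi> c]] g
      borel_measurable_continuous_onI by blast+
  have quot: "\<bar>real n * (\<phi> (x + (1 / real n) *\<^sub>R c) - \<phi> x)\<bar> \<le> C * indicator B x" for n x
  proof (cases "n = 0")
    case False
    show ?thesis
    proof (cases "x \<in> B")
      case True
      have "\<exists>z. 0 < z \<and> z < 1 / real n \<and> \<phi> (x + (1 / real n) *\<^sub>R c) - \<phi> (x + 0 *\<^sub>R c)
          = (1 / real n - 0) * partial c \<phi> (x + z *\<^sub>R c)"
        using False by (intro MVT2 line_derivative test_function_smooth[OF \<phi>]) auto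
      then obtain z where "\<phi> (x + (1 / real n) *\<^sub>R c) - \<phi> x = (1 / real n) * partial c \<phi> (x
          + z *\<^sub>R c)"
        by auto
      then show ?thesis using True C(2)[of "x + z *\<^sub>R c"] False by simp
    next
      case xB: False
      then have x: "norm x > R + 1" by (simp add: B_def)
      have "norm ((1 / real n) *\<^sub>R c) \<le> 1" using False c by simp
      then have "norm (x + (1 / real n) *\<^sub>R c) > R"
        using x norm_diff_ineq[of x "(1 / real n) *\<^sub>R c"] by linarith
      then have "x \<notin> K" "x + (1 / real n) *\<^sub>R c \<notin> K" using x R by fastforce+
      then show ?thesis using K(2) xB by simp
    qed
  qed (use C in auto)
  show ?thesis
  proof (rule integral_dominated_convergence)
    show "integrable lborel (\<lambda>x. C * \<bar>indicator B x *\<^sub>R g x\<bar>)"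
      by (intro integrable_mult_right integrable_abs gB)
    have "(\<lambda>n. real n * (\<phi> (x + (1 / real n) *\<^sub>R c) - \<phi> x)) \<longlonglongrightarrow> partial c \<phi> x" for x
    proof -
      have "((\<lambda>h. (\<phi> (x + h *\<^sub>R c) - \<phi> x) / h) \<longlongrightarrow> partial c \<phi> x) (at 0)"
        using line_derivative[OF test_function_smooth[OF \<phi>], of x c 0] by (simp add: DERIV_def)
      moreover have "filterlim (\<lambda>n. 1 / real n) (at 0) sequentially"
        by (intro filterlim_atI lim_1_over_n) (auto simp: eventually_sequentially intro!: exI[of _
            1])
      ultimately have "(\<lambda>n. (\<phi> (x + (1 / real n) *\<^sub>R c) - \<phi> x) / (1 / real n)) \<longlonglongrightarrow> partial c \<phi> x"
        by (rule filterlim_compose)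
      then show ?thesis by (simp add: mult.commute)
    qed
    then show "AE x in lborel. (\<lambda>n. real n * (\<phi> (x + (1 / real n) *\<^sub>R c) - \<phi> x) * g x)
        \<longlonglongrightarrow> partial c \<phi> x * g x"
      by (auto intro!: tendsto_mult)
    show "AE x in lborel. norm (real n * (\<phi> (x + (1 / real n) *\<^sub>R c) - \<phi> x) * g x)
        \<le> C * \<bar>indicator B x *\<^sub>R g x\<bar>" for n
      using mult_right_mono[OF quot abs_ge_zero, of n _ "g _"]
      by (auto simp: abs_mult mult.assoc)
  qed auto
qed

text \<open>Difference quotients integrate to zero because Lebesgue measure is invariant under
  translations.\<close>

lemma integral_partial_eq_0:
  assumes "\<phi> \<in> test_functions UNIV" "c \<in> Basis"
  shows "(LINT x|lborel. partial c \<phi> x) = 0"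
proof -
  have [measurable]: "\<phi> \<in> borel_measurable borel" by (rule test_function_borel[OF assms(1)])
  have int: "integrable lborel (\<lambda>x. \<phi> (x + h))" for h
  proof -
    have "integrable (distr lborel borel ((+) h)) \<phi>"
      using test_function_integrable[OF assms(1)] by (simp add: lborel_distr_plus)
    then show ?thesis by (subst (asm) integrable_distr_eq) (auto simp: add.commute)
  qed
  have "(LINT x|lborel. real n * (\<phi> (x + (1 / real n) *\<^sub>R c) - \<phi> x) * 1) = 0" for n
    using test_function_integrable[OF assms(1)] int integral_translate[of \<phi>]
    by (simp add: Bochner_Integration.integral_diff)
  then have "(\<lambda>n::nat. 0) \<longlonglongrightarrow> (LINT x|lborel. partial c \<phi> x * 1)"
    using difference_quotient_integral[OF assms, of "\<lambda>_. 1"] by (simp only: continuous_on_const)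
  then show ?thesis by (simp add: LIMSEQ_const_iff)
qed

lemma integration_by_parts:
  assumes \<phi>: "\<phi> \<in> test_functions UNIV" and \<psi>: "\<psi> \<in> test_functions UNIV" and c: "c \<in> Basis"
  shows "(LINT x|lborel. partial c \<phi> x * \<psi> x) = - (LINT x|lborel. \<phi> x * partial c \<psi> x)"
proof -
  note sm = test_function_smooth
  have i1: "integrable lborel (\<lambda>x. partial c \<phi> x * \<psi> x)"
    by (rule test_function_integrable[OF test_function_mult[OF sm[OF test_function_partial[OF \<phi>
        c]] \<psi>]])
  have i2: "integrable lborel (\<lambda>x. \<phi> x * partial c \<psi> x)"
    by (rule test_function_integrable[OF test_function_mult[OF sm[OF \<phi>] test_function_partial[OF \<psi>
        c]]])
  have "0 = (LINT x|lborel. partial c (\<lambda>x. \<phi> x * \<psi> x) x)"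
    using integral_partial_eq_0[OF test_function_mult[OF sm[OF \<phi>] \<psi>] c] by simp
  also have "\<dots> = (LINT x|lborel. \<phi> x * partial c \<psi> x + partial c \<phi> x * \<psi> x)"
    by (intro Bochner_Integration.integral_cong refl partial_mult sm[OF \<phi>] sm[OF \<psi>])
  also have "\<dots> = (LINT x|lborel. \<phi> x * partial c \<psi> x) + (LINT x|lborel. partial c \<phi> x * \<psi> x)"
    by (rule Bochner_Integration.integral_add[OF i2 i1])
  finally show ?thesis by simp
qed

lemma partial_translate:
  assumes "\<And>n. C_k n \<phi>"
  shows "partial b (\<lambda>x. \<phi> (x + h)) x = partial b \<phi> (x + h)"
proof (rule partial_eq)
  have "((\<lambda>x. x + h) has_derivative (\<lambda>v. v)) (at x)" by (auto intro!: derivative_eq_intros)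
  from has_derivative_compose[OF this C_k_has_derivative[OF assms]]
  show "((\<lambda>x. \<phi> (x + h)) has_derivative (\<lambda>b. partial b \<phi> (x + h))) (at x)" .
qed

lemma test_function_translate:
  assumes "\<phi> \<in> test_functions UNIV"
  shows "(\<lambda>x. \<phi> (x + h)) \<in> test_functions UNIV"
proof -
  obtain K where K: "compact K" "\<And>x. x \<notin> K \<Longrightarrow> \<phi> x = 0"
    using test_function_support[OF assms] by metis
  have "C_k n (\<lambda>x. f (x + h))" if "\<And>n. C_k n f" for n and f :: "'a \<Rightarrow> real"
    using that
  proof (induction n arbitrary: f)
    case 0
    from 0[of 0] show ?case by (auto intro!: continuous_on_compose2[of UNIV f] continuous_intros)
  next
    case (Suc n)
    have "((\<lambda>x. x + h) has_derivative (\<lambda>v. v)) (at x)" for x by (auto intro!: derivative_eq_intros)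
    from has_derivative_compose[OF this C_k_has_derivative[OF Suc.prems]]
    show ?case
    proof (rule C_k_Suc_I)
      fix b :: 'a assume "b \<in> Basis"
      then have "C_k n (partial b f)" for n using Suc.prems[of "Suc n"] by simp
      then show "C_k n (\<lambda>x. partial b f (x + h))" by (rule Suc.IH)
    qed
  qed
  then show ?thesis
  proof (rule test_functionI)
    show "C_k n \<phi>" for n by (rule test_function_smooth[OF assms])
    show "compact ((\<lambda>x. x + (- h)) ` K)"
      using K(1) by (intro compact_continuous_image continuous_intros)
    show "\<phi> (x + h) = 0" if "x \<notin> (\<lambda>x. x + (- h)) ` K" for x
      using that K(2)[of "x + h"] by (force simp: image_iff)
  qed simp
qed

text \<open>Difference quotients in direction \<open>c\<close> commute with \<open>partial b\<close>. Integrating by parts in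
  direction \<open>b\<close> and passing to the limit of the quotients gives the symmetry of mixed partial
  derivatives, tested against \<open>\<psi>\<close>.\<close>

lemma integral_mixed_partials:
  assumes \<phi>: "\<phi> \<in> test_functions UNIV" and \<psi>: "\<psi> \<in> test_functions UNIV"
    and b: "b \<in> Basis" and c: "c \<in> Basis"
  shows "(LINT x|lborel. partial b (partial c \<phi>) x * \<psi> x)
      = (LINT x|lborel. partial c (partial b \<phi>) x * \<psi> x)"
proof -
  have b\<phi>: "partial b \<phi> \<in> test_functions UNIV" by (rule test_function_partial[OF \<phi> b])
  have b\<psi>: "partial b \<psi> \<in> test_functions UNIV" by (rule test_function_partial[OF \<psi> b])
  define D where "D f n x = real n * (f (x + (1 / real n) *\<^sub>R c) - f x)" for f :: "'a \<Rightarrow> real"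
      and n x
  have Dtest: "D f n \<in> test_functions UNIV" if "f \<in> test_functions UNIV" for f n
    unfolding D_def by (intro test_function_scale test_function_diff test_function_translate that)
  have Dpartial: "partial b (D \<phi> n) x = D (partial b \<phi>) n x" for n x
  proof -
    note sm = test_function_smooth[OF \<phi>] test_function_smooth[OF test_function_translate[OF \<phi>]]
    have "partial b (\<lambda>x. \<phi> (x + (1 / real n) *\<^sub>R c) + (-1) * \<phi> x) x
        = partial b \<phi> (x + (1 / real n) *\<^sub>R c) + (-1) * partial b \<phi> x"
      by (subst partial_add) (intro sm C_k_mult C_k_const, intro sm C_k_mult C_k_const,
          simp only: partial_scale[OF sm(1)] partial_translate[OF sm(1)])
    moreover have "D \<phi> n = (\<lambda>x. real n * (\<phi> (x + (1 / real n) *\<^sub>R c) + (-1) * \<phi> x))"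
      by (simp add: D_def fun_eq_iff)
    ultimately show ?thesis
      by (simp only:) (subst partial_scale, intro sm C_k_add C_k_mult C_k_const, simp add: D_def)
  qed
  have eq: "(LINT x|lborel. D \<phi> n x * partial b \<psi> x)
      = - (LINT x|lborel. D (partial b \<phi>) n x * \<psi> x)" for n
    using integration_by_parts[OF Dtest[OF \<phi>, of n] \<psi> b] by (simp add: Dpartial)
  have "(\<lambda>n. LINT x|lborel. D \<phi> n x * partial b \<psi> x)
      \<longlonglongrightarrow> (LINT x|lborel. partial c \<phi> x * partial b \<psi> x)"
    unfolding D_def by (rule difference_quotient_integral[OF \<phi> c test_function_continuous[OF b\<psi>]])
  moreover have "(\<lambda>n. - (LINT x|lborel. D (partial b \<phi>) n x * \<psi> x))
      \<longlonglongrightarrow> - (LINT x|lborel. partial c (partial b \<phi>) x * \<psi> x)"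
    unfolding D_def
    by (intro tendsto_minus difference_quotient_integral[OF b\<phi> c test_function_continuous[OF \<psi>]])
  ultimately have "(LINT x|lborel. partial c \<phi> x * partial b \<psi> x)
      = - (LINT x|lborel. partial c (partial b \<phi>) x * \<psi> x)"
    unfolding eq by (rule LIMSEQ_unique)
  then show ?thesis
    using integration_by_parts[OF test_function_partial[OF \<phi> c] \<psi> b] by simp
qed

text \<open>The reason why the Laplacian controls all second derivatives.\<close>

lemma integral_hessian:
  assumes \<phi>: "\<phi> \<in> test_functions UNIV" and b: "b \<in> Basis" and c: "c \<in> Basis"
  shows "(LINT x|lborel. partial c (partial b \<phi>) x * partial c (partial b \<phi>) x)
    = (LINT x|lborel. partial b (partial b \<phi>) x * partial c (partial c \<phi>) x)"
proof -
  note tf = test_function_partial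
  have t: "partial c (partial b \<phi>) \<in> test_functions UNIV" "partial c \<phi> \<in> test_functions UNIV"
    "partial b \<phi> \<in> test_functions UNIV" "partial b (partial b \<phi>) \<in> test_functions UNIV"
    by (intro tf \<phi> b c)+
  have "(LINT x|lborel. partial c (partial b \<phi>) x * partial c (partial b \<phi>) x)
      = (LINT x|lborel. partial b (partial c \<phi>) x * partial c (partial b \<phi>) x)"
    by (rule integral_mixed_partials[OF \<phi> t(1) c b])
  also have "\<dots> = - (LINT x|lborel. partial c \<phi> x * partial b (partial c (partial b \<phi>)) x)"
    by (rule integration_by_parts[OF t(2,1) b])
  also have "\<dots> = - (LINT x|lborel. partial c (partial b (partial b \<phi>)) x * partial c \<phi> x)"
    using integral_mixed_partials[OF t(3,2) b c] by (simp add: mult.commute)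
  also have "\<dots> = (LINT x|lborel. partial b (partial b \<phi>) x * partial c (partial c \<phi>) x)"
    using integration_by_parts[OF t(4,2) c] by simp
  finally show ?thesis .
qed

section \<open>The fundamental lemma of the calculus of variations\<close>

text \<open>Open boxes form a generator of the Borel sets that is stable under intersections, so the
  integrals over all Borel sets vanish.\<close>

lemma AE_eq_0_if_box_integrals_0:
  fixes f :: "'a::euclidean_space \<Rightarrow> real"
  assumes f: "integrable lborel f"
    and box: "\<And>a b. (LINT x:box a b|lborel. f x) = 0" and total: "(LINT x|lborel. f x) = 0"
  shows "AE x in lborel. f x = 0"
proof -
  have sint: "set_integrable lborel A f" if "A \<in> sets borel" for A
    unfolding set_integrable_def by (rule integrable_mult_indicator[OF _ f]) (use that in simp)
  have *: "A \<in> sets borel \<and> (LINT x:A|lborel. f x) = 0"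
    if "A \<in> sigma_sets UNIV (range (\<lambda>(a, b). box a b))" for A :: "'a set"
  proof -
    have "Int_stable (range (\<lambda>(a, b). box a b :: 'a set))"
      by (auto simp: Int_stable_def box_Int_box)
    moreover have "range (\<lambda>(a, b). box a b :: 'a set) \<subseteq> Pow UNIV" by simp
    ultimately show ?thesis using that
    proof (induction rule: sigma_sets_induct_disjoint)
    case (basic A)
    then show ?case using box by auto
  next
    case empty
    then show ?case by (simp add: set_lebesgue_integral_def)
  next
    case (compl A)
    have "(LINT x:A \<union> (UNIV - A)|lborel. f x) = (LINT x:A|lborel. f x)
        + (LINT x:UNIV - A|lborel. f x)"
      using compl sint by (intro set_integral_Un) auto
    moreover have "(LINT x:A \<union> (UNIV - A)|lborel. f x) = 0"
      using total by (simp add: set_lebesgue_integral_def Un_Diff_cancel)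
    ultimately show ?case using compl by auto
  next
    case (union A)
    then have "(\<Union>i. A i) \<in> sets borel" by auto
    moreover have "(LINT x:(\<Union>i. A i)|lborel. f x) = (\<Sum>i. (LINT x:(A i)|lborel. f x))"
      using union calculation
      by (intro lebesgue_integral_countable_add sint) (auto simp: disjoint_family_on_def)
    ultimately show ?case using union by simp
  qed
  qed
  show ?thesis
  proof (rule density_unique_real[OF f])
    show "integrable lborel (\<lambda>x. 0::real)" by simp
    fix A :: "'a set" assume "A \<in> sets lborel"
    then have "A \<in> sigma_sets UNIV (range (\<lambda>(a, b). box a b))"
      by (simp add: borel_eq_box)
    from *[OF this] show "(LINT x:A|lborel. f x) = (LINT x:A|lborel. 0)"
      by (simp add: set_lebesgue_integral_def)
  qed
qed

locale bounded_open =
  fixes \<Omega> :: "'a::euclidean_space set"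
  assumes open_\<Omega>: "open \<Omega>" and bounded_\<Omega>: "bounded \<Omega>"
begin

abbreviation M :: "'a measure" where "M \<equiv> lebesgue_on \<Omega>"

lemma L2_eq: "L2 \<Omega> = square_integrable M"
  by (simp add: L2_def square_integrable_def)

lemma \<Omega>_lmeasurable: "\<Omega> \<in> lmeasurable"
  using bounded_\<Omega> open_\<Omega> by (intro bounded_set_imp_lmeasurable) auto

sublocale M: finite_measure M
  using \<Omega>_lmeasurable by (rule finite_measure_lebesgue_on)

lemma \<Omega>_sets [simp]: "\<Omega> \<inter> space lebesgue \<in> sets lebesgue" "\<Omega> \<in> sets lebesgue"
  using open_\<Omega> by auto

lemma borel_measurable_M:
  fixes f :: "'a \<Rightarrow> real"
  assumes "f \<in> borel_measurable borel"
  shows "f \<in> borel_measurable M"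
  by (rule measurable_restrict_space1) (use assms in \<open>simp add: measurable_completion\<close>)

lemma integral_M_eq:
  fixes f :: "'a \<Rightarrow> real"
  assumes [measurable]: "f \<in> borel_measurable borel" and 0: "\<And>x. x \<notin> \<Omega> \<Longrightarrow> f x = 0"
  shows "(LINT x|M. f x) = (LINT x|lborel. f x)"
proof -
  have eq: "indicator \<Omega> x *\<^sub>R f x = f x" for x using 0[of x] by (cases "x \<in> \<Omega>") auto
  have "(LINT x|M. f x) = (LINT x|lebesgue. f x)"
    by (subst integral_restrict_space) (simp_all only: \<Omega>_sets eq)
  also have "\<dots> = (LINT x|lborel. f x)" by (rule integral_completion) simp
  finally show ?thesis .
qed

lemma integrable_M_iff:
  fixes f :: "'a \<Rightarrow> real"
  assumes [measurable]: "f \<in> borel_measurable borel" and 0: "\<And>x. x \<notin> \<Omega> \<Longrightarrow> f x = 0"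
  shows "integrable M f \<longleftrightarrow> integrable lborel f"
proof -
  have eq: "indicator \<Omega> x *\<^sub>R f x = f x" for x using 0[of x] by (cases "x \<in> \<Omega>") auto
  have "integrable M f \<longleftrightarrow> integrable lebesgue f"
    by (subst integrable_restrict_space) (simp_all only: \<Omega>_sets eq)
  also have "\<dots> \<longleftrightarrow> integrable lborel f" by (rule integrable_completion) simp
  finally show ?thesis .
qed

lemma test_function_0_off: "\<phi> \<in> test_functions \<Omega> \<Longrightarrow> x \<notin> \<Omega> \<Longrightarrow> \<phi> x = 0"
  by (metis subsetD test_function_support)

lemma test_integral_M:
  "\<phi> \<in> test_functions \<Omega> \<Longrightarrow> (LINT x|M. \<phi> x) = (LINT x|lborel. \<phi> x)"
  by (intro integral_M_eq test_function_borel test_function_0_off)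

lemma test_square_integrable:
  assumes "\<phi> \<in> test_functions \<Omega>"
  shows "\<phi> \<in> square_integrable M"
proof -
  have 2: "(\<lambda>x. \<phi> x * \<phi> x) \<in> test_functions \<Omega>"
    by (rule test_function_mult[OF test_function_smooth[OF assms] assms])
  have "integrable M (\<lambda>x. \<phi> x * \<phi> x)"
    using test_function_integrable[OF 2]
    by (subst integrable_M_iff) (intro test_function_borel[OF 2] test_function_0_off[OF 2])+
  then show ?thesis
    using borel_measurable_M[OF test_function_borel[OF assms]]
    by (simp add: square_integrable_def power2_eq_square)
qed

lemma test_inner_L2:
  assumes "\<phi> \<in> test_functions \<Omega>" "\<psi> \<in> test_functions \<Omega>"
  shows "inner_L2 M \<phi> \<psi> = (LINT x|lborel. \<phi> x * \<psi> x)"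
  unfolding inner_L2_def
  by (rule test_integral_M[OF test_function_mult[OF test_function_smooth[OF assms(1)] assms(2)]])

text \<open>Indicator functions of open boxes with closure in the domain are bounded pointwise limits
  of test functions, hence \<open>v\<close> has vanishing integral over such boxes and is zero almost
  everywhere on each of them. Countably many of them cover the domain.\<close>

lemma fundamental_lemma:
  assumes v: "v \<in> square_integrable M"
    and 0: "\<And>\<phi>. \<phi> \<in> test_functions \<Omega> \<Longrightarrow> inner_L2 M v \<phi> = 0"
  shows "AE x in M. v x = 0"
proof -
  have vm [measurable]: "v \<in> borel_measurable M" by (rule square_integrable_measurable[OF v])
  have vint: "integrable M v"
    using M.square_integrable_imp_integrable[OF vm] v by (simp add: square_integrable_def)
  have box0: "(LINT x|M. v x * indicator (box a b) x) = 0" if sub: "cbox a b \<subseteq> \<Omega>" for a b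
  proof -
    obtain \<phi> :: "nat \<Rightarrow> 'a \<Rightarrow> real" where \<phi>: "\<And>n. \<phi> n \<in> test_functions \<Omega>"
      "\<And>n x. \<bar>\<phi> n x\<bar> \<le> 1" "\<And>x. (\<lambda>n. \<phi> n x) \<longlonglongrightarrow> indicator (box a b) x"
      using box_bumps[OF sub] by metis
    have [measurable]: "\<phi> n \<in> borel_measurable M" for n
      by (rule square_integrable_measurable[OF test_square_integrable[OF \<phi>(1)]])
    have [measurable]: "(indicator (box a b) :: 'a \<Rightarrow> real) \<in> borel_measurable M"
      by (rule borel_measurable_M) simp
    have "(\<lambda>n. LINT x|M. v x * \<phi> n x) \<longlonglongrightarrow> (LINT x|M. v x * indicator (box a b) x)"
    proof (rule integral_dominated_convergence)
      show "integrable M (\<lambda>x. \<bar>v x\<bar>)" using vint by simp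
      \<comment> \<open>The domain has finite measure, hence \<open>v\<close> is integrable and serves as a bound.\<close>
      show "AE x in M. norm (v x * \<phi> n x) \<le> \<bar>v x\<bar>" for n
        using \<phi>(2) by (auto simp: abs_mult intro!: mult_left_le)
      show "AE x in M. (\<lambda>n. v x * \<phi> n x) \<longlonglongrightarrow> v x * indicator (box a b) x"
        by (intro AE_I2 tendsto_mult_left \<phi>(3))
    qed auto
    then show ?thesis using 0[OF \<phi>(1)] by (simp add: inner_L2_def LIMSEQ_const_iff)
  qed
  define w where "w x = (if x \<in> \<Omega> then v x else 0)" for x
  have wm: "w \<in> borel_measurable lebesgue"
    unfolding w_def[abs_def] using vm by (rule borel_measurable_if_I) simp
  \<comment> \<open>\<open>w'\<close> is a Borel function, so that Borel sets can be used to test it.\<close>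
  obtain w' where w' [measurable]: "w' \<in> borel_measurable lborel" and ww': "AE x in lborel. w x
      = w' x"
    using completion_ex_borel_measurable_real[OF wm] by blast
  have ww'2: "AE x in lebesgue. w x = w' x" using ww' by (rule AE_completion)
  have wint: "integrable lebesgue w"
  proof -
    have "(\<lambda>x. indicator \<Omega> x *\<^sub>R v x) = w" by (auto simp: w_def indicator_def)
    then show ?thesis using vint by (simp add: integrable_restrict_space)
  qed
  have w'int: "integrable lborel w'"
  proof -
    have w'm: "w' \<in> borel_measurable lebesgue" using w' by (rule measurable_completion)
    have "integrable lebesgue w'"
      using wint integrable_cong_AE[OF wm w'm ww'2] by blast
    then show ?thesis using integrable_completion[OF w'] by blast
  qed
  have w'box: "(LINT x:box a b|lborel. w' x) = 0" if "cbox a b \<subseteq> \<Omega>" for a b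
  proof -
    have m: "(\<lambda>x. indicator (box a b) x *\<^sub>R w' x) \<in> borel_measurable lborel" by measurable
    have "(LINT x:box a b|lborel. w' x) = (LINT x|lebesgue. indicator (box a b) x *\<^sub>R w' x)"
      unfolding set_lebesgue_integral_def using integral_completion[OF m] by simp
    also have "\<dots> = (LINT x|lebesgue. indicator \<Omega> x *\<^sub>R (v x * indicator (box a b) x))"
    proof (rule integral_cong_AE)
      show "(\<lambda>x. indicator (box a b) x *\<^sub>R w' x) \<in> borel_measurable lebesgue"
        using m by (rule measurable_completion)
      have "(\<lambda>x. indicator \<Omega> x *\<^sub>R (v x * indicator (box a b) x))
          = (\<lambda>x. w x * indicator (box a b) x)"
        by (auto simp: w_def indicator_def)
      then show "(\<lambda>x. indicator \<Omega> x *\<^sub>R (v x * indicator (box a b) x)) \<in> borel_measurable lebesgue"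
        using borel_measurable_times[OF wm borel_measurable_indicator[of "box a b" lebesgue]]
            by simp
      show "AE x in lebesgue. indicator (box a b) x *\<^sub>R w' x
          = indicator \<Omega> x *\<^sub>R (v x * indicator (box a b) x)"
        using ww'2
      proof eventually_elim
        case (elim x)
        then show ?case using that box_subset_cbox[of a b] by (auto simp: w_def indicator_def)
      qed
    qed
    also have "\<dots> = (LINT x|M. v x * indicator (box a b) x)"
      by (rule integral_restrict_space[symmetric]) simp
    finally show ?thesis using box0[OF that] by simp
  qed
  define F where "F = {box a b |a b. cbox a b \<subseteq> \<Omega>}"
  have F0: "AE x in lborel. x \<in> X \<longrightarrow> w' x = 0" if "X \<in> F" for X
  proof -
    obtain a b where X: "X = box a b" "cbox a b \<subseteq> \<Omega>" using \<open>X \<in> F\<close> unfolding F_def by blast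
    have "AE x in lborel. indicator X x *\<^sub>R w' x = 0"
    proof (rule AE_eq_0_if_box_integrals_0)
      show "integrable lborel (\<lambda>x. indicator X x *\<^sub>R w' x)"
        unfolding X by (rule integrable_mult_indicator[OF _ w'int]) simp
      show "(LINT x|lborel. indicator X x *\<^sub>R w' x) = 0"
        using w'box[OF X(2)] by (simp add: X set_lebesgue_integral_def)
      fix c d :: 'a
      obtain p q where pq: "box a b \<inter> box c d = box p q" using box_Int_box by blast
      show "(LINT x:box c d|lborel. indicator X x *\<^sub>R w' x) = 0"
      proof (cases "box p q = {}")
        case True
        then have "indicator (box c d) x *\<^sub>R indicator X x *\<^sub>R w' x = 0" for x
          using pq X by (auto simp: indicator_def)
        then show ?thesis unfolding set_lebesgue_integral_def by (simp only: integral_zero)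
      next
        case False
        have "box p q \<subseteq> box a b" using pq by blast
        then have "cbox p q \<subseteq> cbox a b" using False by
            (simp add: subset_box box_ne_empty less_imp_le)
        then have "(LINT x:box p q|lborel. w' x) = 0" using X(2) by (intro w'box) auto
        moreover have "indicator (box c d) x *\<^sub>R indicator X x *\<^sub>R w' x
            = indicator (box p q) x *\<^sub>R w' x" for x
          unfolding pq[symmetric] X(1) by (auto simp: indicator_def)
        ultimately show ?thesis unfolding set_lebesgue_integral_def by (simp only:)
      qed
    qed
    then show ?thesis by eventually_elim auto
  qed
  obtain F' where F': "F' \<subseteq> F" "countable F'" "\<Union>F' = \<Union>F"
    using Lindelof[of F] by (auto simp: F_def open_box)
  have "\<Union>F = \<Omega>"
  proof
    show "\<Union>F \<subseteq> \<Omega>"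
    proof
      fix x assume "x \<in> \<Union>F"
      then obtain a b where "x \<in> box a b" "cbox a b \<subseteq> \<Omega>" unfolding F_def by blast
      then show "x \<in> \<Omega>" using box_subset_cbox[of a b] by (meson subsetD)
    qed
    show "\<Omega> \<subseteq> \<Union>F"
    proof
      fix x assume "x \<in> \<Omega>"
      then obtain a b where "cbox a b \<subseteq> \<Omega>" "x \<in> box a b"
        using open_contains_cbox[OF open_\<Omega>] by metis
      then have "box a b \<in> F" unfolding F_def by blast
      with \<open>x \<in> box a b\<close> show "x \<in> \<Union>F" by (rule UnionI[rotated])
    qed
  qed
  have "AE x in lborel. \<forall>X\<in>F'. x \<in> X \<longrightarrow> w' x = 0"
    using F0 F' by (subst AE_ball_countable) auto
  with ww' have "AE x in lborel. x \<in> \<Omega> \<longrightarrow> v x = 0"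
  proof eventually_elim
    case (elim x)
    show ?case
    proof
      assume x: "x \<in> \<Omega>"
      then have "x \<in> \<Union>F'" using F'(3) \<open>\<Union>F = \<Omega>\<close> by simp
      then have "w' x = 0" using elim(2) by blast
      then show "v x = 0" using elim(1) x by (simp add: w_def)
    qed
  qed
  then show ?thesis by (simp add: AE_restrict_space_iff AE_completion)
qed

section \<open>Weak derivatives\<close>

abbreviation SI :: "('a \<Rightarrow> real) set" where "SI \<equiv> square_integrable M"

lemma is_weak_partial_iff:
  "is_weak_partial \<Omega> b u v \<longleftrightarrow>
    (\<forall>\<phi>\<in>test_functions \<Omega>. inner_L2 M u (partial b \<phi>) = - inner_L2 M v \<phi>)"
  by (simp add: is_weak_partial_def inner_L2_def)

lemma weak_partial_unique:
  assumes "v \<in> SI" "v' \<in> SI" "is_weak_partial \<Omega> b u v" "is_weak_partial \<Omega> b u v'"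
  shows "AE x in M. v x = v' x"
proof -
  have "AE x in M. (v - v') x = 0"
  proof (rule fundamental_lemma)
    show "v - v' \<in> SI" using assms by (intro L2.closed)
    show "inner_L2 M (v - v') \<phi> = 0" if "\<phi> \<in> test_functions \<Omega>" for \<phi>
      using assms that test_square_integrable[OF that]
      by (simp add: L2.diff_left is_weak_partial_iff)
  qed
  then show ?thesis by simp
qed

text \<open>Since \<open>weak_partial\<close> picks an arbitrary representative, it can only be computed almost
  everywhere. The function itself may also be replaced by one that agrees with it almost
  everywhere, as is needed for second derivatives, where \<open>weak_partial\<close> is applied to an
  arbitrary representative.\<close>

lemma weak_partial_eqI:
  assumes u: "u \<in> SI" and u': "u' \<in> SI" and uu': "AE x in M. u x = u' x"
    and v: "v \<in> SI" and b: "b \<in> Basis" and uv: "is_weak_partial \<Omega> b u v"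
  shows "weak_partial \<Omega> b u' \<in> SI" "is_weak_partial \<Omega> b u' (weak_partial \<Omega> b u')"
    "AE x in M. weak_partial \<Omega> b u' x = v x"
proof -
  have "inner_L2 M u (partial b \<phi>) = inner_L2 M u' (partial b \<phi>)" if "\<phi> \<in> test_functions \<Omega>" for \<phi>
    using uu' square_integrable_measurable[OF u] square_integrable_measurable[OF u']
      square_integrable_measurable[OF test_square_integrable[OF test_function_partial[OF that b]]]
    by (intro inner_L2_AE_cong) auto
  then have u'v: "is_weak_partial \<Omega> b u' v" using uv by (simp add: is_weak_partial_iff)
  have "weak_partial \<Omega> b u' \<in> L2 \<Omega> \<and> is_weak_partial \<Omega> b u' (weak_partial \<Omega> b u')"
    unfolding weak_partial_def by (rule someI[of _ v]) (use v u'v in \<open>simp add: L2_eq\<close>)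
  then show "weak_partial \<Omega> b u' \<in> SI" "is_weak_partial \<Omega> b u' (weak_partial \<Omega> b u')"
    by (simp_all add: L2_eq)
  then show "AE x in M. weak_partial \<Omega> b u' x = v x"
    using v u'v by (intro weak_partial_unique)
qed

lemma H1_iff: "u \<in> H1 \<Omega> \<longleftrightarrow> u \<in> SI \<and> (\<forall>b\<in>Basis. \<exists>v\<in>SI. is_weak_partial \<Omega> b u v)"
  by (simp add: H1_def L2_eq)

lemma H1_weak_partial:
  assumes "u \<in> H1 \<Omega>" "b \<in> Basis"
  shows "weak_partial \<Omega> b u \<in> SI" "is_weak_partial \<Omega> b u (weak_partial \<Omega> b u)"
proof -
  obtain v where v: "v \<in> SI" "is_weak_partial \<Omega> b u v" "u \<in> SI"
    using assms unfolding H1_iff by metis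
  show "weak_partial \<Omega> b u \<in> SI" "is_weak_partial \<Omega> b u (weak_partial \<Omega> b u)"
    using weak_partial_eqI[OF v(3) v(3) _ v(1) assms(2) v(2)] by auto
qed

lemma is_weak_partial_test:
  assumes "\<phi> \<in> test_functions \<Omega>" "b \<in> Basis"
  shows "is_weak_partial \<Omega> b \<phi> (partial b \<phi>)"
  unfolding is_weak_partial_iff
proof
  fix \<psi> assume \<psi>: "\<psi> \<in> test_functions \<Omega>"
  show "inner_L2 M \<phi> (partial b \<psi>) = - inner_L2 M (partial b \<phi>) \<psi>"
    using integration_by_parts[OF test_functions_UNIV[OF assms(1)] test_functions_UNIV[OF \<psi>]
        assms(2)]
    by (simp add: test_inner_L2 \<psi> assms test_function_partial)
qed

lemma is_weak_partial_lincomb: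
  assumes "b \<in> Basis" "u \<in> SI" "v \<in> SI" "u' \<in> SI" "v' \<in> SI"
    "is_weak_partial \<Omega> b u v" "is_weak_partial \<Omega> b u' v'"
  shows "is_weak_partial \<Omega> b (c *\<^sub>R u + d *\<^sub>R u') (c *\<^sub>R v + d *\<^sub>R v')"
  unfolding is_weak_partial_iff
proof
  fix \<phi> assume \<phi>: "\<phi> \<in> test_functions \<Omega>"
  show "inner_L2 M (c *\<^sub>R u + d *\<^sub>R u') (partial b \<phi>) = - inner_L2 M (c *\<^sub>R v + d *\<^sub>R v') \<phi>"
    using assms \<phi> test_square_integrable[OF \<phi>]
      test_square_integrable[OF test_function_partial[OF \<phi> assms(1)]]
    by (simp add: L2.bilin L2.closed is_weak_partial_iff algebra_simps)
qed

lemma is_weak_partial_limit: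
  assumes "b \<in> Basis" and s: "\<And>n. s n \<in> SI" "u \<in> SI" "(\<lambda>n. sqnorm M (s n - u)) \<longlonglongrightarrow> 0"
    and t: "\<And>n. t n \<in> SI" "v \<in> SI" "(\<lambda>n. sqnorm M (t n - v)) \<longlonglongrightarrow> 0"
    and st: "\<And>n. is_weak_partial \<Omega> b (s n) (t n)"
  shows "is_weak_partial \<Omega> b u v"
  unfolding is_weak_partial_iff
proof
  fix \<phi> assume \<phi>: "\<phi> \<in> test_functions \<Omega>"
  have "(\<lambda>n. inner_L2 M (s n) (partial b \<phi>)) \<longlonglongrightarrow> inner_L2 M u (partial b \<phi>)"
    by (rule L2.tendsto_form_left[OF s(1,2) test_square_integrable[OF test_function_partial[OF \<phi>
        assms(1)]] s(3)])
  moreover have "(\<lambda>n. - inner_L2 M (t n) \<phi>) \<longlonglongrightarrow> - inner_L2 M v \<phi>"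
    by (intro tendsto_minus L2.tendsto_form_left[OF t(1,2) test_square_integrable[OF \<phi>] t(3)])
  moreover have "inner_L2 M (s n) (partial b \<phi>) = - inner_L2 M (t n) \<phi>" for n
    using st \<phi> by (simp add: is_weak_partial_iff)
  ultimately show "inner_L2 M u (partial b \<phi>) = - inner_L2 M v \<phi>"
    by (simp add: LIMSEQ_unique)
qed

section \<open>Second order jets\<close>

text \<open>Derivatives up to order two are indexed by pairs of directions, where the vector \<open>0\<close>
  stands for no differentiation. Thus \<open>(0, 0)\<close> is the function itself, and \<open>(b, c)\<close> means first
  \<open>b\<close>, then \<open>c\<close>.\<close>

definition jet_index :: "('a \<times> 'a) set"
  where "jet_index = insert (0, 0) (Basis \<times> {0} \<union> Basis \<times> Basis)"

definition weak_jet :: "('a \<Rightarrow> real) \<Rightarrow> 'a \<times> 'a \<Rightarrow> 'a \<Rightarrow> real"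
  where "weak_jet u = (\<lambda>(b, c). let v = if b = 0 then u else weak_partial \<Omega> b u in
    if c = 0 then v else weak_partial \<Omega> c v)"

definition classical_jet :: "('a \<Rightarrow> real) \<Rightarrow> 'a \<times> 'a \<Rightarrow> 'a \<Rightarrow> real"
  where "classical_jet u = (\<lambda>(b, c). let v = if b = 0 then u else partial b u in
    if c = 0 then v else partial c v)"

definition is_jet :: "('a \<times> 'a \<Rightarrow> 'a \<Rightarrow> real) \<Rightarrow> bool"
  where "is_jet h \<longleftrightarrow> (\<forall>j\<in>jet_index. h j \<in> SI) \<and>
    (\<forall>b\<in>Basis. is_weak_partial \<Omega> b (h (0, 0)) (h (b, 0)) \<and>
      (\<forall>c\<in>Basis. is_weak_partial \<Omega> c (h (b, 0)) (h (b, c))))"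

lemma jet_index_mem [simp]:
  "(0, 0) \<in> jet_index" "b \<in> Basis \<Longrightarrow> (b, 0) \<in> jet_index"
  "b \<in> Basis \<Longrightarrow> c \<in> Basis \<Longrightarrow> (b, c) \<in> jet_index"
  by (auto simp: jet_index_def)

lemma finite_jet_index [simp]: "finite jet_index"
  by (simp add: jet_index_def)

lemma jet_index_cases:
  assumes "j \<in> jet_index"
  obtains "j = (0, 0)" | b where "j = (b, 0)" "b \<in> Basis" | b c where "j
      = (b, c)" "b \<in> Basis" "c \<in> Basis"
  using assms by (auto simp: jet_index_def)

lemma sum_jet_index:
  "(\<Sum>j\<in>jet_index. f j) = f (0, 0) + (\<Sum>b\<in>Basis. f (b, 0)) + (\<Sum>b\<in>Basis. \<Sum>c\<in>Basis. f (b, c))"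
  for f :: "'a \<times> 'a \<Rightarrow> real"
proof -
  have "(\<Sum>j\<in>jet_index. f j) = f (0, 0) + (\<Sum>j\<in>Basis \<times> {0} \<union> Basis \<times> Basis. f j)"
    unfolding jet_index_def by (subst sum.insert) auto
  also have "(\<Sum>j\<in>Basis \<times> {0} \<union> Basis \<times> Basis. f j) = (\<Sum>j\<in>Basis \<times> {0}. f j)
      + (\<Sum>j\<in>Basis \<times> Basis. f j)"
    by (rule sum.union_disjoint) auto
  also have "(\<Sum>j\<in>Basis \<times> {0}. f j) = (\<Sum>b\<in>Basis. \<Sum>c\<in>{0}. f (b, c))"
    unfolding sum.cartesian_product by simp
  also have "(\<Sum>j\<in>Basis \<times> Basis. f j) = (\<Sum>b\<in>Basis. \<Sum>c\<in>Basis. f (b, c))"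
    unfolding sum.cartesian_product by simp
  finally show ?thesis by simp
qed

lemma weak_jet_simps [simp]:
  "weak_jet u (0, 0) = u" "b \<in> Basis \<Longrightarrow> weak_jet u (b, 0) = weak_partial \<Omega> b u"
  "b \<in> Basis \<Longrightarrow> c \<in> Basis \<Longrightarrow> weak_jet u (b, c) = weak_partial \<Omega> c (weak_partial \<Omega> b u)"
  by (auto simp: weak_jet_def nonzero_Basis)

lemma classical_jet_simps [simp]:
  "classical_jet u (0, 0) = u" "b \<in> Basis \<Longrightarrow> classical_jet u (b, 0) = partial b u"
  "b \<in> Basis \<Longrightarrow> c \<in> Basis \<Longrightarrow> classical_jet u (b, c) = partial c (partial b u)"
  by (auto simp: classical_jet_def nonzero_Basis)

lemma is_jet_SI: "is_jet h \<Longrightarrow> j \<in> jet_index \<Longrightarrow> h j \<in> SI"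
  by (simp add: is_jet_def)

lemma is_jet_weak_partial:
  assumes "is_jet h" "b \<in> Basis"
  shows "is_weak_partial \<Omega> b (h (0, 0)) (h (b, 0))"
    and "c \<in> Basis \<Longrightarrow> is_weak_partial \<Omega> c (h (b, 0)) (h (b, c))"
  using assms by (auto simp: is_jet_def)

text \<open>A function is in \<open>H2\<close> as soon as some family of square integrable functions consists of
  its weak derivatives; the family then agrees with the chosen representatives.\<close>

lemma jet_imp_H2:
  assumes h: "is_jet h"
  shows "h (0, 0) \<in> H2 \<Omega>" and "\<And>j. j \<in> jet_index \<Longrightarrow> AE x in M. weak_jet (h (0, 0)) j x = h j x"
proof -
  let ?u = "h (0, 0)"
  note hSI = is_jet_SI[OF h]
  have u: "?u \<in> SI" by (simp add: hSI)
  have 1: "weak_partial \<Omega> b ?u \<in> SI" "AE x in M. weak_partial \<Omega> b ?u x = h (b, 0) x"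
      if "b \<in> Basis" for b
    using weak_partial_eqI[OF u u _ _ that is_jet_weak_partial(1)[OF h that]] hSI that by auto
  have 2: "weak_partial \<Omega> c (weak_partial \<Omega> b ?u) \<in> SI"
    "is_weak_partial \<Omega> c (weak_partial \<Omega> b ?u) (weak_partial \<Omega> c (weak_partial \<Omega> b ?u))"
    "AE x in M. weak_partial \<Omega> c (weak_partial \<Omega> b ?u) x = h (b, c) x"
    if "b \<in> Basis" "c \<in> Basis" for b c
  proof -
    have "AE x in M. h (b, 0) x = weak_partial \<Omega> b ?u x" using 1(2)[OF that(1)]
        by eventually_elim simp
    from weak_partial_eqI[OF _ 1(1)[OF that(1)] this _ that(2) is_jet_weak_partial(2)[OF h that]]
    show "weak_partial \<Omega> c (weak_partial \<Omega> b ?u) \<in> SI"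
      "is_weak_partial \<Omega> c (weak_partial \<Omega> b ?u) (weak_partial \<Omega> c (weak_partial \<Omega> b ?u))"
      "AE x in M. weak_partial \<Omega> c (weak_partial \<Omega> b ?u) x = h (b, c) x"
      using hSI that by auto
  qed
  have "?u \<in> H1 \<Omega>" unfolding H1_iff
  proof (intro conjI ballI u)
    fix b :: 'a assume b: "b \<in> Basis"
    show "\<exists>v\<in>SI. is_weak_partial \<Omega> b ?u v"
      using is_jet_weak_partial(1)[OF h b] hSI[OF jet_index_mem(2)[OF b]] by blast
  qed
  moreover have "weak_partial \<Omega> b ?u \<in> H1 \<Omega>" if "b \<in> Basis" for b
    unfolding H1_iff using 1(1)[OF that] 2(1,2)[OF that] by blast
  ultimately show "h (0, 0) \<in> H2 \<Omega>" by (simp add: H2_def)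
  show "AE x in M. weak_jet (h (0, 0)) j x = h j x" if "j \<in> jet_index" for j
    using that by (cases rule: jet_index_cases) (use 1 2 in auto)
qed

lemma H2_imp_jet: "u \<in> H2 \<Omega> \<Longrightarrow> is_jet (weak_jet u)"
  unfolding is_jet_def
proof (intro conjI ballI)
  assume u: "u \<in> H2 \<Omega>"
  then have u1: "u \<in> H1 \<Omega>" and u2: "\<And>b. b \<in> Basis \<Longrightarrow> weak_partial \<Omega> b u \<in> H1 \<Omega>" by
      (auto simp: H2_def)
  show "weak_jet u j \<in> SI" if "j \<in> jet_index" for j
    using that by (cases rule: jet_index_cases)
      (use H1_weak_partial(1)[OF u1] H1_weak_partial(1)[OF u2] u1[unfolded H1_iff] in auto)
  fix b :: 'a assume b: "b \<in> Basis"
  show "is_weak_partial \<Omega> b (weak_jet u (0, 0)) (weak_jet u (b, 0))"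
    using H1_weak_partial(2)[OF u1 b] b by simp
  fix c :: 'a assume c: "c \<in> Basis"
  show "is_weak_partial \<Omega> c (weak_jet u (b, 0)) (weak_jet u (b, c))"
    using H1_weak_partial(2)[OF u2[OF b] c] b c by simp
qed

lemma classical_jet_test:
  "\<phi> \<in> test_functions \<Omega> \<Longrightarrow> j \<in> jet_index \<Longrightarrow> classical_jet \<phi> j \<in> test_functions \<Omega>"
  by (erule jet_index_cases) (auto intro: test_function_partial)

lemma test_imp_jet:
  assumes "\<phi> \<in> test_functions \<Omega>"
  shows "is_jet (classical_jet \<phi>)"
  unfolding is_jet_def
  using assms
  by (auto intro!: test_square_integrable classical_jet_test is_weak_partial_test
      test_function_partial)

lemma is_jet_lincomb:
  assumes "is_jet g" "is_jet h"
  shows "is_jet (\<lambda>j. c *\<^sub>R g j + d *\<^sub>R h j)"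
  unfolding is_jet_def
  by (intro conjI ballI is_weak_partial_lincomb L2.closed is_jet_SI[OF assms(1)] is_jet_SI[OF
      assms(2)]
      is_jet_weak_partial[OF assms(1)] is_jet_weak_partial[OF assms(2)]) simp_all

lemma is_jet_limit:
  assumes s: "\<And>n. is_jet (s n)" and h: "\<And>j. j \<in> jet_index \<Longrightarrow> h j \<in> SI"
    and lim: "\<And>j. j \<in> jet_index \<Longrightarrow> (\<lambda>n. sqnorm M (s n j - h j)) \<longlonglongrightarrow> 0"
  shows "is_jet h"
  unfolding is_jet_def
proof (intro conjI ballI h)
  fix b c :: 'a assume b: "b \<in> Basis" and c: "c \<in> Basis"
  show "is_weak_partial \<Omega> c (h (b, 0)) (h (b, c))"
    by (rule is_weak_partial_limit[OF c is_jet_SI[OF s] h lim is_jet_SI[OF s] h lim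
        is_jet_weak_partial(2)[OF s b c]])
      (use b c in simp_all)
next
  fix b :: 'a assume b: "b \<in> Basis"
  show "is_weak_partial \<Omega> b (h (0, 0)) (h (b, 0))"
    by (rule is_weak_partial_limit[OF b is_jet_SI[OF s] h lim is_jet_SI[OF s] h lim
        is_jet_weak_partial(1)[OF s b]])
      (use b in simp_all)
qed

definition jet_norm2 :: "('a \<times> 'a \<Rightarrow> 'a \<Rightarrow> real) \<Rightarrow> real"
  where "jet_norm2 h = (\<Sum>j\<in>jet_index. sqnorm M (h j))"

lemma H2_norm_eq: "H2_norm \<Omega> u = sqrt (jet_norm2 (weak_jet u))"
  by (simp add: H2_norm_def jet_norm2_def sum_jet_index inner_L2_self)

lemma jet_norm2_bound:
  assumes "\<And>j. j \<in> jet_index \<Longrightarrow> h j \<in> SI" "j \<in> jet_index"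
  shows "0 \<le> sqnorm M (h j)" "sqnorm M (h j) \<le> jet_norm2 h"
proof -
  show "0 \<le> sqnorm M (h j)" using assms by (intro L2.nonneg)
  show "sqnorm M (h j) \<le> jet_norm2 h"
    unfolding jet_norm2_def using assms by (intro member_le_sum L2.nonneg) auto
qed

lemma jet_norm2_AE_cong:
  assumes "\<And>j. j \<in> jet_index \<Longrightarrow> g j \<in> SI" "\<And>j. j \<in> jet_index \<Longrightarrow> h j \<in> SI"
    "\<And>j. j \<in> jet_index \<Longrightarrow> AE x in M. g j x = h j x"
  shows "jet_norm2 g = jet_norm2 h"
  unfolding jet_norm2_def
  by (intro sum.cong refl inner_L2_AE_cong assms(3) square_integrable_measurable assms(1,2))

lemma jet_norm2_tendsto_0_iff:
  assumes "\<And>n j. j \<in> jet_index \<Longrightarrow> h n j \<in> SI"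
  shows "(\<lambda>n. jet_norm2 (h n)) \<longlonglongrightarrow> 0 \<longleftrightarrow>
    (\<forall>j\<in>jet_index. (\<lambda>n. sqnorm M (h n j)) \<longlonglongrightarrow> 0)"
proof
  assume lim: "(\<lambda>n. jet_norm2 (h n)) \<longlonglongrightarrow> 0"
  show "\<forall>j\<in>jet_index. (\<lambda>n. sqnorm M (h n j)) \<longlonglongrightarrow> 0"
  proof
    fix j assume j: "j \<in> jet_index"
    show "(\<lambda>n. sqnorm M (h n j)) \<longlonglongrightarrow> 0"
      by (rule Lim_null_comparison[OF _ lim])
        (use jet_norm2_bound[where h = "h n" for n, OF assms j] in \<open>simp add: always_eventually\<close>)
  qed
next
  assume "\<forall>j\<in>jet_index. (\<lambda>n. sqnorm M (h n j)) \<longlonglongrightarrow> 0"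
  then have "(\<lambda>n. jet_norm2 (h n)) \<longlonglongrightarrow> (\<Sum>j\<in>jet_index. 0)"
    unfolding jet_norm2_def by (intro tendsto_sum) auto
  then show "(\<lambda>n. jet_norm2 (h n)) \<longlonglongrightarrow> 0" by simp
qed

lemma jet_norm2_diff_tendsto_0_iff:
  assumes "\<And>n j. j \<in> jet_index \<Longrightarrow> f n j \<in> SI" "\<And>j. j \<in> jet_index \<Longrightarrow> g j \<in> SI"
  shows "(\<lambda>n. jet_norm2 (\<lambda>j. f n j - g j)) \<longlonglongrightarrow> 0 \<longleftrightarrow>
    (\<forall>j\<in>jet_index. (\<lambda>n. sqnorm M (f n j - g j)) \<longlonglongrightarrow> 0)"
  by (rule jet_norm2_tendsto_0_iff[where h = "\<lambda>n j. f n j - g j"]) (rule L2.closed(2)[OF assms])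

lemma jet_diff:
  assumes "is_jet g" "is_jet h"
  shows "is_jet (\<lambda>j. g j - h j)"
  using is_jet_lincomb[OF assms, of 1 "-1"] by simp

lemma jet_norm2_weak_jet_diff:
  assumes "is_jet g" "is_jet h"
  shows "jet_norm2 (weak_jet (g (0, 0) - h (0, 0))) = jet_norm2 (\<lambda>j. g j - h j)"
proof (rule jet_norm2_AE_cong)
  note d = jet_diff[OF assms]
  show "weak_jet (g (0, 0) - h (0, 0)) j \<in> SI" if "j \<in> jet_index" for j
    by (rule is_jet_SI[OF H2_imp_jet[OF jet_imp_H2(1)[OF d]] that])
  show "g j - h j \<in> SI" if "j \<in> jet_index" for j by (rule is_jet_SI[OF d that])
  show "AE x in M. weak_jet (g (0, 0) - h (0, 0)) j x = (g j - h j) x" if "j \<in> jet_index" for j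
    by (rule jet_imp_H2(2)[OF d that])
qed

section \<open>The space \<open>H\<^sup>2\<^sub>0\<close>\<close>

lemma H20_H2: "u \<in> H20 \<Omega> \<Longrightarrow> u \<in> H2 \<Omega>"
  by (simp add: H20_def)

lemmas H20_jet = H2_imp_jet[OF H20_H2]

lemma weak_jet_SI [simp, intro]: "u \<in> H20 \<Omega> \<Longrightarrow> j \<in> jet_index \<Longrightarrow> weak_jet u j \<in> SI"
  by (rule is_jet_SI[OF H20_jet])

lemma classical_jet_SI [simp, intro]: "\<phi> \<in> test_functions \<Omega> \<Longrightarrow> j \<in> jet_index \<Longrightarrow> classical_jet \<phi> j \<in>
    SI"
  by (rule is_jet_SI[OF test_imp_jet])

lemma H20_approx:
  assumes u: "u \<in> H20 \<Omega>"
  shows "\<exists>\<phi>. (\<forall>n::nat. \<phi> n \<in> test_functions \<Omega>) \<and>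
    (\<lambda>n. jet_norm2 (\<lambda>j. classical_jet (\<phi> n) j - weak_jet u j)) \<longlonglongrightarrow> 0"
proof -
  obtain \<phi> where \<phi>: "\<And>n. \<phi> n \<in> test_functions \<Omega>"
    "(\<lambda>n::nat. H2_norm \<Omega> (\<lambda>x. u x - \<phi> n x)) \<longlonglongrightarrow> 0"
    using u unfolding H20_def by blast
  have "(\<lambda>n. (H2_norm \<Omega> (\<lambda>x. u x - \<phi> n x))\<^sup>2) \<longlonglongrightarrow> 0"
    using tendsto_power[OF \<phi>(2), of 2] by simp
  moreover have "(H2_norm \<Omega> (\<lambda>x. u x - \<phi> n x))\<^sup>2
      = jet_norm2 (\<lambda>j. classical_jet (\<phi> n) j - weak_jet u j)" for n
  proof -
    have nn: "0 \<le> jet_norm2 (\<lambda>j. weak_jet u j - classical_jet (\<phi> n) j)"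
      unfolding jet_norm2_def using u \<phi>(1) by (intro sum_nonneg L2.nonneg L2.closed) auto
    have "(\<lambda>x. u x - \<phi> n x) = weak_jet u (0, 0) - classical_jet (\<phi> n) (0, 0)" by auto
    then have "jet_norm2 (weak_jet (\<lambda>x. u x - \<phi> n x))
        = jet_norm2 (\<lambda>j. weak_jet u j - classical_jet (\<phi> n) j)"
      using jet_norm2_weak_jet_diff[OF H20_jet[OF u] test_imp_jet[OF \<phi>(1)[of n]]] by simp
    also have "\<dots> = jet_norm2 (\<lambda>j. classical_jet (\<phi> n) j - weak_jet u j)"
      by (simp add: jet_norm2_def inner_L2_self power2_commute)
    finally show ?thesis using nn by (simp add: H2_norm_eq jet_norm2_def inner_L2_self
        power2_commute)
  qed
  ultimately show ?thesis by (intro exI[of _ \<phi>] conjI allI \<phi>(1)) simp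
qed

text \<open>\<open>H\<^sup>2\<^sub>0\<close> consists of the limits of the jets of test functions. This and the converse
  \<open>H20_approx\<close> reduce linearity and completeness of \<open>H\<^sup>2\<^sub>0\<close> to properties of \<open>L\<^sup>2\<close>.\<close>

lemma H20_limitI:
  assumes \<phi>: "\<And>n. \<phi> n \<in> test_functions \<Omega>" and g: "\<And>j. j \<in> jet_index \<Longrightarrow> g j \<in> SI"
    and lim: "(\<lambda>n::nat. jet_norm2 (\<lambda>j. classical_jet (\<phi> n) j - g j)) \<longlonglongrightarrow> 0"
  shows "g (0, 0) \<in> H20 \<Omega>" "\<And>j. j \<in> jet_index \<Longrightarrow> AE x in M. weak_jet (g (0, 0)) j x = g j x"
proof -
  have "(\<lambda>n. sqnorm M (classical_jet (\<phi> n) j - g j)) \<longlonglongrightarrow> 0"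
    if "j \<in> jet_index" for j
    using lim that
      jet_norm2_diff_tendsto_0_iff[where f = "\<lambda>n. classical_jet (\<phi> n)" and g
          = g, OF classical_jet_SI[OF \<phi>] g]
    by blast
  then have jet: "is_jet g"
    by (intro is_jet_limit[where s = "\<lambda>n. classical_jet (\<phi> n)", OF test_imp_jet[OF \<phi>] g])
  show "AE x in M. weak_jet (g (0, 0)) j x = g j x" if "j \<in> jet_index" for j
    by (rule jet_imp_H2(2)[OF jet that])
  have "H2_norm \<Omega> (\<lambda>x. g (0, 0) x - \<phi> n x) = sqrt (jet_norm2 (\<lambda>j. classical_jet (\<phi> n) j - g j))"
      for n
  proof -
    have "(\<lambda>x. g (0, 0) x - \<phi> n x) = g (0, 0) - classical_jet (\<phi> n) (0, 0)" by auto
    then show ?thesis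
      using jet_norm2_weak_jet_diff[OF jet test_imp_jet[OF \<phi>[of n]]]
      by (simp add: H2_norm_eq jet_norm2_def inner_L2_self power2_commute)
  qed
  moreover have "(\<lambda>n. sqrt (jet_norm2 (\<lambda>j. classical_jet (\<phi> n) j - g j))) \<longlonglongrightarrow> 0"
    using tendsto_real_sqrt[OF lim] by simp
  ultimately show "g (0, 0) \<in> H20 \<Omega>"
    using jet_imp_H2(1)[OF jet] \<phi> unfolding H20_def by (intro CollectI conjI exI[of _ \<phi>]) simp_all
qed

lemma test_in_H20:
  assumes "\<phi> \<in> test_functions \<Omega>"
  shows "\<phi> \<in> H20 \<Omega>" "\<And>j. j \<in> jet_index \<Longrightarrow> AE x in M. weak_jet \<phi> j x = classical_jet \<phi> j x"
proof -
  have "(\<lambda>n::nat. jet_norm2 (\<lambda>j. classical_jet \<phi> j - classical_jet \<phi> j)) \<longlonglongrightarrow> 0"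
    by (simp add: jet_norm2_def inner_L2_self)
  from H20_limitI[OF _ _ this] assms
  show "\<phi> \<in> H20 \<Omega>" "\<And>j. j \<in> jet_index \<Longrightarrow> AE x in M. weak_jet \<phi> j x = classical_jet \<phi> j x"
    by auto
qed

lemma classical_jet_lincomb:
  assumes "\<phi> \<in> test_functions \<Omega>" "\<psi> \<in> test_functions \<Omega>" "j \<in> jet_index"
  shows "classical_jet (c *\<^sub>R \<phi> + d *\<^sub>R \<psi>) j = c *\<^sub>R classical_jet \<phi> j + d *\<^sub>R classical_jet \<psi> j"
proof -
  have p: "partial b (c *\<^sub>R \<phi> + d *\<^sub>R \<psi>) = c *\<^sub>R partial b \<phi> + d *\<^sub>R partial b \<psi>"
    if "\<phi> \<in> test_functions \<Omega>" "\<psi> \<in> test_functions \<Omega>" for b \<phi> \<psi>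
  proof
    fix x
    note sm = test_function_smooth[OF that(1)] test_function_smooth[OF that(2)]
    have "partial b (\<lambda>x. c * \<phi> x + d * \<psi> x) x = partial b (\<lambda>x. c * \<phi> x) x
        + partial b (\<lambda>x. d * \<psi> x) x"
      by (intro partial_add C_k_mult C_k_const sm)
    then show "partial b (c *\<^sub>R \<phi> + d *\<^sub>R \<psi>) x = (c *\<^sub>R partial b \<phi> + d *\<^sub>R partial b \<psi>) x"
      by (simp add: plus_fun_def scaleR_fun_def partial_scale[OF sm(1)] partial_scale[OF sm(2)])
  qed
  show ?thesis
    using assms(3) by (cases rule: jet_index_cases) (auto simp: p assms test_function_partial)
qed

lemma H20_lincomb:
  assumes u: "u \<in> H20 \<Omega>" and v: "v \<in> H20 \<Omega>"
  shows "c *\<^sub>R u + d *\<^sub>R v \<in> H20 \<Omega>"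
    "\<And>j. j \<in> jet_index \<Longrightarrow>
      AE x in M. weak_jet (c *\<^sub>R u + d *\<^sub>R v) j x = c * weak_jet u j x + d * weak_jet v j x"
proof -
  obtain \<phi> where \<phi>: "\<And>n. \<phi> n \<in> test_functions \<Omega>"
    "(\<lambda>n::nat. jet_norm2 (\<lambda>j. classical_jet (\<phi> n) j - weak_jet u j)) \<longlonglongrightarrow> 0"
    using H20_approx[OF u] by blast
  obtain \<psi> where \<psi>: "\<And>n. \<psi> n \<in> test_functions \<Omega>"
    "(\<lambda>n::nat. jet_norm2 (\<lambda>j. classical_jet (\<psi> n) j - weak_jet v j)) \<longlonglongrightarrow> 0"
    using H20_approx[OF v] by blast
  define g where "g j = c *\<^sub>R weak_jet u j + d *\<^sub>R weak_jet v j" for j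
  have gSI: "g j \<in> SI" if "j \<in> jet_index" for j
    unfolding g_def using u v that by (intro L2.closed weak_jet_SI)
  have t: "c *\<^sub>R \<phi> n + d *\<^sub>R \<psi> n \<in> test_functions \<Omega>" for n
    using test_function_add[OF test_function_scale[OF \<phi>(1)[of n], of c] test_function_scale[OF
        \<psi>(1)[of n], of d]]
    by (simp add: plus_fun_def scaleR_fun_def)
  have "(\<lambda>n. jet_norm2 (\<lambda>j. classical_jet (c *\<^sub>R \<phi> n + d *\<^sub>R \<psi> n) j - g j)) \<longlonglongrightarrow> 0"
  proof (rule Lim_null_comparison)
    show "(\<lambda>n. 2 * c\<^sup>2 * jet_norm2 (\<lambda>j. classical_jet (\<phi> n) j - weak_jet u j)
        + 2 * d\<^sup>2 * jet_norm2 (\<lambda>j. classical_jet (\<psi> n) j - weak_jet v j)) \<longlonglongrightarrow> 0"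
      by (intro tendsto_add_zero tendsto_mult_right_zero \<phi>(2) \<psi>(2))
    show "\<forall>\<^sub>F n in sequentially. norm (jet_norm2 (\<lambda>j. classical_jet (c *\<^sub>R \<phi> n
        + d *\<^sub>R \<psi> n) j - g j))
      \<le> 2 * c\<^sup>2 * jet_norm2 (\<lambda>j. classical_jet (\<phi> n) j - weak_jet u j)
        + 2 * d\<^sup>2 * jet_norm2 (\<lambda>j. classical_jet (\<psi> n) j - weak_jet v j)"
    proof (intro always_eventually allI)
      fix n
      have "0 \<le> jet_norm2 (\<lambda>j. classical_jet (c *\<^sub>R \<phi> n + d *\<^sub>R \<psi> n) j - g j)"
        unfolding jet_norm2_def using t gSI by (intro sum_nonneg L2.nonneg L2.closed) auto
      moreover have "jet_norm2 (\<lambda>j. classical_jet (c *\<^sub>R \<phi> n + d *\<^sub>R \<psi> n) j - g j)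
        \<le> 2 * c\<^sup>2 * jet_norm2 (\<lambda>j. classical_jet (\<phi> n) j - weak_jet u j)
        + 2 * d\<^sup>2 * jet_norm2 (\<lambda>j. classical_jet (\<psi> n) j - weak_jet v j)"
        unfolding jet_norm2_def sum_distrib_left sum.distrib[symmetric]
      proof (rule sum_mono)
        fix j assume j: "j \<in> jet_index"
        let ?p = "classical_jet (\<phi> n) j - weak_jet u j" and ?q
            = "classical_jet (\<psi> n) j - weak_jet v j"
        have pq: "?p \<in> SI" "?q \<in> SI" by (intro L2.closed(2) weak_jet_SI classical_jet_SI u v \<phi>(1)
            \<psi>(1) j)+
        have eq: "classical_jet (c *\<^sub>R \<phi> n + d *\<^sub>R \<psi> n) j - g j = c *\<^sub>R ?p + d *\<^sub>R ?q"
          unfolding classical_jet_lincomb[OF \<phi>(1) \<psi>(1) j] g_def by (simp add: scaleR_diff_right)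
        have "sqnorm M (c *\<^sub>R ?p + d *\<^sub>R ?q)
            \<le> 2 * sqnorm M (c *\<^sub>R ?p) + 2 * sqnorm M (d *\<^sub>R ?q)"
          by (rule L2.quad_sum_le[OF L2.closed(3)[OF pq(1)] L2.closed(3)[OF pq(2)]])
        also have "\<dots> = 2 * c\<^sup>2 * sqnorm M ?p + 2 * d\<^sup>2 * sqnorm M ?q"
          using pq by (simp add: L2.scale_left L2.scale_right L2.closed(3) power2_eq_square)
        finally show "sqnorm M (classical_jet (c *\<^sub>R \<phi> n + d *\<^sub>R \<psi> n) j - g j)
            \<le> 2 * c\<^sup>2 * sqnorm M ?p + 2 * d\<^sup>2 * sqnorm M ?q"
          unfolding eq .
      qed
      ultimately show "norm (jet_norm2 (\<lambda>j. classical_jet (c *\<^sub>R \<phi> n + d *\<^sub>R \<psi> n) j - g j))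
        \<le> 2 * c\<^sup>2 * jet_norm2 (\<lambda>j. classical_jet (\<phi> n) j - weak_jet u j)
        + 2 * d\<^sup>2 * jet_norm2 (\<lambda>j. classical_jet (\<psi> n) j - weak_jet v j)" by simp
    qed
  qed
  from H20_limitI[OF t gSI this]
  show "c *\<^sub>R u + d *\<^sub>R v \<in> H20 \<Omega>"
    "\<And>j. j \<in> jet_index \<Longrightarrow>
      AE x in M. weak_jet (c *\<^sub>R u + d *\<^sub>R v) j x = c * weak_jet u j x + d * weak_jet v j x"
    by (simp_all add: g_def)
qed

lemma subspace_H20: "subspace (H20 \<Omega>)"
proof -
  have "0 \<in> H20 \<Omega>" using test_in_H20(1)[OF test_function_zero] by (simp add: zero_fun_def)
  moreover have "u + v \<in> H20 \<Omega>" if "u \<in> H20 \<Omega>" "v \<in> H20 \<Omega>" for u v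
    using H20_lincomb(1)[OF that, of 1 1] by simp
  moreover have "c *\<^sub>R u \<in> H20 \<Omega>" if "u \<in> H20 \<Omega>" for u c
    using H20_lincomb(1)[OF that that, of c 0] by simp
  ultimately show ?thesis by (simp add: subspace_def)
qed

text \<open>The jets converge in \<open>L\<^sup>2\<close>, component by component. Replacing every member of the sequence
  by a test function at distance tending to zero, one sees that the limit belongs to \<open>H\<^sup>2\<^sub>0\<close>.\<close>

lemma H20_complete:
  assumes s: "\<And>n. s n \<in> H20 \<Omega>"
    and cauchy: "\<And>e. e > 0 \<Longrightarrow> \<exists>N. \<forall>i\<ge>N. \<forall>k\<ge>N. jet_norm2 (weak_jet (s i - s k)) < e"
  shows "\<exists>u\<in>H20 \<Omega>. (\<lambda>n. jet_norm2 (weak_jet (s n - u))) \<longlonglongrightarrow> 0"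
proof -
  have dist: "jet_norm2 (weak_jet (s i - s k)) = jet_norm2 (\<lambda>j. weak_jet (s i) j - weak_jet (s k)
      j)" for i k
    using jet_norm2_weak_jet_diff[OF H20_jet[OF s] H20_jet[OF s], of i k] by simp
  have "\<exists>g\<in>SI. (\<lambda>n. sqnorm M (weak_jet (s n) j - g)) \<longlonglongrightarrow> 0"
    if j: "j \<in> jet_index" for j
  proof (rule L2_complete)
    show "finite_measure M" by (rule M.finite_measure_axioms)
    show "weak_jet (s n) j \<in> SI" for n using s j by simp
    fix e :: real assume "e > 0"
    from cauchy[OF this] obtain N where
      N: "\<forall>i\<ge>N. \<forall>k\<ge>N. jet_norm2 (\<lambda>j. weak_jet (s i) j - weak_jet (s k) j) < e"
      unfolding dist by blast
    have "sqnorm M (weak_jet (s i) j - weak_jet (s k) j) < e"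
      if "i \<ge> N" "k \<ge> N" for i k
    proof -
      have "sqnorm M (weak_jet (s i) j - weak_jet (s k) j)
          \<le> jet_norm2 (\<lambda>j. weak_jet (s i) j - weak_jet (s k) j)"
        by (rule jet_norm2_bound(2)[OF _ j]) (intro L2.closed(2) weak_jet_SI s)
      also have "\<dots> < e" using N that by simp
      finally show ?thesis .
    qed
    then show "\<exists>N. \<forall>i\<ge>N. \<forall>k\<ge>N.
      sqnorm M (weak_jet (s i) j - weak_jet (s k) j) < e" by blast
  qed
  then have "\<forall>j\<in>jet_index. \<exists>g. g \<in> SI \<and>
      (\<lambda>n. sqnorm M (weak_jet (s n) j - g)) \<longlonglongrightarrow> 0" by blast
  from bchoice[OF this] obtain g where g: "\<And>j. j \<in> jet_index \<Longrightarrow> g j \<in> SI"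
    "\<And>j. j \<in> jet_index \<Longrightarrow> (\<lambda>n. sqnorm M (weak_jet (s n) j - g j)) \<longlonglongrightarrow> 0"
    by blast
  have "\<exists>\<phi>\<in>test_functions \<Omega>. jet_norm2 (\<lambda>j. classical_jet \<phi> j - weak_jet (s n) j)
      < 1 / real (Suc n)" for n
  proof -
    obtain \<phi> where \<phi>: "\<And>m. \<phi> m \<in> test_functions \<Omega>"
      "(\<lambda>m::nat. jet_norm2 (\<lambda>j. classical_jet (\<phi> m) j - weak_jet (s n) j)) \<longlonglongrightarrow> 0"
      using H20_approx[OF s[of n]] by blast
    have "\<forall>\<^sub>F m in sequentially. jet_norm2 (\<lambda>j. classical_jet (\<phi> m) j - weak_jet (s n) j)
        < 1 / real (Suc n)"
      by (rule order_tendstoD(2)[OF \<phi>(2)]) simp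
    then obtain m where "jet_norm2 (\<lambda>j. classical_jet (\<phi> m) j - weak_jet (s n) j)
        < 1 / real (Suc n)"
      by (auto simp: eventually_sequentially)
    then show ?thesis using \<phi>(1) by blast
  qed
  then obtain \<phi> where \<phi>: "\<And>n. \<phi> n \<in> test_functions \<Omega>"
    "\<And>n. jet_norm2 (\<lambda>j. classical_jet (\<phi> n) j - weak_jet (s n) j) < 1 / real (Suc n)" by metis
  have "(\<lambda>n. sqnorm M (classical_jet (\<phi> n) j - g j)) \<longlonglongrightarrow> 0"
    if j: "j \<in> jet_index" for j
  proof (rule Lim_null_comparison)
    show "(\<lambda>n. 2 * (1 / real (Suc n)) + 2 * sqnorm M (weak_jet (s n) j - g j)) \<longlonglongrightarrow> 0"
      by (intro tendsto_add_zero tendsto_mult_right_zero g(2)[OF j] LIMSEQ_Suc[OF lim_1_over_n])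
    show "\<forall>\<^sub>F n in sequentially. norm (sqnorm M (classical_jet (\<phi> n) j - g j))
      \<le> 2 * (1 / real (Suc n)) + 2 * sqnorm M (weak_jet (s n) j - g j)"
    proof (intro always_eventually allI)
      fix n
      let ?p = "classical_jet (\<phi> n) j - weak_jet (s n) j" and ?q = "weak_jet (s n) j - g j"
      have pq: "?p \<in> SI" "?q \<in> SI" by (intro L2.closed(2) weak_jet_SI classical_jet_SI s g(1) \<phi>(1)
          j)+
      have "sqnorm M ?p \<le> jet_norm2 (\<lambda>j. classical_jet (\<phi> n) j - weak_jet (s n) j)"
        by (rule jet_norm2_bound(2)[OF _ j]) (intro L2.closed(2) weak_jet_SI classical_jet_SI s
            \<phi>(1))
      then have "sqnorm M ?p \<le> 1 / real (Suc n)" using \<phi>(2)[of n] by linarith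
      moreover have "sqnorm M (?p + ?q) \<le> 2 * sqnorm M ?p + 2 * sqnorm M ?q"
        by (rule L2.quad_sum_le[OF pq])
      moreover have "0 \<le> sqnorm M (?p + ?q)" by (rule L2.nonneg[OF L2.closed(1)[OF pq]])
      moreover have "?p + ?q = classical_jet (\<phi> n) j - g j" by simp
      ultimately show "norm (sqnorm M (classical_jet (\<phi> n) j - g j))
        \<le> 2 * (1 / real (Suc n)) + 2 * sqnorm M ?q" by simp
    qed
  qed
  then have "(\<lambda>n. jet_norm2 (\<lambda>j. classical_jet (\<phi> n) j - g j)) \<longlonglongrightarrow> 0"
    using jet_norm2_diff_tendsto_0_iff[where f = "\<lambda>n. classical_jet (\<phi> n)" and g = g,
        OF classical_jet_SI[OF \<phi>(1)] g(1)]
    by blast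
  from H20_limitI[OF \<phi>(1) g(1) this]
  have u: "g (0, 0) \<in> H20 \<Omega>" "\<And>j. j \<in> jet_index \<Longrightarrow> AE x in M. weak_jet (g (0, 0)) j x = g j x"
    by auto
  have "jet_norm2 (weak_jet (s n - g (0, 0))) = jet_norm2 (\<lambda>j. weak_jet (s n) j - g j)" for n
  proof -
    have "jet_norm2 (weak_jet (s n - g (0, 0))) = jet_norm2 (\<lambda>j. weak_jet (s n) j - weak_jet (g
        (0, 0)) j)"
      using jet_norm2_weak_jet_diff[OF H20_jet[OF s] H20_jet[OF u(1)], of n] by simp
    also have "\<dots> = jet_norm2 (\<lambda>j. weak_jet (s n) j - g j)"
    proof (rule jet_norm2_AE_cong)
      fix j assume j: "j \<in> jet_index"
      show "weak_jet (s n) j - weak_jet (g (0, 0)) j \<in> SI" "weak_jet (s n) j - g j \<in> SI"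
        by (intro L2.closed(2) weak_jet_SI s u(1) g(1) j)+
      show "AE x in M. (weak_jet (s n) j - weak_jet (g (0, 0)) j) x = (weak_jet (s n) j - g j) x"
        using u(2)[OF j] by eventually_elim simp
    qed
    finally show ?thesis .
  qed
  moreover have "(\<lambda>n. jet_norm2 (\<lambda>j. weak_jet (s n) j - g j)) \<longlonglongrightarrow> 0"
    using g(2) jet_norm2_diff_tendsto_0_iff[where f = "\<lambda>n. weak_jet (s n)" and g = g,
        OF weak_jet_SI[OF s] g(1)]
    by blast
  ultimately show ?thesis using u(1) by (intro bexI[of _ "g (0, 0)"]) simp_all
qed

section \<open>Energy identities\<close>

lemma inner_jet_limit:
  assumes u: "u \<in> H20 \<Omega>" and \<phi>: "\<And>n. \<phi> n \<in> test_functions \<Omega>"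
    and lim: "(\<lambda>n::nat. jet_norm2 (\<lambda>j. classical_jet (\<phi> n) j - weak_jet u j)) \<longlonglongrightarrow> 0"
    and j: "j \<in> jet_index"
  shows "(\<lambda>n. sqnorm M (classical_jet (\<phi> n) j - weak_jet u j)) \<longlonglongrightarrow> 0"
  using lim j jet_norm2_diff_tendsto_0_iff[where f = "\<lambda>n. classical_jet (\<phi> n)" and g = "weak_jet u",
      OF classical_jet_SI[OF \<phi>] weak_jet_SI[OF u]]
  by blast

text \<open>For a test function in place of \<open>u\<close> this is the definition of the weak derivative of
  \<open>weak_partial \<Omega> b v\<close>; both sides are continuous in \<open>u\<close>.\<close>

lemma H20_green:
  assumes u: "u \<in> H20 \<Omega>" and v: "v \<in> H20 \<Omega>" and b: "b \<in> Basis"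
  shows "inner_L2 M (weak_jet u (b, 0)) (weak_jet v (b, 0)) = - inner_L2 M u (weak_jet v (b, b))"
proof -
  obtain \<phi> where \<phi>: "\<And>n. \<phi> n \<in> test_functions \<Omega>"
    "(\<lambda>n::nat. jet_norm2 (\<lambda>j. classical_jet (\<phi> n) j - weak_jet u j)) \<longlonglongrightarrow> 0"
    using H20_approx[OF u] by blast
  note lim = inner_jet_limit[OF u \<phi>]
  have "(\<lambda>n. inner_L2 M (classical_jet (\<phi> n) (b, 0)) (weak_jet v (b, 0)))
      \<longlonglongrightarrow> inner_L2 M (weak_jet u (b, 0)) (weak_jet v (b, 0))"
    by (intro L2.tendsto_form_left lim classical_jet_SI weak_jet_SI \<phi>(1) u v jet_index_mem b)
  moreover have "(\<lambda>n. - inner_L2 M (classical_jet (\<phi> n) (0, 0)) (weak_jet v (b, b)))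
      \<longlonglongrightarrow> - inner_L2 M (weak_jet u (0, 0)) (weak_jet v (b, b))"
    by (intro tendsto_minus L2.tendsto_form_left lim classical_jet_SI weak_jet_SI \<phi>(1) u v
        jet_index_mem b)
  moreover have "inner_L2 M (classical_jet (\<phi> n) (b, 0)) (weak_jet v (b, 0))
      = - inner_L2 M (classical_jet (\<phi> n) (0, 0)) (weak_jet v (b, b))" for n
  proof -
    have "inner_L2 M (weak_jet v (b, 0)) (partial b (\<phi> n)) = - inner_L2 M (weak_jet v (b, b)) (\<phi> n)"
      using is_jet_weak_partial(2)[OF H20_jet[OF v] b b] \<phi>(1) by (simp add: is_weak_partial_iff)
    then show ?thesis
      using b by (simp add: inner_L2_def mult.commute)
  qed
  ultimately have "inner_L2 M (weak_jet u (b, 0)) (weak_jet v (b, 0))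
      = - inner_L2 M (weak_jet u (0, 0)) (weak_jet v (b, b))"
    by (simp only: LIMSEQ_unique)
  then show ?thesis by simp
qed

lemma H20_hessian:
  assumes u: "u \<in> H20 \<Omega>" and b: "b \<in> Basis" and c: "c \<in> Basis"
  shows "sqnorm M (weak_jet u (b, c)) = inner_L2 M (weak_jet u (b, b)) (weak_jet u (c, c))"
proof -
  obtain \<phi> where \<phi>: "\<And>n. \<phi> n \<in> test_functions \<Omega>"
    "(\<lambda>n::nat. jet_norm2 (\<lambda>j. classical_jet (\<phi> n) j - weak_jet u j)) \<longlonglongrightarrow> 0"
    using H20_approx[OF u] by blast
  note lim = inner_jet_limit[OF u \<phi>]
  have *: "(\<lambda>n. inner_L2 M (classical_jet (\<phi> n) i) (classical_jet (\<phi> n) j))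
      \<longlonglongrightarrow> inner_L2 M (weak_jet u i) (weak_jet u j)" if "i \<in> jet_index" "j \<in> jet_index" for i j
    by (intro L2.tendsto_form lim classical_jet_SI weak_jet_SI \<phi>(1) u that)
  have "sqnorm M (classical_jet (\<phi> n) (b, c))
      = inner_L2 M (classical_jet (\<phi> n) (b, b)) (classical_jet (\<phi> n) (c, c))" for n
    using integral_hessian[OF test_functions_UNIV[OF \<phi>(1)] b c]
    by (simp add: test_inner_L2 test_function_partial \<phi>(1) b c)
  then have "(\<lambda>n. inner_L2 M (classical_jet (\<phi> n) (b, b)) (classical_jet (\<phi> n) (c, c)))
      \<longlonglongrightarrow> sqnorm M (weak_jet u (b, c))"
    using *[of "(b, c)" "(b, c)"] b c by (simp only: jet_index_mem)
  then show ?thesis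
    by (rule LIMSEQ_unique[OF _ *[OF jet_index_mem(3)[OF b b] jet_index_mem(3)[OF c c]]])
qed

end

section \<open>Rellich compactness\<close>

text \<open>Jensen's inequality for the square, without normalisation. The upper integral on the
  right-hand side makes Tonelli's theorem applicable where the lemma is used.\<close>

lemma square_of_set_integral_le:
  fixes f :: "'b \<Rightarrow> real"
  assumes [measurable]: "f \<in> borel_measurable N" "B \<in> sets N"
  shows "ennreal ((LINT y|N. indicator B y * f y)\<^sup>2)
    \<le> emeasure N B * (\<integral>\<^sup>+y. indicator B y * ennreal ((f y)\<^sup>2) \<partial>N)"
proof (cases "integrable N (\<lambda>y. indicator B y * f y)")
  case False
  then show ?thesis by (simp add: not_integrable_integral_eq)
next
  case True
  have "ennreal ((LINT y|N. indicator B y * f y)\<^sup>2)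
      = (ennreal (norm (LINT y|N. indicator B y * f y)))\<^sup>2"
    by (simp add: ennreal_power)
  also have "\<dots> \<le> (\<integral>\<^sup>+y. ennreal (norm (indicator B y * f y)) \<partial>N)\<^sup>2"
    by (intro power_mono integral_norm_bound_ennreal True) simp
  also have "\<dots> = (\<integral>\<^sup>+y. indicator B y * ennreal \<bar>indicator B y * f y\<bar> \<partial>N)\<^sup>2"
    by (intro arg_cong[where f = "\<lambda>x. x\<^sup>2"] nn_integral_cong) (auto simp: indicator_def)
  also have "\<dots> \<le> (\<integral>\<^sup>+y. (indicator B y)\<^sup>2 \<partial>N) * (\<integral>\<^sup>+y. (ennreal \<bar>indicator B y * f y\<bar>)\<^sup>2 \<partial>N)"
    by (rule Cauchy_Schwarz_nn_integral) measurable
  also have "(\<integral>\<^sup>+y. (indicator B y)\<^sup>2 \<partial>N) = (\<integral>\<^sup>+y. indicator B y \<partial>N)"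
    by (intro nn_integral_cong) (auto simp: indicator_def)
  also have "\<dots> = emeasure N B" by simp
  also have "(\<integral>\<^sup>+y. (ennreal \<bar>indicator B y * f y\<bar>)\<^sup>2 \<partial>N)
      = (\<integral>\<^sup>+y. indicator B y * ennreal ((f y)\<^sup>2) \<partial>N)"
    by (intro nn_integral_cong) (auto simp: indicator_def ennreal_power)
  finally show ?thesis .
qed

definition grad_energy :: "('a::euclidean_space \<Rightarrow> real) \<Rightarrow> real"
  where "grad_energy \<phi> = (\<Sum>b\<in>Basis. LINT x|lborel. (partial b \<phi> x)\<^sup>2)"

lemma grad_energy_nonneg: "0 \<le> grad_energy \<phi>"
  unfolding grad_energy_def by (intro sum_nonneg integral_nonneg_AE) auto

lemma nn_integral_translate:
  fixes f :: "'a::euclidean_space \<Rightarrow> ennreal"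
  assumes [measurable]: "f \<in> borel_measurable borel"
  shows "(\<integral>\<^sup>+x. f (x + c) \<partial>lborel) = (\<integral>\<^sup>+x. f x \<partial>lborel)"
proof -
  have "(\<integral>\<^sup>+x. f x \<partial>lborel) = (\<integral>\<^sup>+x. f x \<partial>distr lborel borel ((+) c))"
    by (simp add: lborel_distr_plus)
  also have "\<dots> = (\<integral>\<^sup>+x. f (c + x) \<partial>lborel)"
    by (subst nn_integral_distr) auto
  finally show ?thesis by (simp add: add.commute)
qed

lemma directional_derivative:
  assumes "\<And>n. C_k n \<phi>"
  shows "partial h \<phi> x = (\<Sum>b\<in>Basis. (h \<bullet> b) * partial b \<phi> x)"
proof -
  have lin: "linear (\<lambda>v. partial v \<phi> x)"
    by (rule has_derivative_linear[OF C_k_has_derivative[OF assms]])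
  have "partial h \<phi> x = partial (\<Sum>b\<in>Basis. (h \<bullet> b) *\<^sub>R b) \<phi> x"
    by (simp only: euclidean_representation)
  also have "\<dots> = (\<Sum>b\<in>Basis. partial ((h \<bullet> b) *\<^sub>R b) \<phi> x)"
    by (rule linear_sum[OF lin])
  also have "\<dots> = (\<Sum>b\<in>Basis. (h \<bullet> b) * partial b \<phi> x)"
    by (intro sum.cong refl) (simp add: linear_scale[OF lin])
  finally show ?thesis .
qed

lemma directional_derivative_square_le:
  assumes "\<And>n. C_k n \<phi>"
  shows "(partial h \<phi> x)\<^sup>2 \<le> (norm h)\<^sup>2 * (\<Sum>b\<in>Basis. (partial b \<phi> x)\<^sup>2)"
proof -
  have "(partial h \<phi> x)\<^sup>2 \<le> (\<Sum>b\<in>Basis. (h \<bullet> b)\<^sup>2) * (\<Sum>b\<in>Basis. (partial b \<phi> x)\<^sup>2)"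
    unfolding directional_derivative[OF assms, of h] by (rule Cauchy_Schwarz_ineq_sum)
  also have "(\<Sum>b\<in>Basis. (h \<bullet> b)\<^sup>2) = (norm h)\<^sup>2"
    unfolding power2_norm_eq_inner by (subst euclidean_inner) (simp add: power2_eq_square)
  finally show ?thesis .
qed

text \<open>The increment is the integral of the directional derivative along the segment from \<open>x\<close> to
  \<open>x + h\<close>. After squaring, the order of integration is exchanged, and translation invariance
  removes the dependence on the position on the segment.\<close>

lemma translation_estimate:
  fixes \<phi> :: "'a::euclidean_space \<Rightarrow> real"
  assumes \<phi>: "\<phi> \<in> test_functions UNIV"
  shows "(\<integral>\<^sup>+x. ennreal ((\<phi> (x + h) - \<phi> x)\<^sup>2) \<partial>lborel) \<le> ennreal ((norm h)\<^sup>2 * grad_energy \<phi>)"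
proof -
  note sm = test_function_smooth[OF \<phi>]
  define S where "S x = (\<Sum>b\<in>Basis. (partial b \<phi> x)\<^sup>2)" for x
  have pb [measurable]: "partial b \<phi> \<in> borel_measurable borel" if "b \<in> Basis" for b
    by (rule test_function_borel[OF test_function_partial[OF \<phi> that]])
  have S [measurable]: "S \<in> borel_measurable borel" unfolding S_def[abs_def] by measurable
  have S0: "S x \<ge> 0" for x by (auto simp: S_def intro: sum_nonneg)
  have Sint: "(\<integral>\<^sup>+x. ennreal (S x) \<partial>lborel) = ennreal (grad_energy \<phi>)"
  proof -
    have i: "integrable lborel (\<lambda>x. (partial b \<phi> x)\<^sup>2)" if "b \<in> Basis" for b
      unfolding power2_eq_square
      by (rule test_function_integrable[OF test_function_mult[OF test_function_smooth]])
        (rule test_function_partial[OF \<phi> that])+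
    have "integrable lborel S" unfolding S_def[abs_def] by (intro
        Bochner_Integration.integrable_sum i)
    moreover have "(LINT x|lborel. S x) = grad_energy \<phi>"
      unfolding S_def grad_energy_def by (intro Bochner_Integration.integral_sum i)
    ultimately show ?thesis using S0 by (simp add: nn_integral_eq_integral)
  qed
  have pcont: "continuous_on UNIV (\<lambda>t. partial h \<phi> (x + t *\<^sub>R h))" for x
    unfolding directional_derivative[OF sm, of h]
  proof (intro continuous_on_sum continuous_on_mult continuous_on_const)
    fix b :: 'a assume "b \<in> Basis"
    then have "continuous_on UNIV (partial b \<phi>)"
      by (rule test_function_continuous[OF test_function_partial[OF \<phi>]])
    then show "continuous_on UNIV (\<lambda>t. partial b \<phi> (x + t *\<^sub>R h))"
      by (rule continuous_on_compose2) (auto intro!: continuous_intros)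
  qed
  have D [measurable]: "(\<lambda>t. partial h \<phi> (x + t *\<^sub>R h)) \<in> borel_measurable borel" for x
    by (rule borel_measurable_continuous_onI[OF pcont])
  have pt: "ennreal ((\<phi> (x + h) - \<phi> x)\<^sup>2)
      \<le> (\<integral>\<^sup>+t. indicator {0..1} t * ennreal ((norm h)\<^sup>2 * S (x + t *\<^sub>R h)) \<partial>lborel)" for x
  proof -
    have cont: "continuous_on {0..1} (\<lambda>t. partial h \<phi> (x + t *\<^sub>R h))"
      by (rule continuous_on_subset[OF pcont]) simp
    have "(LINT t|lborel. indicator {0..1} t *\<^sub>R partial h \<phi> (x + t *\<^sub>R h)) = \<phi> (x
        + 1 *\<^sub>R h) - \<phi> (x + 0 *\<^sub>R h)"
    proof (rule integral_FTC_Icc[OF _ _ cont])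
      show "((\<lambda>t. \<phi> (x + t *\<^sub>R h)) has_vector_derivative partial h \<phi> (x
          + t *\<^sub>R h)) (at t within {0..1})" for t
        using line_derivative[OF sm, of x h t]
        by (auto simp: has_real_derivative_iff_has_vector_derivative intro:
            has_vector_derivative_at_within)
    qed simp
    then have "ennreal ((\<phi> (x + h) - \<phi> x)\<^sup>2)
        = ennreal ((LINT t|lborel. indicator {0..1} t * partial h \<phi> (x + t *\<^sub>R h))\<^sup>2)" by simp
    also have "\<dots> \<le> emeasure lborel {0..1::real} *
        (\<integral>\<^sup>+t. indicator {0..1} t * ennreal ((partial h \<phi> (x + t *\<^sub>R h))\<^sup>2) \<partial>lborel)"
      by (rule square_of_set_integral_le) simp_all
    also have "\<dots> = (\<integral>\<^sup>+t. indicator {0..1} t * ennreal ((partial h \<phi> (x + t *\<^sub>R h))\<^sup>2) \<partial>lborel)"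
      by simp
    also have "\<dots> \<le> (\<integral>\<^sup>+t. indicator {0..1} t * ennreal ((norm h)\<^sup>2 * S (x + t *\<^sub>R h)) \<partial>lborel)"
      unfolding S_def
      by (intro nn_integral_mono mult_left_mono ennreal_leI directional_derivative_square_le sm)
          simp
    finally show ?thesis .
  qed
  have "(\<integral>\<^sup>+x. ennreal ((\<phi> (x + h) - \<phi> x)\<^sup>2) \<partial>lborel)
      \<le> (\<integral>\<^sup>+x. (\<integral>\<^sup>+t. indicator {0..1} t * ennreal ((norm h)\<^sup>2 * S (x + t *\<^sub>R h)) \<partial>lborel) \<partial>lborel)"
    by (intro nn_integral_mono pt)
  also have "\<dots> = (\<integral>\<^sup>+t. (\<integral>\<^sup>+x. indicator {0..1} t * ennreal ((norm h)\<^sup>2 * S (x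
      + t *\<^sub>R h)) \<partial>lborel) \<partial>lborel)"
    by (rule lborel_pair.Fubini'[symmetric]) measurable
  also have "\<dots> = (\<integral>\<^sup>+t. indicator {0..1} t * ennreal ((norm h)\<^sup>2 * grad_energy \<phi>) \<partial>(lborel::real
      measure))"
  proof (rule nn_integral_cong)
    fix t :: real
    have "(\<integral>\<^sup>+x. indicator {0..1} t * ennreal ((norm h)\<^sup>2 * S (x + t *\<^sub>R h)) \<partial>lborel)
        = indicator {0..1} t * (ennreal ((norm h)\<^sup>2) * (\<integral>\<^sup>+x. ennreal (S (x + t *\<^sub>R h)) \<partial>lborel))"
      using S0 by (simp add: nn_integral_cmult ennreal_mult)
    also have "(\<integral>\<^sup>+x. ennreal (S (x + t *\<^sub>R h)) \<partial>lborel) = (\<integral>\<^sup>+x. ennreal (S x) \<partial>lborel)"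
      by (rule nn_integral_translate[of "\<lambda>x. ennreal (S x)"]) simp
    finally show "(\<integral>\<^sup>+x. indicator {0..1} t * ennreal ((norm h)\<^sup>2 * S (x + t *\<^sub>R h)) \<partial>lborel)
        = indicator {0..1} t * ennreal ((norm h)\<^sup>2 * grad_energy \<phi>)"
      unfolding Sint using grad_energy_nonneg[of \<phi>] by (simp add: ennreal_mult)
  qed
  also have "\<dots> = ennreal ((norm h)\<^sup>2 * grad_energy \<phi>)"
    by (subst nn_integral_multc) simp_all
  finally show ?thesis .
qed

definition ball_integral :: "real \<Rightarrow> ('a::euclidean_space \<Rightarrow> real) \<Rightarrow> 'a \<Rightarrow> real"
  where "ball_integral \<epsilon> \<phi> x = (LINT y|lborel. indicator (ball 0 \<epsilon>) y * \<phi> (x + y))"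

lemma emeasure_ball_lborel: "emeasure lborel (ball (0::'a::euclidean_space) \<epsilon>)
    = ennreal (measure lborel (ball (0::'a) \<epsilon>))"
  by (rule emeasure_eq_ennreal_measure) (use emeasure_bounded_finite[of "ball (0::'a) \<epsilon>"] in auto)

lemma integrable_ball_integral:
  fixes \<phi> :: "'a::euclidean_space \<Rightarrow> real"
  assumes "\<phi> \<in> test_functions UNIV"
  shows "integrable lborel (\<lambda>y. indicator (ball 0 \<epsilon>) y * \<phi> (x + y))"
proof -
  have "integrable lborel (\<lambda>y. \<phi> (y + x))"
    by (rule test_function_integrable[OF test_function_translate[OF assms]])
  then have "integrable lborel (\<lambda>y. indicator (ball 0 \<epsilon>) y *\<^sub>R \<phi> (y + x))"
    by (intro integrable_mult_indicator) simp_all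
  then show ?thesis by (simp add: add.commute)
qed

lemma ball_integral_integrand_measurable:
  fixes \<phi> :: "'a::euclidean_space \<Rightarrow> real"
  assumes "\<phi> \<in> test_functions \<Omega>"
  shows "(\<lambda>z. \<phi> (fst z + snd z)) \<in> borel_measurable (lborel \<Otimes>\<^sub>M lborel)"
    "(\<lambda>z. indicator (ball 0 \<epsilon>) (snd z) :: 'b::{zero_neq_one,topological_space}) \<in> borel_measurable
        (lborel \<Otimes>\<^sub>M (lborel :: 'a measure))"
proof -
  have "continuous_on UNIV (\<lambda>z::'a \<times> 'a. \<phi> (fst z + snd z))"
    by (rule continuous_on_compose2[OF test_function_continuous[OF assms]])
        (auto intro!: continuous_intros)
  then show "(\<lambda>z. \<phi> (fst z + snd z)) \<in> borel_measurable (lborel \<Otimes>\<^sub>M lborel)"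
    unfolding lborel_prod measurable_lborel2 by (rule borel_measurable_continuous_onI)
  show "(\<lambda>z. indicator (ball 0 \<epsilon>) (snd z) :: 'b) \<in> borel_measurable (lborel \<Otimes>\<^sub>M (lborel :: 'a
      measure))"
    by (rule measurable_compose[OF measurable_snd borel_measurable_indicator]) simp
qed

lemma ball_integral_measurable:
  fixes \<phi> :: "'a::euclidean_space \<Rightarrow> real"
  assumes "\<phi> \<in> test_functions \<Omega>"
  shows "ball_integral \<epsilon> \<phi> \<in> borel_measurable borel"
proof -
  have "ball_integral \<epsilon> \<phi> \<in> borel_measurable lborel"
    unfolding ball_integral_def[abs_def]
  proof (rule lborel.borel_measurable_lebesgue_integral)
    show "(\<lambda>(x, y). indicator (ball 0 \<epsilon>) y * \<phi> (x + y)) \<in> borel_measurable (lborel \<Otimes>\<^sub>M lborel)"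
      unfolding case_prod_beta
      by (intro borel_measurable_times ball_integral_integrand_measurable[OF assms])
  qed
  then show ?thesis by simp
qed

lemma ball_integral_diff:
  assumes "\<phi> \<in> test_functions UNIV" "\<psi> \<in> test_functions UNIV"
  shows "ball_integral \<epsilon> (\<lambda>x. \<phi> x - \<psi> x) x = ball_integral \<epsilon> \<phi> x - ball_integral \<epsilon> \<psi> x"
  unfolding ball_integral_def
  using integrable_ball_integral[OF assms(1), of \<epsilon> x] integrable_ball_integral[OF assms(2), of \<epsilon> x]
  by (simp add: right_diff_distrib)

text \<open>Together with \<open>ball_integral_bound\<close> this gives the hypotheses of the theorem of Arzela and
  Ascoli for the integrals over balls of a fixed radius, with constants that only depend on the
  \<open>H\<^sup>1\<close> norm.\<close>

lemma ball_integral_lipschitz: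
  fixes \<phi> :: "'a::euclidean_space \<Rightarrow> real"
  assumes \<phi>: "\<phi> \<in> test_functions UNIV"
  shows "(ball_integral \<epsilon> \<phi> x - ball_integral \<epsilon> \<phi> z)\<^sup>2
    \<le> measure lborel (ball (0::'a) \<epsilon>) * ((norm (x - z))\<^sup>2 * grad_energy \<phi>)"
proof -
  let ?B = "ball (0::'a) \<epsilon>"
  have [measurable]: "\<phi> \<in> borel_measurable borel" by (rule test_function_borel[OF \<phi>])
  have "ball_integral \<epsilon> \<phi> x - ball_integral \<epsilon> \<phi> z = (LINT y|lborel. indicator ?B y * (\<phi> (x
      + y) - \<phi> (z + y)))"
    unfolding ball_integral_def
    using integrable_ball_integral[OF \<phi>, of \<epsilon> x] integrable_ball_integral[OF \<phi>, of \<epsilon> z]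
    by (simp add: right_diff_distrib)
  then have "ennreal ((ball_integral \<epsilon> \<phi> x - ball_integral \<epsilon> \<phi> z)\<^sup>2)
      \<le> emeasure lborel ?B * (\<integral>\<^sup>+y. indicator ?B y * ennreal ((\<phi> (x + y) - \<phi> (z + y))\<^sup>2) \<partial>lborel)"
    using square_of_set_integral_le[of "\<lambda>y. \<phi> (x + y) - \<phi> (z + y)" lborel ?B] by simp
  also have "\<dots> \<le> emeasure lborel ?B * (\<integral>\<^sup>+y. ennreal ((\<phi> (x + y) - \<phi> (z + y))\<^sup>2) \<partial>lborel)"
    by (intro mult_left_mono nn_integral_mono) (auto simp: indicator_def)
  also have "(\<integral>\<^sup>+y. ennreal ((\<phi> (x + y) - \<phi> (z + y))\<^sup>2) \<partial>lborel)
      = (\<integral>\<^sup>+y. ennreal ((\<phi> ((y + z) + (x - z)) - \<phi> (y + z))\<^sup>2) \<partial>lborel)"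
    by (intro nn_integral_cong) (simp add: algebra_simps)
  also have "\<dots> = (\<integral>\<^sup>+y. ennreal ((\<phi> (y + (x - z)) - \<phi> y)\<^sup>2) \<partial>lborel)"
    by (rule nn_integral_translate[of "\<lambda>y. ennreal ((\<phi> (y + (x - z)) - \<phi> y)\<^sup>2)"]) measurable
  also have "emeasure lborel ?B * \<dots> \<le> emeasure lborel ?B * ennreal ((norm (x - z))\<^sup>2 * grad_energy
      \<phi>)"
    by (intro mult_left_mono translation_estimate[OF \<phi>]) simp
  also have "\<dots> = ennreal (measure lborel ?B * ((norm (x - z))\<^sup>2 * grad_energy \<phi>))"
    using grad_energy_nonneg[of \<phi>] by (simp add: emeasure_ball_lborel ennreal_mult)
  finally show ?thesis
    using grad_energy_nonneg[of \<phi>] by (simp add: ennreal_le_iff)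
qed

lemma ball_integral_bound:
  fixes \<phi> :: "'a::euclidean_space \<Rightarrow> real"
  assumes \<phi>: "\<phi> \<in> test_functions UNIV"
  shows "(ball_integral \<epsilon> \<phi> x)\<^sup>2 \<le> measure lborel (ball (0::'a) \<epsilon>) * (LINT x|lborel. (\<phi> x)\<^sup>2)"
proof -
  let ?B = "ball (0::'a) \<epsilon>"
  have [measurable]: "\<phi> \<in> borel_measurable borel" by (rule test_function_borel[OF \<phi>])
  have "ennreal ((ball_integral \<epsilon> \<phi> x)\<^sup>2)
      \<le> emeasure lborel ?B * (\<integral>\<^sup>+y. indicator ?B y * ennreal ((\<phi> (x + y))\<^sup>2) \<partial>lborel)"
    unfolding ball_integral_def by (rule square_of_set_integral_le) simp_all
  also have "\<dots> \<le> emeasure lborel ?B * (\<integral>\<^sup>+y. ennreal ((\<phi> (y + x))\<^sup>2) \<partial>lborel)"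
    by (intro mult_left_mono nn_integral_mono) (auto simp: indicator_def add.commute)
  also have "(\<integral>\<^sup>+y. ennreal ((\<phi> (y + x))\<^sup>2) \<partial>lborel) = (\<integral>\<^sup>+y. ennreal ((\<phi> y)\<^sup>2) \<partial>lborel)"
    by (rule nn_integral_translate[of "\<lambda>y. ennreal ((\<phi> y)\<^sup>2)"]) measurable
  also have "\<dots> = ennreal (LINT x|lborel. (\<phi> x)\<^sup>2)"
    using test_function_integrable[OF test_function_mult[OF test_function_smooth[OF \<phi>] \<phi>]]
    by (intro nn_integral_eq_integral) (auto simp: power2_eq_square)
  also have "emeasure lborel ?B * \<dots> = ennreal (measure lborel ?B * (LINT x|lborel. (\<phi> x)\<^sup>2))"
    by (simp add: emeasure_ball_lborel ennreal_mult)
  finally show ?thesis by (simp add: ennreal_le_iff)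
qed

text \<open>The average over a ball of radius \<open>\<epsilon>\<close> is a mean of translates by vectors of length at most
  \<open>\<epsilon>\<close>, each of which is close to the function by \<open>translation_estimate\<close>.\<close>

lemma ball_integral_error:
  fixes \<phi> :: "'a::euclidean_space \<Rightarrow> real" and \<epsilon> :: real
  assumes \<phi>: "\<phi> \<in> test_functions UNIV"
  defines "v \<equiv> measure lborel (ball (0::'a) \<epsilon>)"
  shows "(\<integral>\<^sup>+x. ennreal ((ball_integral \<epsilon> \<phi> x - v * \<phi> x)\<^sup>2) \<partial>lborel)
    \<le> ennreal (v\<^sup>2 * (\<epsilon>\<^sup>2 * grad_energy \<phi>))"
proof -
  let ?B = "ball (0::'a) \<epsilon>"
  have [measurable]: "\<phi> \<in> borel_measurable borel" by (rule test_function_borel[OF \<phi>])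
  have pm: "(\<lambda>z. indicator ?B (snd z) * ennreal ((\<phi> (fst z
      + snd z) - \<phi> (fst z))\<^sup>2)) \<in> borel_measurable (lborel \<Otimes>\<^sub>M lborel)"
  proof -
    have [measurable]: "(\<lambda>z. \<phi> (fst z)) \<in> borel_measurable (lborel \<Otimes>\<^sub>M (lborel :: 'a measure))"
      by (rule measurable_compose[OF measurable_fst]) simp
    note [measurable] = ball_integral_integrand_measurable(1)[OF \<phi>]
    show ?thesis
    proof (rule borel_measurable_times_ennreal)
      show "(\<lambda>z. indicator ?B (snd z)) \<in> borel_measurable (lborel \<Otimes>\<^sub>M lborel)"
        by (rule ball_integral_integrand_measurable(2)[OF \<phi>])
    qed measurable
  qed
  have Bi: "integrable lborel (\<lambda>y. indicator ?B y * \<phi> x)" for x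
    using emeasure_bounded_finite[of ?B] by (intro integrable_mult_left integrable_real_indicator)
        auto
  have eq: "ball_integral \<epsilon> \<phi> x - v * \<phi> x = (LINT y|lborel. indicator ?B y * (\<phi> (x + y) - \<phi> x))"
      for x
  proof -
    have "(LINT y|lborel. indicator ?B y * (\<phi> (x + y) - \<phi> x))
        = (LINT y|lborel. indicator ?B y * \<phi> (x + y)) - (LINT y|lborel. indicator ?B y * \<phi> x)"
      using integrable_ball_integral[OF \<phi>, of \<epsilon> x] Bi[of x] by (simp add: right_diff_distrib)
    then show ?thesis by (simp add: ball_integral_def v_def)
  qed
  have "(\<integral>\<^sup>+x. ennreal ((ball_integral \<epsilon> \<phi> x - v * \<phi> x)\<^sup>2) \<partial>lborel)
      \<le> (\<integral>\<^sup>+x. emeasure lborel ?B * (\<integral>\<^sup>+y. indicator ?B y * ennreal ((\<phi> (x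
          + y) - \<phi> x)\<^sup>2) \<partial>lborel) \<partial>lborel)"
    unfolding eq by (intro nn_integral_mono square_of_set_integral_le) simp_all
  also have "\<dots> = emeasure lborel ?B * (\<integral>\<^sup>+x. (\<integral>\<^sup>+y. indicator ?B y * ennreal ((\<phi> (x
      + y) - \<phi> x)\<^sup>2) \<partial>lborel) \<partial>lborel)"
    by (rule nn_integral_cmult, rule lborel.borel_measurable_nn_integral)
        (use pm in \<open>simp add: case_prod_beta\<close>)
  also have "(\<integral>\<^sup>+x. (\<integral>\<^sup>+y. indicator ?B y * ennreal ((\<phi> (x + y) - \<phi> x)\<^sup>2) \<partial>lborel) \<partial>lborel)
      = (\<integral>\<^sup>+y. (\<integral>\<^sup>+x. indicator ?B y * ennreal ((\<phi> (x + y) - \<phi> x)\<^sup>2) \<partial>lborel) \<partial>lborel)"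
    by (rule lborel_pair.Fubini'[symmetric]) (use pm in \<open>simp add: case_prod_beta\<close>)
  also have "\<dots> \<le> (\<integral>\<^sup>+y. indicator ?B y * ennreal (\<epsilon>\<^sup>2 * grad_energy \<phi>) \<partial>lborel)"
  proof (rule nn_integral_mono)
    fix y :: 'a
    have "(\<integral>\<^sup>+x. indicator ?B y * ennreal ((\<phi> (x + y) - \<phi> x)\<^sup>2) \<partial>lborel)
        = indicator ?B y * (\<integral>\<^sup>+x. ennreal ((\<phi> (x + y) - \<phi> x)\<^sup>2) \<partial>lborel)"
      by (rule nn_integral_cmult) measurable
    also have "\<dots> \<le> indicator ?B y * ennreal (\<epsilon>\<^sup>2 * grad_energy \<phi>)"
    proof (cases "y \<in> ?B")
      case True
      then have "(norm y)\<^sup>2 \<le> \<epsilon>\<^sup>2" by (intro power_mono) auto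
      then have "(norm y)\<^sup>2 * grad_energy \<phi> \<le> \<epsilon>\<^sup>2 * grad_energy \<phi>"
        by (intro mult_right_mono grad_energy_nonneg)
      then show ?thesis
        using order_trans[OF translation_estimate[OF \<phi>, of y] ennreal_leI]
        by (intro mult_left_mono) simp_all
    qed simp
    finally show "(\<integral>\<^sup>+x. indicator ?B y * ennreal ((\<phi> (x + y) - \<phi> x)\<^sup>2) \<partial>lborel)
        \<le> indicator ?B y * ennreal (\<epsilon>\<^sup>2 * grad_energy \<phi>)" .
  qed
  also have "(\<integral>\<^sup>+y. indicator ?B y * ennreal (\<epsilon>\<^sup>2 * grad_energy \<phi>) \<partial>lborel)
      = emeasure lborel ?B * ennreal (\<epsilon>\<^sup>2 * grad_energy \<phi>)"
    by (subst nn_integral_multc) (auto intro!: borel_measurable_indicator)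
  also have "emeasure lborel ?B * \<dots> = ennreal (v\<^sup>2 * (\<epsilon>\<^sup>2 * grad_energy \<phi>))"
  proof -
    have "ennreal v * (ennreal v * ennreal w) = ennreal (v\<^sup>2 * w)" if "0 \<le> w" for w
      using that by (simp add: v_def ennreal_mult power2_eq_square mult.assoc)
    then show ?thesis
      using grad_energy_nonneg[of \<phi>] by (simp add: emeasure_ball_lborel v_def[symmetric])
  qed
  finally show ?thesis by (simp add: mult_left_mono)
qed

lemma grad_energy_diff_le:
  assumes "\<phi> \<in> test_functions UNIV" "\<psi> \<in> test_functions UNIV"
  shows "grad_energy (\<lambda>x. \<phi> x - \<psi> x) \<le> 2 * grad_energy \<phi> + 2 * grad_energy \<psi>"
  unfolding grad_energy_def sum_distrib_left sum.distrib[symmetric]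
proof (rule sum_mono)
  fix b :: 'a assume b: "b \<in> Basis"
  note sm = test_function_smooth[OF assms(1)] test_function_smooth[OF assms(2)]
  have i: "integrable lborel (\<lambda>x. (partial b f x)\<^sup>2)" if "f \<in> test_functions UNIV" for f
    unfolding power2_eq_square
    by (rule test_function_integrable[OF test_function_mult[OF test_function_smooth]])
      (rule test_function_partial[OF that b])+
  have p: "partial b (\<lambda>x. \<phi> x - \<psi> x) x = partial b \<phi> x - partial b \<psi> x" for x
    by (rule partial_eq[OF has_derivative_diff[OF C_k_has_derivative[OF sm(1)]
        C_k_has_derivative[OF sm(2)]]])
  have "(LINT x|lborel. (partial b (\<lambda>x. \<phi> x - \<psi> x) x)\<^sup>2)
      \<le> (LINT x|lborel. 2 * (partial b \<phi> x)\<^sup>2 + 2 * (partial b \<psi> x)\<^sup>2)"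
  proof (rule integral_mono)
    show "integrable lborel (\<lambda>x. (partial b (\<lambda>x. \<phi> x - \<psi> x) x)\<^sup>2)"
      by (rule i[OF test_function_diff[OF assms]])
    show "integrable lborel (\<lambda>x. 2 * (partial b \<phi> x)\<^sup>2 + 2 * (partial b \<psi> x)\<^sup>2)"
      using i[OF assms(1)] i[OF assms(2)] by simp
    show "(partial b (\<lambda>x. \<phi> x - \<psi> x) x)\<^sup>2 \<le> 2 * (partial b \<phi> x)\<^sup>2 + 2 * (partial b \<psi> x)\<^sup>2" for x
      using zero_le_power2[of "partial b \<phi> x + partial b \<psi> x"]
      unfolding p power2_sum power2_diff by linarith
  qed
  also have "\<dots> = 2 * (LINT x|lborel. (partial b \<phi> x)\<^sup>2) + 2 * (LINT x|lborel. (partial b \<psi> x)\<^sup>2)"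
    using i[OF assms(1)] i[OF assms(2)] by simp
  finally show "(LINT x|lborel. (partial b (\<lambda>x. \<phi> x - \<psi> x) x)\<^sup>2)
      \<le> 2 * (LINT x|lborel. (partial b \<phi> x)\<^sup>2) + 2 * (LINT x|lborel. (partial b \<psi> x)\<^sup>2)" .
qed

context bounded_open
begin

text \<open>Up to an error of order \<open>\<epsilon>\<close> the \<open>L\<^sup>2\<close> norm is controlled by the supremum of the integrals
  over balls of radius \<open>\<epsilon>\<close>.\<close>

lemma averaging_inequality:
  assumes \<psi>: "\<psi> \<in> test_functions \<Omega>"
    and small: "\<And>x. x \<in> \<Omega> \<Longrightarrow> \<bar>ball_integral \<epsilon> \<psi> x\<bar> \<le> \<delta>"
  defines "v \<equiv> measure lborel (ball (0::'a) \<epsilon>)"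
  shows "v\<^sup>2 * sqnorm M \<psi>
    \<le> 2 * (v\<^sup>2 * (\<epsilon>\<^sup>2 * grad_energy \<psi>)) + 2 * (\<delta>\<^sup>2 * measure lborel \<Omega>)"
proof -
  have \<psi>U: "\<psi> \<in> test_functions UNIV" by (rule test_functions_UNIV[OF \<psi>])
  have [measurable]: "\<psi> \<in> borel_measurable borel" by (rule test_function_borel[OF \<psi>])
  have [measurable]: "ball_integral \<epsilon> \<psi> \<in> borel_measurable borel"
    by (rule ball_integral_measurable[OF \<psi>])
  have [measurable]: "\<Omega> \<in> sets borel" using open_\<Omega> by simp
  have e\<Omega>: "emeasure lborel \<Omega> = ennreal (measure lborel \<Omega>)"
    by (rule emeasure_eq_ennreal_measure) (use emeasure_bounded_finite[OF bounded_\<Omega>] in auto)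
  have i: "integrable lborel (\<lambda>x. \<psi> x * \<psi> x)"
    by (rule test_function_integrable[OF test_function_mult[OF test_function_smooth[OF \<psi>] \<psi>]])
  have "ennreal (v\<^sup>2 * sqnorm M \<psi>) = ennreal (LINT x|lborel. (v * \<psi> x)\<^sup>2)"
    unfolding test_inner_L2[OF \<psi> \<psi>] by (simp add: power2_eq_square mult_ac)
  also have "\<dots> = (\<integral>\<^sup>+x. ennreal ((v * \<psi> x)\<^sup>2) \<partial>lborel)"
  proof (rule nn_integral_eq_integral[symmetric])
    have "(\<lambda>x. (v * \<psi> x)\<^sup>2) = (\<lambda>x. v\<^sup>2 * (\<psi> x * \<psi> x))" by (simp add: power2_eq_square mult_ac)
    with i show "integrable lborel (\<lambda>x. (v * \<psi> x)\<^sup>2)" by simp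
  qed simp
  also have "\<dots> \<le> (\<integral>\<^sup>+x. 2 * ennreal ((ball_integral \<epsilon> \<psi> x - v * \<psi> x)\<^sup>2)
      + ennreal (2 * \<delta>\<^sup>2) * indicator \<Omega> x \<partial>lborel)"
  proof (rule nn_integral_mono)
    fix x
    show "ennreal ((v * \<psi> x)\<^sup>2) \<le> 2 * ennreal ((ball_integral \<epsilon> \<psi> x - v * \<psi> x)\<^sup>2)
      + ennreal (2 * \<delta>\<^sup>2) * indicator \<Omega> x"
    proof (cases "x \<in> \<Omega>")
      case True
      have "(ball_integral \<epsilon> \<psi> x)\<^sup>2 \<le> \<delta>\<^sup>2"
        using power_mono[OF small[OF True] abs_ge_zero, of 2] by simp
      moreover have "(v * \<psi> x)\<^sup>2 \<le> 2 * (ball_integral \<epsilon> \<psi> x - v * \<psi> x)\<^sup>2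
          + 2 * (ball_integral \<epsilon> \<psi> x)\<^sup>2"
      proof -
        have "0 \<le> (2 * ball_integral \<epsilon> \<psi> x - v * \<psi> x)\<^sup>2" by simp
        then show ?thesis by (simp add: power2_eq_square algebra_simps)
      qed
      ultimately have "(v * \<psi> x)\<^sup>2 \<le> 2 * (ball_integral \<epsilon> \<psi> x - v * \<psi> x)\<^sup>2 + 2 * \<delta>\<^sup>2" by linarith
      then have "ennreal ((v * \<psi> x)\<^sup>2) \<le> ennreal (2 * (ball_integral \<epsilon> \<psi> x - v * \<psi> x)\<^sup>2 + 2 * \<delta>\<^sup>2)"
        by (rule ennreal_leI)
      also have "\<dots> = 2 * ennreal ((ball_integral \<epsilon> \<psi> x - v * \<psi> x)\<^sup>2) + ennreal (2 * \<delta>\<^sup>2)"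
        by (simp add: ennreal_mult)
      finally show ?thesis using True by simp
    qed (simp add: test_function_0_off[OF \<psi>])
  qed
  also have "\<dots> = 2 * (\<integral>\<^sup>+x. ennreal ((ball_integral \<epsilon> \<psi> x - v * \<psi> x)\<^sup>2) \<partial>lborel)
      + ennreal (2 * \<delta>\<^sup>2) * emeasure lborel \<Omega>"
    by (subst nn_integral_add) (simp_all add: nn_integral_cmult)
  also have "\<dots> \<le> 2 * ennreal (v\<^sup>2 * (\<epsilon>\<^sup>2 * grad_energy \<psi>)) + ennreal (2 * \<delta>\<^sup>2) * emeasure lborel \<Omega>"
    unfolding v_def by (intro add_right_mono mult_left_mono ball_integral_error[OF \<psi>U]) simp
  also have "\<dots> = ennreal (2 * (v\<^sup>2 * (\<epsilon>\<^sup>2 * grad_energy \<psi>)) + 2 * (\<delta>\<^sup>2 * measure lborel \<Omega>))"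
    using grad_energy_nonneg[of \<psi>] by (simp add: e\<Omega> ennreal_mult mult.assoc)
  finally show ?thesis
    using grad_energy_nonneg[of \<psi>] by (subst (asm) ennreal_le_iff) (auto intro!: add_nonneg_nonneg)
qed

text \<open>First \<open>\<epsilon>\<close> is chosen such that averaging over balls of radius \<open>\<epsilon>\<close> changes all functions
  little. For this \<open>\<epsilon>\<close> the averages have a uniformly convergent subsequence.\<close>

lemma small_oscillation_subsequence:
  assumes \<phi>: "\<And>n::nat. \<phi> n \<in> test_functions \<Omega>"
    and K: "\<And>n. sqnorm M (\<phi> n) \<le> K" "\<And>n. grad_energy (\<phi> n) \<le> K" and e: "e > 0"
  shows "\<exists>r::nat \<Rightarrow> nat. strict_mono r \<and>
    (\<exists>N. \<forall>i\<ge>N. \<forall>j\<ge>N. sqnorm M (\<phi> (r i) - \<phi> (r j)) < e)"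
proof -
  have K0: "K \<ge> 0" using K(2)[of 0] grad_energy_nonneg[of "\<phi> 0"] by linarith
  have \<phi>U: "\<phi> n \<in> test_functions UNIV" for n by (rule test_functions_UNIV[OF \<phi>])
  \<comment> \<open>The constants 16 and 8 leave \<open>e / 2\<close> for the averaging error and \<open>e / 4\<close> for the averages.\<close>
  define \<epsilon> where "\<epsilon> = sqrt (e / (16 * (K + 1)))"
  have \<epsilon>: "\<epsilon> > 0" "\<epsilon>\<^sup>2 = e / (16 * (K + 1))" using e K0 by (simp_all add: \<epsilon>_def)
  define v where "v = measure lborel (ball (0::'a) \<epsilon>)"
  have v: "v > 0" unfolding v_def using \<epsilon>(1) content_ball_pos[of \<epsilon> "0::'a"] by simp
  define m where "m = measure lborel \<Omega>"
  have m: "m \<ge> 0" by (simp add: m_def)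
  define \<delta> where "\<delta> = sqrt (v\<^sup>2 * e / (8 * (m + 1)))"
  have \<delta>: "\<delta> > 0" "\<delta>\<^sup>2 = v\<^sup>2 * e / (8 * (m + 1))" using v e m by (simp_all add: \<delta>_def)
  have lip: "(ball_integral \<epsilon> (\<phi> n) x - ball_integral \<epsilon> (\<phi> n) z)\<^sup>2 \<le> v * ((norm (x - z))\<^sup>2 * K)"
      for n x z
  proof -
    have "v * ((norm (x - z))\<^sup>2 * grad_energy (\<phi> n)) \<le> v * ((norm (x - z))\<^sup>2 * K)"
      using K(2) v by (intro mult_left_mono) auto
    then show ?thesis using ball_integral_lipschitz[OF \<phi>U[of n], of \<epsilon> x z] unfolding v_def
        by linarith
  qed
  obtain g and r :: "nat \<Rightarrow> nat" where r: "strict_mono r" and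
    unif: "\<And>e. 0 < e \<Longrightarrow> \<exists>N. \<forall>n x. n \<ge> N \<and> x \<in> closure \<Omega> \<longrightarrow> norm (ball_integral \<epsilon> (\<phi> (r n)) x - g x)
        < e"
  proof (rule Arzela_Ascoli[of "closure \<Omega>" "\<lambda>n. ball_integral \<epsilon> (\<phi> n)" "sqrt (v * K)"])
    show "compact (closure \<Omega>)" using bounded_\<Omega> by (simp add: compact_closure)
    show "norm (ball_integral \<epsilon> (\<phi> n) x) \<le> sqrt (v * K)" for n x
    proof -
      have "(LINT x|lborel. (\<phi> n x)\<^sup>2) \<le> K"
        using K(1)[of n] test_inner_L2[OF \<phi> \<phi>, of n n] by (simp add: power2_eq_square)
      then have "v * (LINT x|lborel. (\<phi> n x)\<^sup>2) \<le> v * K" using v by (intro mult_left_mono) auto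
      then have "(ball_integral \<epsilon> (\<phi> n) x)\<^sup>2 \<le> v * K"
        using ball_integral_bound[OF \<phi>U[of n], of \<epsilon> x] unfolding v_def by linarith
      then show ?thesis by (simp add: real_le_rsqrt)
    qed
    fix x and c :: real assume c: "0 < c"
    define d where "d = c / sqrt (v * (K + 1))"
    have d: "d > 0" using c v K0 by (simp add: d_def)
    have "norm (ball_integral \<epsilon> (\<phi> n) x - ball_integral \<epsilon> (\<phi> n) y) < c" if "norm (x - y) < d"
        for n y
    proof -
      have "(norm (x - y))\<^sup>2 < d\<^sup>2" using that d by (intro power_strict_mono) auto
      also have "d\<^sup>2 = c\<^sup>2 / (v * (K + 1))" using v K0 by (simp add: d_def power_divide)
      finally have "(norm (x - y))\<^sup>2 * (v * (K + 1)) < c\<^sup>2"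
        using v K0 by (simp add: pos_less_divide_eq)
      moreover have "v * ((norm (x - y))\<^sup>2 * K) \<le> (norm (x - y))\<^sup>2 * (v * (K + 1))"
        using v by (simp add: algebra_simps)
      ultimately have "(ball_integral \<epsilon> (\<phi> n) x - ball_integral \<epsilon> (\<phi> n) y)\<^sup>2 < c\<^sup>2"
        using lip[of n x y] by linarith
      then show ?thesis using c by (metis abs_le_square_iff abs_of_pos not_less real_norm_def)
    qed
    with d show "\<exists>d>0. \<forall>n y. y \<in> closure \<Omega> \<and> norm (x - y) < d \<longrightarrow>
        norm (ball_integral \<epsilon> (\<phi> n) x - ball_integral \<epsilon> (\<phi> n) y) < c" by blast
  qed blast
  have "0 < \<delta> / 2" using \<delta> by simp
  from unif[OF this] obtain N where
    N: "\<And>n x. n \<ge> N \<Longrightarrow> x \<in> closure \<Omega> \<Longrightarrow> \<bar>ball_integral \<epsilon> (\<phi> (r n)) x - g x\<bar> < \<delta> / 2" by auto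
  have "sqnorm M (\<phi> (r i) - \<phi> (r j)) < e" if ij: "i \<ge> N" "j \<ge> N" for i j
  proof -
    define \<psi> where "\<psi> x = \<phi> (r i) x - \<phi> (r j) x" for x
    have \<psi>: "\<psi> \<in> test_functions \<Omega>" unfolding \<psi>_def by (rule test_function_diff[OF \<phi> \<phi>])
    have "\<bar>ball_integral \<epsilon> \<psi> x\<bar> \<le> \<delta>" if "x \<in> \<Omega>" for x
    proof -
      have "x \<in> closure \<Omega>" using that closure_subset by blast
      from N[OF ij(1) this] N[OF ij(2) this]
      have "\<bar>ball_integral \<epsilon> (\<phi> (r i)) x - ball_integral \<epsilon> (\<phi> (r j)) x\<bar> \<le> \<delta>" by linarith
      then show ?thesis unfolding \<psi>_def by (simp add: ball_integral_diff \<phi>U)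
    qed
    from averaging_inequality[OF \<psi> this]
    have "v\<^sup>2 * sqnorm M \<psi> \<le> 2 * (v\<^sup>2 * (\<epsilon>\<^sup>2 * grad_energy \<psi>)) + 2 * (\<delta>\<^sup>2 * m)"
      by (simp add: v_def m_def)
    also have "\<dots> \<le> v\<^sup>2 * (e / 2) + v\<^sup>2 * (e / 4)"
    proof (rule add_mono)
      have "grad_energy \<psi> \<le> 4 * K"
        using grad_energy_diff_le[OF \<phi>U \<phi>U, of "r i" "r j"] K(2)[of "r i"] K(2)[of "r j"]
        unfolding \<psi>_def by linarith
      then have "\<epsilon>\<^sup>2 * grad_energy \<psi> \<le> \<epsilon>\<^sup>2 * (4 * (K + 1))" by (intro mult_left_mono) auto
      also have "\<dots> = e / 4" using K0 by (simp add: \<epsilon>(2) field_simps)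
      finally have "v\<^sup>2 * (\<epsilon>\<^sup>2 * grad_energy \<psi>) \<le> v\<^sup>2 * (e / 4)" by (intro mult_left_mono) auto
      then show "2 * (v\<^sup>2 * (\<epsilon>\<^sup>2 * grad_energy \<psi>)) \<le> v\<^sup>2 * (e / 2)" by simp
      have "\<delta>\<^sup>2 * m \<le> \<delta>\<^sup>2 * (m + 1)" by (intro mult_left_mono) auto
      also have "\<dots> = v\<^sup>2 * e / 8" using m by (simp add: \<delta>(2) field_simps)
      finally show "2 * (\<delta>\<^sup>2 * m) \<le> v\<^sup>2 * (e / 4)" by simp
    qed
    also have "\<dots> = v\<^sup>2 * (3 / 4 * e)" by (simp add: field_simps)
    finally have "sqnorm M \<psi> \<le> 3 / 4 * e" using v by simp
    moreover have "\<psi> = \<phi> (r i) - \<phi> (r j)" by (auto simp: \<psi>_def)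
    ultimately show ?thesis using e by simp
  qed
  with r show ?thesis by blast
qed

text \<open>Subsequences with oscillation below \<open>1 / (k + 1)\<close> are extracted for all \<open>k\<close> in turn; their
  diagonal sequence is Cauchy.\<close>

theorem rellich:
  assumes \<phi>: "\<And>n::nat. \<phi> n \<in> test_functions \<Omega>"
    and K: "\<And>n. sqnorm M (\<phi> n) \<le> K" "\<And>n. grad_energy (\<phi> n) \<le> K"
  shows "\<exists>r::nat \<Rightarrow> nat. strict_mono r \<and>
    (\<forall>e>0. \<exists>N. \<forall>i\<ge>N. \<forall>j\<ge>N. sqnorm M (\<phi> (r i) - \<phi> (r j)) < e)"
proof -
  define P where "P k s \<longleftrightarrow> (\<exists>N. \<forall>i\<ge>N. \<forall>j\<ge>N.
    sqnorm M (\<phi> (s i) - \<phi> (s j)) < 1 / real (Suc k))" for k :: nat and s :: "nat \<Rightarrow> nat"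
  interpret subseqs P
  proof
    fix k :: nat and s :: "nat \<Rightarrow> nat"
    show "\<exists>r. strict_mono r \<and> P k (s \<circ> r)"
      using small_oscillation_subsequence[of "\<lambda>n. \<phi> (s n)" K "1 / real (Suc k)"] \<phi> K
      by (simp add: P_def)
  qed
  have stable: "P k (s \<circ> r)" if r: "strict_mono r" and s: "P k s" for r s k
  proof -
    obtain N where N: "\<forall>i\<ge>N. \<forall>j\<ge>N. sqnorm M (\<phi> (s i) - \<phi> (s j)) < 1 / real (Suc k)"
      using s unfolding P_def by blast
    have "r i \<ge> N" if "i \<ge> N" for i using seq_suble[OF r, of i] that by linarith
    with N show ?thesis unfolding P_def comp_def by blast
  qed
  have "\<exists>N. \<forall>i\<ge>N. \<forall>j\<ge>N.
      sqnorm M (\<phi> (diagseq i) - \<phi> (diagseq j)) < e" if "e > 0" for e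
  proof -
    obtain k where k: "inverse (real (Suc k)) < e" using reals_Archimedean[OF \<open>e > 0\<close>] by blast
    have "P k (diagseq \<circ> ((+) (Suc k)))" by (rule diagseq_holds) (rule stable)
    then obtain N where N: "\<And>i j. \<lbrakk>i \<ge> N; j \<ge> N\<rbrakk> \<Longrightarrow>
        sqnorm M (\<phi> (diagseq (Suc k + i)) - \<phi> (diagseq (Suc k + j))) < 1 / real (Suc k)"
      unfolding P_def comp_def by blast
    show ?thesis
    proof (intro exI[of _ "Suc k + N"] allI impI)
      fix i j assume "Suc k + N \<le> i" "Suc k + N \<le> j"
      then have "sqnorm M (\<phi> (diagseq i) - \<phi> (diagseq j)) < 1 / real (Suc k)"
        using N[of "i - Suc k" "j - Suc k"] by simp
      also have "\<dots> < e" using k by (simp add: inverse_eq_divide)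
      finally show "sqnorm M (\<phi> (diagseq i) - \<phi> (diagseq j)) < e" .
    qed
  qed
  with subseq_diagseq show ?thesis by blast
qed

end

section \<open>Uniqueness of the eigenvalue sequence\<close>

text \<open>If there were more vectors in one basis than in the other, the coefficients of the larger
  one with respect to the smaller one would satisfy a linear relation.\<close>

lemma has_ae_dim_unique:
  assumes "has_ae_dim \<Omega> V m" "has_ae_dim \<Omega> V n"
  shows "m = n"
proof -
  have False if mn: "m < n" and m: "has_ae_dim \<Omega> V m" and n: "has_ae_dim \<Omega> V n" for m n
  proof -
    obtain w where w: "\<forall>v\<in>V. \<exists>c. AE x in lebesgue_on \<Omega>. v x = (\<Sum>i<m. c i * w i x)"
      using m unfolding has_ae_dim_def by blast
    obtain z where z: "\<forall>i<n. z i \<in> V"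
      "\<forall>c. (AE x in lebesgue_on \<Omega>. (\<Sum>i<n. c i * z i x) = 0) \<longrightarrow> (\<forall>i<n. c i = 0)"
      using n unfolding has_ae_dim_def by blast
    have "\<forall>j. \<exists>c. j < n \<longrightarrow> (AE x in lebesgue_on \<Omega>. z j x = (\<Sum>i<m. c i * w i x))"
      using w z(1) by blast
    then obtain C where C: "\<And>j. j < n \<Longrightarrow> AE x in lebesgue_on \<Omega>. z j x = (\<Sum>i<m. C j i * w i x)"
      by metis
    obtain c where c: "\<exists>j<n. c j \<noteq> 0" "\<And>i. i < m \<Longrightarrow> (\<Sum>j<n. C j i * c j) = 0"
      using homogeneous_system_nontrivial_solution[OF mn, of "\<lambda>i j. C j i"] by blast
    have "AE x in lebesgue_on \<Omega>. \<forall>j\<in>{..<n}. z j x = (\<Sum>i<m. C j i * w i x)"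
      using C by (intro eventually_ball_finite) auto
    then have "AE x in lebesgue_on \<Omega>. (\<Sum>j<n. c j * z j x) = 0"
    proof eventually_elim
      case (elim x)
      have "(\<Sum>j<n. c j * z j x) = (\<Sum>j<n. \<Sum>i<m. C j i * c j * w i x)"
        using elim by (intro sum.cong) (auto simp: sum_distrib_left mult_ac)
      also have "\<dots> = (\<Sum>i<m. (\<Sum>j<n. C j i * c j) * w i x)"
        by (subst sum.swap) (simp add: sum_distrib_right)
      also have "\<dots> = 0" using c(2) by simp
      finally show ?case .
    qed
    then show False using z(2) c(1) by blast
  qed
  from this[of m n] this[of n m] assms show ?thesis by (meson linorder_neqE_nat)
qed

text \<open>At the first difference, say \<open>s n < t n\<close>, the value \<open>s n\<close> is attained by \<open>t\<close> only before
  \<open>n\<close>, and hence less often than by \<open>s\<close>.\<close>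

lemma mono_sequence_eq_if_multiplicities_eq:
  fixes s t :: "nat \<Rightarrow> real"
  assumes s: "mono s" "\<And>\<mu>. finite {j. s j = \<mu>}" and t: "mono t" "\<And>\<mu>. finite {j. t j = \<mu>}"
    and card: "\<And>\<mu>. card {j. s j = \<mu>} = card {j. t j = \<mu>}"
  shows "s = t"
proof
  fix n
  show "s n = t n"
  proof (induction n rule: less_induct)
    case (less n)
    have False if s: "mono s" "\<And>\<mu>. finite {j. s j = \<mu>}" and t: "mono t"
      and card: "\<And>\<mu>. card {j. s j = \<mu>} = card {j. t j = \<mu>}"
      and IH: "\<And>j. j < n \<Longrightarrow> s j = t j" and lt: "s n < t n" for s t :: "nat \<Rightarrow> real"
    proof -
      have "{j. t j = s n} \<subset> {j. s j = s n}"
      proof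
        show "{j. t j = s n} \<subseteq> {j. s j = s n}"
        proof
          fix j assume j: "j \<in> {j. t j = s n}"
          have "j < n"
          proof (rule ccontr)
            assume "\<not> j < n"
            then have "t n \<le> t j" using t by (simp add: monoD)
            with j lt show False by simp
          qed
          with IH j show "j \<in> {j. s j = s n}" by simp
        qed
        have "n \<in> {j. s j = s n}" "n \<notin> {j. t j = s n}" using lt by auto
        then show "{j. t j = s n} \<noteq> {j. s j = s n}" by blast
      qed
      from psubset_card_mono[OF s(2) this] show False using card[of "s n"] by simp
    qed
    from this[of s t] this[of t s] s t card less show ?case by (metis linorder_less_linear)
  qed
qed

lemma clamped_eigenvalue_sequence_unique:
  assumes "clamped_eigenvalue_sequence \<Omega> \<alpha> s" "clamped_eigenvalue_sequence \<Omega> \<alpha> t"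
  shows "s = t"
proof (rule mono_sequence_eq_if_multiplicities_eq)
  show "card {j. s j = \<mu>} = card {j. t j = \<mu>}" for \<mu>
    using assms has_ae_dim_unique unfolding clamped_eigenvalue_sequence_def by blast
qed (use assms in \<open>auto simp: clamped_eigenvalue_sequence_def\<close>)

lemma clamped_eigenvalue_eq:
  assumes "clamped_eigenvalue_sequence \<Omega> \<alpha> s"
  shows "clamped_eigenvalue \<Omega> \<alpha> k = s (k - 1)"
  unfolding clamped_eigenvalue_def
  using the_equality[of "clamped_eigenvalue_sequence \<Omega> \<alpha>" s] assms
      clamped_eigenvalue_sequence_unique
  by metis

section \<open>The clamped plate forms\<close>

context bounded_open
begin

lemma AE_linear_semidefinite_form:
  assumes T: "\<And>u. u \<in> H20 \<Omega> \<Longrightarrow> T u \<in> SI"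
    and lin: "\<And>u v c d. \<lbrakk>u \<in> H20 \<Omega>; v \<in> H20 \<Omega>\<rbrakk> \<Longrightarrow>
      AE x in M. T (c *\<^sub>R u + d *\<^sub>R v) x = c * T u x + d * T v x"
  shows "semidefinite_form (H20 \<Omega>) (\<lambda>u v. inner_L2 M (T u) (T v))"
proof
  have *: "inner_L2 M (T (c *\<^sub>R u + d *\<^sub>R v)) (T w) = c * inner_L2 M (T u) (T w)
      + d * inner_L2 M (T v) (T w)"
    if "u \<in> H20 \<Omega>" "v \<in> H20 \<Omega>" "w \<in> H20 \<Omega>" for u v w c d
  proof -
    have cl: "c *\<^sub>R T u + d *\<^sub>R T v \<in> SI" using T that by (intro L2.closed)
    have "inner_L2 M (T (c *\<^sub>R u + d *\<^sub>R v)) (T w) = inner_L2 M (c *\<^sub>R T u + d *\<^sub>R T v) (T w)"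
      using lin[OF that(1,2), of c d] cl T[OF that(3)] T[OF H20_lincomb(1)[OF that(1,2), of c d]]
      by (intro inner_L2_AE_cong square_integrable_measurable) simp_all
    also have "\<dots> = c * inner_L2 M (T u) (T w) + d * inner_L2 M (T v) (T w)"
      using T that by (simp add: L2.bilin)
    finally show ?thesis .
  qed
  fix u v w c
  assume u: "u \<in> H20 \<Omega>"
  { assume v: "v \<in> H20 \<Omega>"
    show "inner_L2 M (T u) (T v) = inner_L2 M (T v) (T u)" using T u v by (intro L2.sym)
    assume w: "w \<in> H20 \<Omega>"
    show "inner_L2 M (T (u + v)) (T w) = inner_L2 M (T u) (T w) + inner_L2 M (T v) (T w)"
      using *[OF u v w, of 1 1] by simp }
  { assume w: "w \<in> H20 \<Omega>"
    show "inner_L2 M (T (c *\<^sub>R u)) (T w) = c * inner_L2 M (T u) (T w)"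
      using *[OF u u w, of c 0] by simp }
  show "0 \<le> sqnorm M (T u)" using T[OF u] by (rule L2.nonneg)
qed (rule subspace_H20)

lemma weak_laplacian_jet: "weak_laplacian \<Omega> u = (\<Sum>b\<in>Basis. weak_jet u (b, b))"
  by (rule ext) (simp add: weak_laplacian_def sum_fun_apply)

lemma weak_laplacian_SI: "u \<in> H20 \<Omega> \<Longrightarrow> weak_laplacian \<Omega> u \<in> SI"
  unfolding weak_laplacian_jet by (intro L2.sum_closed weak_jet_SI jet_index_mem)

text \<open>Completing the square: \<open>\<Delta> + \<alpha>/2\<close> is the square root of the plate operator \<open>\<Delta>\<^sup>2 + \<alpha> \<Delta>\<close>
  shifted by \<open>\<alpha>\<^sup>2/4\<close>. The further shift by one in \<open>plate_form\<close> makes this form dominate the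
  \<open>L\<^sup>2\<close> norm.\<close>

definition plate_op :: "real \<Rightarrow> ('a \<Rightarrow> real) \<Rightarrow> 'a \<Rightarrow> real"
  where "plate_op \<alpha> u = weak_laplacian \<Omega> u + (\<alpha> / 2) *\<^sub>R u"

definition plate_form :: "real \<Rightarrow> ('a \<Rightarrow> real) \<Rightarrow> ('a \<Rightarrow> real) \<Rightarrow> real"
  where "plate_form \<alpha> u v = inner_L2 M (plate_op \<alpha> u) (plate_op \<alpha> v) + inner_L2 M u v"

lemma H20_SI: "u \<in> H20 \<Omega> \<Longrightarrow> u \<in> SI"
  using weak_jet_SI[of u "(0, 0)"] by simp

lemma plate_op_SI: "u \<in> H20 \<Omega> \<Longrightarrow> plate_op \<alpha> u \<in> SI"
  unfolding plate_op_def by (intro L2.closed weak_laplacian_SI H20_SI)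

lemma plate_op_linear:
  assumes "u \<in> H20 \<Omega>" "v \<in> H20 \<Omega>"
  shows "AE x in M. plate_op \<alpha> (c *\<^sub>R u + d *\<^sub>R v) x = c * plate_op \<alpha> u x + d * plate_op \<alpha> v x"
proof -
  have "AE x in M. \<forall>b\<in>Basis. weak_jet (c *\<^sub>R u + d *\<^sub>R v) (b, b) x
      = c * weak_jet u (b, b) x + d * weak_jet v (b, b) x"
    by (intro eventually_ball_finite ballI H20_lincomb(2)[OF assms] jet_index_mem finite_Basis)
  then show ?thesis
  proof eventually_elim
    case (elim x)
    then have "weak_laplacian \<Omega> (c *\<^sub>R u + d *\<^sub>R v) x = (\<Sum>b\<in>Basis. c * weak_jet u (b, b) x
        + d * weak_jet v (b, b) x)"
      unfolding weak_laplacian_jet sum_fun_apply by (intro sum.cong) auto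
    also have "\<dots> = c * weak_laplacian \<Omega> u x + d * weak_laplacian \<Omega> v x"
      unfolding weak_laplacian_jet sum_fun_apply by (simp add: sum.distrib sum_distrib_left)
    finally show ?case by (simp add: plate_op_def algebra_simps)
  qed
qed

lemma semidefinite_plate_op: "semidefinite_form (H20 \<Omega>) (\<lambda>u v. inner_L2 M (plate_op \<alpha> u) (plate_op
    \<alpha> v))"
  by (rule AE_linear_semidefinite_form[OF plate_op_SI plate_op_linear])

lemma semidefinite_L2: "semidefinite_form (H20 \<Omega>) (inner_L2 M)"
  using AE_linear_semidefinite_form[of "\<lambda>u. u"] H20_SI by simp

lemma semidefinite_plate_form: "semidefinite_form (H20 \<Omega>) (plate_form \<alpha>)"
proof -
  interpret T: semidefinite_form "H20 \<Omega>" "\<lambda>u v. inner_L2 M (plate_op \<alpha> u) (plate_op \<alpha> v)"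
    by (rule semidefinite_plate_op)
  interpret B: semidefinite_form "H20 \<Omega>" "inner_L2 M" by (rule semidefinite_L2)
  show ?thesis
    unfolding plate_form_def
    by standard (auto simp: subspace_H20 T.add_left B.add_left T.scale_left B.scale_left
        distrib_left
        intro: T.sym B.sym T.nonneg B.nonneg add_nonneg_nonneg arg_cong2[where f = "(+)"])
qed

lemma H20_inner_laplacian:
  assumes "u \<in> H20 \<Omega>" "v \<in> H20 \<Omega>"
  shows "inner_L2 M u (weak_laplacian \<Omega> v)
    = - (\<Sum>b\<in>Basis. inner_L2 M (weak_jet u (b, 0)) (weak_jet v (b, 0)))"
proof -
  have "inner_L2 M u (weak_laplacian \<Omega> v) = (\<Sum>b\<in>Basis. inner_L2 M u (weak_jet v (b, b)))"
    unfolding weak_laplacian_jet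
    using L2.sum_right[of Basis "\<lambda>b. weak_jet v (b, b)" M u "\<lambda>_. 1"] assms H20_SI
    by (simp del: weak_jet_simps)
  also have "\<dots> = (\<Sum>b\<in>Basis. - inner_L2 M (weak_jet u (b, 0)) (weak_jet v (b, 0)))"
    using H20_green[OF assms] by (intro sum.cong) (auto simp del: weak_jet_simps)
  finally show ?thesis by (simp add: sum_negf)
qed

lemma plate_form_eq:
  assumes u: "u \<in> H20 \<Omega>" and v: "v \<in> H20 \<Omega>"
  shows "plate_form \<alpha> u v = (LINT x|M. weak_laplacian \<Omega> u x * weak_laplacian \<Omega> v x
        - \<alpha> * (weak_gradient \<Omega> u x \<bullet> weak_gradient \<Omega> v x)) + (\<alpha>\<^sup>2 / 4 + 1) * inner_L2 M u v"
proof -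
  let ?G = "\<Sum>b\<in>Basis. inner_L2 M (weak_jet u (b, 0)) (weak_jet v (b, 0))"
  have g: "weak_gradient \<Omega> u x \<bullet> weak_gradient \<Omega> v x
      = (\<Sum>b\<in>Basis. weak_jet u (b, 0) x * weak_jet v (b, 0) x)" for x
    unfolding weak_gradient_def by (subst euclidean_inner) (auto simp: inner_sum_left_Basis)
  have i: "integrable M (\<lambda>x. weak_jet u (b, 0) x * weak_jet v (b, 0) x)" if "b \<in> Basis" for b
    by (rule integrable_product) (use u v that in \<open>auto simp del: weak_jet_simps\<close>)
  have "(LINT x|M. weak_laplacian \<Omega> u x * weak_laplacian \<Omega> v x
        - \<alpha> * (weak_gradient \<Omega> u x \<bullet> weak_gradient \<Omega> v x))
      = inner_L2 M (weak_laplacian \<Omega> u) (weak_laplacian \<Omega> v) - \<alpha> * ?G"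
    unfolding g inner_L2_def
    using integrable_product[OF weak_laplacian_SI[OF u] weak_laplacian_SI[OF v]] i
    by (simp add: Bochner_Integration.integral_diff Bochner_Integration.integral_sum
        Bochner_Integration.integrable_sum del: weak_jet_simps)
  moreover have "inner_L2 M (weak_laplacian \<Omega> u) v = - ?G"
    using H20_inner_laplacian[OF v u] by (simp add: inner_L2_def mult.commute del: weak_jet_simps)
  moreover note H20_inner_laplacian[OF u v]
  ultimately show ?thesis
    unfolding plate_form_def plate_op_def
    using weak_laplacian_SI[OF u] weak_laplacian_SI[OF v] H20_SI[OF u] H20_SI[OF v]
    by (simp add: L2.bilin power2_eq_square field_simps del: weak_jet_simps)
qed

text \<open>The gradient and the Hessian are expressed by \<open>H20_inner_laplacian\<close> and \<open>H20_hessian\<close>.\<close>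

lemma jet_norm2_eq:
  assumes u: "u \<in> H20 \<Omega>"
  shows "jet_norm2 (weak_jet u) = sqnorm M u - inner_L2 M u (weak_laplacian \<Omega> u)
    + sqnorm M (weak_laplacian \<Omega> u)"
proof -
  have "sqnorm M (weak_laplacian \<Omega> u)
      = (\<Sum>b\<in>Basis. inner_L2 M (weak_jet u (b, b)) (weak_laplacian \<Omega> u))"
    using L2.sum_left[of Basis "\<lambda>b. weak_jet u (b, b)" M "weak_laplacian \<Omega> u" "\<lambda>_. 1"] u
        weak_laplacian_SI[OF u]
    unfolding weak_laplacian_jet[of u, symmetric]
    by (simp add: weak_laplacian_jet[of u, symmetric] del: weak_jet_simps)
  also have "\<dots> = (\<Sum>b\<in>Basis. \<Sum>c\<in>Basis. inner_L2 M (weak_jet u (b, b)) (weak_jet u (c, c)))"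
  proof (rule sum.cong)
    fix b :: 'a assume b: "b \<in> Basis"
    show "inner_L2 M (weak_jet u (b, b)) (weak_laplacian \<Omega> u)
        = (\<Sum>c\<in>Basis. inner_L2 M (weak_jet u (b, b)) (weak_jet u (c, c)))"
      unfolding weak_laplacian_jet
      using L2.sum_right[of Basis "\<lambda>c. weak_jet u (c, c)" M "weak_jet u (b, b)" "\<lambda>_. 1"] u b
      by (simp del: weak_jet_simps)
  qed simp
  also have "\<dots> = (\<Sum>b\<in>Basis. \<Sum>c\<in>Basis. sqnorm M (weak_jet u (b, c)))"
    using H20_hessian[OF u] by (intro sum.cong) (auto simp del: weak_jet_simps)
  finally show ?thesis
    unfolding jet_norm2_def sum_jet_index H20_inner_laplacian[OF u u] by
        (simp del: weak_jet_simps(2,3))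
qed

text \<open>\<open>plate_op \<alpha> u\<close> and \<open>weak_laplacian \<Omega> u\<close> differ by \<open>(\<alpha> / 2) u\<close>, so both control each other
  together with the \<open>L\<^sup>2\<close> norm; the gradient term lies between zero and half the sum of the two
  other terms.\<close>

lemma plate_form_equivalent:
  assumes u: "u \<in> H20 \<Omega>"
  shows "jet_norm2 (weak_jet u) \<le> (3 + \<alpha>\<^sup>2) * plate_form \<alpha> u u"
    and "plate_form \<alpha> u u \<le> (3 + \<alpha>\<^sup>2) * jet_norm2 (weak_jet u)"
proof -
  let ?L = "weak_laplacian \<Omega> u"
  let ?a = "sqnorm M u" and ?l = "sqnorm M ?L" and ?t = "sqnorm M (plate_op \<alpha> u)"
  note SI = H20_SI[OF u] weak_laplacian_SI[OF u] plate_op_SI[OF u, of \<alpha>]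
  have a: "0 \<le> ?a" and l: "0 \<le> ?l" and t: "0 \<le> ?t" using SI by (auto intro: L2.nonneg)
  have cross: "- 2 * inner_L2 M u ?L \<le> ?a + ?l"
    using L2.nonneg[OF L2.closed(1)[OF SI(1,2)]] SI L2.sym[OF SI(1,2)] by (simp add: L2.bilin)
  have G: "inner_L2 M u ?L \<le> 0"
    unfolding H20_inner_laplacian[OF u u] neg_le_0_iff_le
    by (intro sum_nonneg L2.nonneg weak_jet_SI u jet_index_mem)
  have s: "sqnorm M ((\<alpha> / 2) *\<^sub>R u) = \<alpha>\<^sup>2 / 4 * ?a"
    using SI by (simp add: L2.bilin power2_eq_square)
  have L: "?L = plate_op \<alpha> u - (\<alpha> / 2) *\<^sub>R u" by (simp add: plate_op_def)
  have lt: "?l \<le> 2 * ?t + \<alpha>\<^sup>2 / 2 * ?a"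
  proof -
    have "?l \<le> 2 * ?t + 2 * sqnorm M ((\<alpha> / 2) *\<^sub>R u)"
      unfolding L by (rule L2.quad_diff_le[OF SI(3) L2.closed(3)[OF SI(1)]])
    then show ?thesis unfolding s by simp
  qed
  have tl: "?t \<le> 2 * ?l + \<alpha>\<^sup>2 / 2 * ?a"
  proof -
    have "?t \<le> 2 * ?l + 2 * sqnorm M ((\<alpha> / 2) *\<^sub>R u)"
      unfolding plate_op_def by (rule L2.quad_sum_le[OF SI(2) L2.closed(3)[OF SI(1)]])
    then show ?thesis unfolding s by simp
  qed
  have aa: "0 \<le> \<alpha>\<^sup>2 * ?a" "0 \<le> \<alpha>\<^sup>2 * ?l" "0 \<le> \<alpha>\<^sup>2 * ?t" using a l t by simp_all
  have "0 \<le> - (\<alpha>\<^sup>2 * inner_L2 M u ?L)" using G by (simp add: mult_nonneg_nonpos)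
  with cross lt tl aa a l t G
  show "jet_norm2 (weak_jet u) \<le> (3 + \<alpha>\<^sup>2) * plate_form \<alpha> u u"
    "plate_form \<alpha> u u \<le> (3 + \<alpha>\<^sup>2) * jet_norm2 (weak_jet u)"
    unfolding plate_form_def jet_norm2_eq[OF u] distrib_left distrib_right right_diff_distrib
        by linarith+
qed

lemma H20_approx_close:
  assumes "u \<in> H20 \<Omega>" "e > 0"
  shows "\<exists>\<phi>\<in>test_functions \<Omega>. jet_norm2 (\<lambda>j. classical_jet \<phi> j - weak_jet u j) < e"
proof -
  obtain \<phi> where \<phi>: "\<And>n. \<phi> n \<in> test_functions \<Omega>"
    "(\<lambda>n::nat. jet_norm2 (\<lambda>j. classical_jet (\<phi> n) j - weak_jet u j)) \<longlonglongrightarrow> 0"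
    using H20_approx[OF assms(1)] by blast
  have "\<forall>\<^sub>F n in sequentially. jet_norm2 (\<lambda>j. classical_jet (\<phi> n) j - weak_jet u j) < e"
    by (rule order_tendstoD(2)[OF \<phi>(2) assms(2)])
  then obtain n where "jet_norm2 (\<lambda>j. classical_jet (\<phi> n) j - weak_jet u j) < e"
    by (auto simp: eventually_sequentially)
  then show ?thesis using \<phi>(1) by blast
qed

lemma grad_energy_le_jet_norm2:
  assumes "\<phi> \<in> test_functions \<Omega>"
  shows "grad_energy \<phi> \<le> jet_norm2 (classical_jet \<phi>)"
proof -
  have nn: "0 \<le> sqnorm M (classical_jet \<phi> j)" if "j \<in> jet_index" for j
    by (intro L2.nonneg classical_jet_SI assms that)
  have "grad_energy \<phi> = (\<Sum>b\<in>Basis. sqnorm M (classical_jet \<phi> (b, 0)))"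
    unfolding grad_energy_def
    by (intro sum.cong) (auto simp: test_inner_L2 test_function_partial assms power2_eq_square)
  moreover have "0 \<le> sqnorm M (classical_jet \<phi> (0, 0))"
    by (intro nn jet_index_mem)
  moreover have "0 \<le> (\<Sum>b\<in>Basis. \<Sum>c\<in>Basis. sqnorm M (classical_jet \<phi> (b, c)))"
    by (intro sum_nonneg nn jet_index_mem)
  ultimately show ?thesis unfolding jet_norm2_def sum_jet_index by linarith
qed

text \<open>Rellich's theorem is transferred from test functions to \<open>H\<^sup>2\<^sub>0\<close> by approximation.\<close>

lemma H20_compact:
  assumes s: "\<And>n. s n \<in> H20 \<Omega>" and K: "\<And>n. jet_norm2 (weak_jet (s n)) \<le> K"
  shows "\<exists>r::nat \<Rightarrow> nat. strict_mono r \<and>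
    (\<forall>e>0. \<exists>N. \<forall>i\<ge>N. \<forall>j\<ge>N. sqnorm M (s (r i) - s (r j)) < e)"
proof -
  have "\<exists>\<phi>\<in>test_functions \<Omega>. jet_norm2 (\<lambda>j. classical_jet \<phi> j - weak_jet (s n) j)
      < 1 / real (Suc n)" for n
    by (rule H20_approx_close[OF s]) simp
  then obtain \<phi> where \<phi>: "\<And>n. \<phi> n \<in> test_functions \<Omega>"
    "\<And>n. jet_norm2 (\<lambda>j. classical_jet (\<phi> n) j - weak_jet (s n) j) < 1 / real (Suc n)" by metis
  have dSI: "classical_jet (\<phi> n) j - weak_jet (s n) j \<in> SI" if "j \<in> jet_index" for n j
    by (intro L2.closed(2) classical_jet_SI weak_jet_SI \<phi>(1) s that)
  have bound: "jet_norm2 (classical_jet (\<phi> n)) \<le> 2 * K + 2" for n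
  proof -
    have "jet_norm2 (classical_jet (\<phi> n))
        \<le> 2 * jet_norm2 (weak_jet (s n)) + 2 * jet_norm2 (\<lambda>j. classical_jet (\<phi> n) j - weak_jet (s
            n) j)"
      unfolding jet_norm2_def sum_distrib_left sum.distrib[symmetric]
    proof (rule sum_mono)
      fix j assume j: "j \<in> jet_index"
      show "sqnorm M (classical_jet (\<phi> n) j)
          \<le> 2 * sqnorm M (weak_jet (s n) j)
          + 2 * sqnorm M (classical_jet (\<phi> n) j - weak_jet (s n) j)"
        using L2.quad_sum_le[OF weak_jet_SI[OF s j] dSI[OF j, of n], of n] by simp
    qed
    moreover have "1 / real (Suc n) \<le> 1" by simp
    ultimately show ?thesis using K[of n] \<phi>(2)[of n] by linarith
  qed
  have "sqnorm M (\<phi> n) \<le> 2 * K + 2" "grad_energy (\<phi> n) \<le> 2 * K + 2" for n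
  proof -
    have "sqnorm M (classical_jet (\<phi> n) (0, 0)) \<le> jet_norm2 (classical_jet (\<phi> n))"
      by (intro jet_norm2_bound classical_jet_SI \<phi>(1) jet_index_mem)
    then show "sqnorm M (\<phi> n) \<le> 2 * K + 2" using bound[of n] by simp
    show "grad_energy (\<phi> n) \<le> 2 * K + 2"
      using grad_energy_le_jet_norm2[OF \<phi>(1)[of n]] bound[of n] by linarith
  qed
  from rellich[where \<phi> = \<phi> and K = "2 * K + 2", OF \<phi>(1) this] obtain r :: "nat \<Rightarrow> nat"
      where r: "strict_mono r"
    "\<And>e. e > 0 \<Longrightarrow> \<exists>N. \<forall>i\<ge>N. \<forall>j\<ge>N. sqnorm M (\<phi> (r i) - \<phi> (r j)) < e" by blast
  have close: "sqnorm M (\<phi> n - s n) \<le> 1 / real (Suc n)" for n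
  proof -
    have "sqnorm M (classical_jet (\<phi> n) (0, 0) - weak_jet (s n) (0, 0))
        \<le> jet_norm2 (\<lambda>j. classical_jet (\<phi> n) j - weak_jet (s n) j)"
      by (rule jet_norm2_bound(2)[where h = "\<lambda>j. classical_jet (\<phi> n) j - weak_jet (s n) j", OF dSI
          jet_index_mem(1)])
    then show ?thesis using \<phi>(2)[of n] by simp
  qed
  have "\<exists>N. \<forall>i\<ge>N. \<forall>j\<ge>N. sqnorm M (s (r i) - s (r j)) < e" if e: "e > 0" for e
  proof -
    have "e / 8 > 0" using e by simp
    from r(2)[OF this] obtain N1 where
      N1: "\<And>i j. \<lbrakk>i \<ge> N1; j \<ge> N1\<rbrakk> \<Longrightarrow> sqnorm M (\<phi> (r i) - \<phi> (r j)) < e / 8" by blast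
    have "e / 16 > 0" using e by simp
    from reals_Archimedean[OF this] obtain N2 where N2: "inverse (real (Suc N2)) < e / 16" by blast
    have small: "sqnorm M (\<phi> (r i) - s (r i)) < e / 16" if "i \<ge> N2" for i
    proof -
      have "N2 \<le> r i" using seq_suble[OF r(1), of i] that by linarith
      then have "1 / real (Suc (r i)) \<le> 1 / real (Suc N2)" by (intro divide_left_mono) auto
      then show ?thesis using close[of "r i"] N2 by (simp add: inverse_eq_divide)
    qed
    show ?thesis
    proof (intro exI[of _ "max N1 N2"] allI impI)
      fix i j assume ij: "max N1 N2 \<le> i" "max N1 N2 \<le> j"
      let ?p = "\<phi> (r i) - \<phi> (r j)" and ?q = "\<phi> (r i) - s (r i)" and ?t = "\<phi> (r j) - s (r j)"
      have SI: "?p \<in> SI" "?q \<in> SI" "?t \<in> SI"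
        by (intro L2.closed(2) H20_SI s test_square_integrable \<phi>(1))+
      have "s (r i) - s (r j) = (?p - ?q) + ?t" by simp
      then have "sqnorm M (s (r i) - s (r j))
          \<le> 2 * sqnorm M (?p - ?q) + 2 * sqnorm M ?t"
        using L2.quad_sum_le[OF L2.closed(2)[OF SI(1,2)] SI(3)] by simp
      moreover have "sqnorm M (?p - ?q) \<le> 2 * sqnorm M ?p + 2 * sqnorm M ?q"
        by (rule L2.quad_diff_le[OF SI(1,2)])
      moreover have "sqnorm M ?p < e / 8" using ij by (intro N1) auto
      moreover have "sqnorm M ?q < e / 16" using ij by (intro small) auto
      moreover have "sqnorm M ?t < e / 16" using ij by (intro small) auto
      ultimately show "sqnorm M (s (r i) - s (r j)) < e" using e by linarith
    qed
  qed
  with r(1) show ?thesis by blast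
qed

section \<open>Test functions with disjoint supports\<close>

text \<open>The balls are strung along a coordinate direction inside a given ball; their radius is a
  third of the distance of neighbouring centres.\<close>

lemma disjoint_balls:
  fixes n :: nat
  assumes "\<Omega> \<noteq> {}"
  shows "\<exists>a r. r > 0 \<and> (\<forall>i<n. cball (a i) r \<subseteq> \<Omega>) \<and>
    (\<forall>i<n. \<forall>j<n. i \<noteq> j \<longrightarrow> cball (a i) r \<inter> cball (a j) r = {})"
proof -
  obtain x0 where "x0 \<in> \<Omega>" using assms by blast
  then obtain R where R: "R > 0" "cball x0 R \<subseteq> \<Omega>"
    using open_\<Omega> by (meson open_contains_cball)
  obtain e :: 'a where e: "e \<in> Basis" using nonempty_Basis by blast
  define h where "h = R / (real n + 1)"
  have h: "h > 0" "h * (real n + 1) = R" using R by (auto simp: h_def)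
  define a where "a i = x0 + (h * real i) *\<^sub>R e" for i :: nat
  have dist: "dist (a i) (a j) = h * \<bar>real i - real j\<bar>" for i j
  proof -
    have "a i - a j = (h * (real i - real j)) *\<^sub>R e" by (simp add: a_def algebra_simps)
    then show ?thesis using e h by (simp add: dist_norm abs_mult)
  qed
  have "cball (a i) (h / 3) \<subseteq> \<Omega>" if "i < n" for i
  proof -
    have "dist (a i) x0 = h * real i" using dist[of i 0] by (simp add: a_def)
    moreover have "h * real i + h / 3 \<le> R"
    proof -
      have "h * (real i + 1) \<le> h * (real n + 1)" using that h by (intro mult_left_mono) auto
      then have "h * real i + h * 1 \<le> R" using h(2) by (simp only: distrib_left)
      then show ?thesis using h(1) by linarith
    qed
    ultimately have "cball (a i) (h / 3) \<subseteq> cball x0 R"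
      by (simp add: cball_subset_cball_iff)
    then show ?thesis using R by blast
  qed
  moreover have "cball (a i) (h / 3) \<inter> cball (a j) (h / 3) = {}" if "i \<noteq> j" for i j
  proof (rule ccontr)
    assume "cball (a i) (h / 3) \<inter> cball (a j) (h / 3) \<noteq> {}"
    then obtain x where "dist (a i) x \<le> h / 3" "dist (a j) x \<le> h / 3" by auto
    then have "dist (a i) (a j) \<le> 2 * h / 3" using dist_triangle2[of "a i" "a j" x] by linarith
    moreover have "1 \<le> \<bar>real i - real j\<bar>" using that by linarith
    then have "h * 1 \<le> h * \<bar>real i - real j\<bar>" using h by (intro mult_left_mono) auto
    ultimately show False using dist[of i j] h by linarith
  qed
  ultimately show ?thesis using h by (intro exI[of _ a] exI[of _ "h / 3"]) simp
qed

lemma inner_L2_eq_0_if_disjoint: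
  assumes "\<And>x. f x = 0 \<or> g x = 0"
  shows "inner_L2 M f g = 0"
proof -
  have "f x * g x = 0" for x using assms[of x] by auto
  then show ?thesis unfolding inner_L2_def by (simp only: integral_zero)
qed

lemma test_inner_L2_pos:
  assumes \<phi>: "\<phi> \<in> test_functions \<Omega>" and x: "\<phi> x \<noteq> 0"
  shows "sqnorm M \<phi> > 0"
proof -
  have i: "integrable lborel (\<lambda>x. (\<phi> x)\<^sup>2)"
    unfolding power2_eq_square
    by (rule test_function_integrable[OF test_function_mult[OF test_function_smooth[OF \<phi>] \<phi>]])
  have "sqnorm M \<phi> = (LINT x|lborel. (\<phi> x)\<^sup>2)"
    by (simp add: test_inner_L2 \<phi> power2_eq_square)
  moreover have "(LINT x|lborel. (\<phi> x)\<^sup>2) \<noteq> 0"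
  proof
    assume "(LINT x|lborel. (\<phi> x)\<^sup>2) = 0"
    then have ae: "AE x in lborel. \<phi> x = 0"
      using i by (subst (asm) integral_nonneg_eq_0_iff_AE) auto
    have "open {x. \<phi> x \<noteq> 0}"
      using open_Collect_neq[OF test_function_continuous[OF \<phi>] continuous_on_const] .
    moreover have "{x. \<phi> x \<noteq> 0} \<in> null_sets lborel"
      using ae \<open>open {x. \<phi> x \<noteq> 0}\<close> by (subst (asm) AE_iff_null) (auto simp: null_sets_def)
    ultimately have "{x. \<phi> x \<noteq> 0} = {}"
      by (metis null_sets_completionI open_not_negligible negligible_iff_null_sets)
    then show False using x by blast
  qed
  moreover have "(LINT x|lborel. (\<phi> x)\<^sup>2) \<ge> 0" by simp
  ultimately show ?thesis by linarith
qed

lemma bump_family: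
  fixes n :: nat
  assumes "\<Omega> \<noteq> {}"
  shows "\<exists>a r. r > 0 \<and> (\<forall>i<n. ball_bump (a i) r \<in> test_functions \<Omega> \<and>
      sqnorm M (ball_bump (a i) r) > 0) \<and>
    (\<forall>i<n. \<forall>j<n. i \<noteq> j \<longrightarrow> cball (a i) r \<inter> cball (a j) r = {})"
proof -
  obtain a r where ar0: "r > 0" "\<forall>i<n. cball (a i) r \<subseteq> \<Omega>"
    "\<forall>i<n. \<forall>j<n. i \<noteq> j \<longrightarrow> cball (a i) r \<inter> cball (a j) r = {}"
    using disjoint_balls[OF assms, of n] by (elim exE conjE) (rule that)
  note ar = ar0(1) ar0(2)[rule_format]
  have t: "ball_bump (a i) r \<in> test_functions \<Omega>" if "i < n" for i
    by (rule ball_bump_test_function[OF ar(1) ar(2)[OF that]])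
  moreover have "sqnorm M (ball_bump (a i) r) > 0" if "i < n" for i
    by (rule test_inner_L2_pos[OF t[OF that], of "a i"])
        (use ball_bump_nonzero_iff[OF ar(1), of "a i" "a i"] ar(1) in simp)
  ultimately show ?thesis
    using ar0(1,3) by (intro exI[of _ a] exI[of _ r] conjI allI impI) simp_all
qed

lemma compact_form_pair_plate:
  assumes ne: "\<Omega> \<noteq> {}"
  shows "compact_form_pair (H20 \<Omega>) (plate_form \<alpha>) (inner_L2 M)"
proof -
  interpret A: semidefinite_form "H20 \<Omega>" "plate_form \<alpha>" by (rule semidefinite_plate_form)
  interpret B: semidefinite_form "H20 \<Omega>" "inner_L2 M" by (rule semidefinite_L2)
  define C where "C = 3 + \<alpha>\<^sup>2"
  have C: "C > 0" unfolding C_def by (rule add_pos_nonneg) simp_all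
  note le = plate_form_equivalent[where \<alpha> = \<alpha>, folded C_def]
  show ?thesis
  proof
    show "sqnorm M u \<le> plate_form \<alpha> u u" if "u \<in> H20 \<Omega>" for u
      using L2.nonneg[OF plate_op_SI[OF that]] by (simp add: plate_form_def)
  next
    fix s :: "nat \<Rightarrow> 'a \<Rightarrow> real"
    assume s: "\<And>n. s n \<in> H20 \<Omega>"
      and cauchy: "\<And>e. e > 0 \<Longrightarrow> \<exists>N. \<forall>i\<ge>N. \<forall>j\<ge>N. plate_form \<alpha> (s i - s j) (s i - s j) < e"
    have d: "s i - s j \<in> H20 \<Omega>" for i j by (rule A.closed(2)[OF s s])
    have "\<exists>N. \<forall>i\<ge>N. \<forall>k\<ge>N. jet_norm2 (weak_jet (s i - s k)) < e" if e: "e > 0" for e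
    proof -
      have "e / C > 0" using e C by simp
      from cauchy[OF this] obtain N where
        N: "\<And>i j. \<lbrakk>i \<ge> N; j \<ge> N\<rbrakk> \<Longrightarrow> plate_form \<alpha> (s i - s j) (s i - s j) < e / C" by blast
      have "jet_norm2 (weak_jet (s i - s k)) < e" if "i \<ge> N" "k \<ge> N" for i k
      proof -
        have "C * plate_form \<alpha> (s i - s k) (s i - s k) < C * (e / C)"
          using N[OF that] C by (intro mult_strict_left_mono)
        then show ?thesis using le(1)[OF d[of i k]] C by simp
      qed
      then show ?thesis by blast
    qed
    from H20_complete[where s = s, OF s this] obtain u where u: "u \<in> H20 \<Omega>"
      "(\<lambda>n. jet_norm2 (weak_jet (s n - u))) \<longlonglongrightarrow> 0" by blast
    have "(\<lambda>n. plate_form \<alpha> (s n - u) (s n - u)) \<longlonglongrightarrow> 0"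
    proof (rule Lim_null_comparison)
      show "(\<lambda>n. C * jet_norm2 (weak_jet (s n - u))) \<longlonglongrightarrow> 0"
        by (rule tendsto_mult_right_zero[OF u(2)])
      show "\<forall>\<^sub>F n in sequentially. norm (plate_form \<alpha> (s n - u) (s n - u))
          \<le> C * jet_norm2 (weak_jet (s n - u))"
        using le(2)[OF A.closed(2)[OF s u(1)]] A.nonneg[OF A.closed(2)[OF s u(1)]]
        by (intro always_eventually) simp
    qed
    with u(1) show "\<exists>u\<in>H20 \<Omega>. (\<lambda>n. plate_form \<alpha> (s n - u) (s n - u)) \<longlonglongrightarrow> 0" by blast
  next
    fix s :: "nat \<Rightarrow> 'a \<Rightarrow> real" and K
    assume s: "\<And>n. s n \<in> H20 \<Omega>" and K: "\<And>n. plate_form \<alpha> (s n) (s n) \<le> K"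
    have "jet_norm2 (weak_jet (s n)) \<le> C * K" for n
      using le(1)[OF s[of n]] mult_left_mono[OF K[of n], of C] C by linarith
    from H20_compact[where s = s and K = "C * K", OF s this] show "\<exists>r::nat \<Rightarrow> nat. strict_mono r \<and>
        (\<forall>e>0. \<exists>N. \<forall>i\<ge>N. \<forall>j\<ge>N. sqnorm M (s (r i) - s (r j)) < e)" .
  next
    fix n :: nat
    obtain a r where ar0: "r > 0" "\<forall>i<n. ball_bump (a i) r \<in> test_functions \<Omega> \<and>
        sqnorm M (ball_bump (a i) r) > 0"
      "\<forall>i<n. \<forall>j<n. i \<noteq> j \<longrightarrow> cball (a i) r \<inter> cball (a j) r = {}"
      using bump_family[OF ne, of n] by (elim exE conjE) (rule that)
    note ar = ar0(1) ar0(2)[rule_format, THEN conjunct1] ar0(2)[rule_format, THEN conjunct2]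
      ar0(3)[rule_format]
    define f where "f i = ball_bump (a i) r" for i
    have f: "f i \<in> H20 \<Omega>" if "i < n" for i unfolding f_def
        by (rule test_in_H20(1)[OF ar(2)[OF that]])
    have off: "inner_L2 M (f i) (f j) = 0" if "i < n" "j < n" "i \<noteq> j" for i j
    proof (rule inner_L2_eq_0_if_disjoint)
      fix x
      have "\<not> (x \<in> ball (a i) r \<and> x \<in> ball (a j) r)" using ar(4)[OF that] ball_subset_cball by blast
      then show "f i x = 0 \<or> f j x = 0"
        using ball_bump_nonzero_iff[OF ar(1)] unfolding f_def by metis
    qed
    have "\<forall>i<n. c i = 0"
      if 0: "sqnorm M (\<Sum>i<n. c i *\<^sub>R f i) = 0" for c
    proof (intro allI impI)
      fix i assume i: "i < n"
      let ?u = "\<Sum>i<n. c i *\<^sub>R f i"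
      have u: "?u \<in> H20 \<Omega>" using f by (intro B.sum_closed B.closed) auto
      have "(inner_L2 M ?u (f i))\<^sup>2 \<le> 0"
        using B.Cauchy_Schwarz[OF u f[OF i]] 0 by simp
      then have "inner_L2 M ?u (f i) = 0" by simp
      moreover have "inner_L2 M ?u (f i) = (\<Sum>j<n. c j * inner_L2 M (f j) (f i))"
        using f i by (intro B.sum_left) auto
      moreover have "\<dots> = (\<Sum>j<n. if j = i then c i * sqnorm M (f i) else 0)"
        using off i by (intro sum.cong) auto
      ultimately have "c i * sqnorm M (f i) = 0" using i by simp
      then show "c i = 0" using ar(3)[OF i] by (simp add: f_def)
    qed
    then show "\<exists>f::nat \<Rightarrow> 'a \<Rightarrow> real. (\<forall>i<n. f i \<in> H20 \<Omega>) \<and>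
      (\<forall>c. sqnorm M (\<Sum>i<n. c i *\<^sub>R f i) = 0 \<longrightarrow> (\<forall>i<n. c i = 0))"
      using f by (intro exI[of _ f]) blast
  qed
qed

end

section \<open>Oscillating test functions\<close>

definition plane_wave :: "real \<Rightarrow> 'a::euclidean_space \<Rightarrow> real \<Rightarrow> 'a \<Rightarrow> real"
  where "plane_wave \<omega> e \<theta> x = cos (\<omega> * (x \<bullet> e) + \<theta>)"

lemma C_k_plane_wave: "C_k n (plane_wave \<omega> e \<theta>)"
  unfolding plane_wave_def[abs_def]
  by (intro C_k_cos C_k_add C_k_mult C_k_const C_k_inner)

text \<open>Differentiation shifts the phase by a quarter of a period, so that sines need not be
  treated apart.\<close>

lemma partial_plane_wave:
  "partial b (plane_wave \<omega> e \<theta>) x = \<omega> * (b \<bullet> e) * plane_wave \<omega> e (\<theta> + pi / 2) x"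
proof (rule partial_eq)
  have "(plane_wave \<omega> e \<theta> has_derivative (\<lambda>v. - sin (\<omega> * (x \<bullet> e) + \<theta>) * (\<omega> * (v \<bullet> e)))) (at x)"
    unfolding plane_wave_def[abs_def] by (auto intro!: derivative_eq_intros)
  moreover have "plane_wave \<omega> e (\<theta> + pi / 2) x = - sin (\<omega> * (x \<bullet> e) + \<theta>)"
    by (simp add: plane_wave_def cos_add flip: add.assoc)
  ultimately show "(plane_wave \<omega> e \<theta> has_derivative (\<lambda>b. \<omega> * (b \<bullet> e) * plane_wave \<omega> e (\<theta>
      + pi / 2) x)) (at x)"
    by (simp add: mult_ac)
qed

lemma plane_wave_add_pi: "plane_wave \<omega> e (\<theta> + pi / 2 + pi / 2) x = - plane_wave \<omega> e \<theta> x"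
proof -
  have "\<omega> * (x \<bullet> e) + (\<theta> + pi / 2 + pi / 2) = (\<omega> * (x \<bullet> e) + \<theta>) + pi" by simp
  then show ?thesis unfolding plane_wave_def by (simp only: cos_periodic_pi)
qed

lemma partial_modulated:
  assumes "\<And>n. C_k n \<eta>"
  shows "partial b (\<lambda>x. \<eta> x * plane_wave \<omega> e \<theta> x) x =
    partial b \<eta> x * plane_wave \<omega> e \<theta> x + \<omega> * (b \<bullet> e) * (\<eta> x * plane_wave \<omega> e (\<theta> + pi / 2) x)"
  by (subst partial_mult[OF assms C_k_plane_wave]) (simp add: partial_plane_wave)

text \<open>The product rule, for \<open>\<Delta> + \<omega>\<^sup>2\<close>: the term in which both derivatives fall on the wave
  cancels.\<close>

lemma laplacian_modulated:
  fixes e :: "'a::euclidean_space"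
  assumes \<eta>: "\<eta> \<in> test_functions \<Omega>" and e: "e \<in> Basis"
  shows "(\<Sum>b\<in>Basis. partial b (partial b (\<lambda>x. \<eta> x * plane_wave \<omega> e \<theta> x)) x)
      + \<omega>\<^sup>2 * (\<eta> x * plane_wave \<omega> e \<theta> x)
    = (\<Sum>b\<in>Basis. partial b (partial b \<eta>) x) * plane_wave \<omega> e \<theta> x
      + 2 * \<omega> * (partial e \<eta> x * plane_wave \<omega> e (\<theta> + pi / 2) x)"
proof -
  note sm = test_function_smooth[OF \<eta>]
  have second: "partial b (partial b (\<lambda>x. \<eta> x * plane_wave \<omega> e \<theta> x)) x
      = partial b (partial b \<eta>) x * plane_wave \<omega> e \<theta> x
      + (b \<bullet> e) * (2 * \<omega> * (partial b \<eta> x * plane_wave \<omega> e (\<theta> + pi / 2) x)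
        - (b \<bullet> e) * (\<omega>\<^sup>2 * (\<eta> x * plane_wave \<omega> e \<theta> x)))" if b: "b \<in> Basis" for b
  proof -
    note smb = test_function_smooth[OF test_function_partial[OF \<eta> b]]
    have "partial b (\<lambda>x. \<eta> x * plane_wave \<omega> e \<theta> x) = (\<lambda>x. partial b \<eta> x * plane_wave \<omega> e \<theta> x
        + \<omega> * (b \<bullet> e) * (\<eta> x * plane_wave \<omega> e (\<theta> + pi / 2) x))"
      by (rule ext) (rule partial_modulated[OF sm])
    then have "partial b (partial b (\<lambda>x. \<eta> x * plane_wave \<omega> e \<theta> x)) x
        = partial b (\<lambda>x. partial b \<eta> x * plane_wave \<omega> e \<theta> x) x
        + partial b (\<lambda>x. \<omega> * (b \<bullet> e) * (\<eta> x * plane_wave \<omega> e (\<theta> + pi / 2) x)) x"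
      by (simp only:) (intro partial_add C_k_mult C_k_const C_k_plane_wave sm smb)
    also have "partial b (\<lambda>x. partial b \<eta> x * plane_wave \<omega> e \<theta> x) x
        = partial b (partial b \<eta>) x * plane_wave \<omega> e \<theta> x
        + \<omega> * (b \<bullet> e) * (partial b \<eta> x * plane_wave \<omega> e (\<theta> + pi / 2) x)"
      by (rule partial_modulated[OF smb])
    also have "partial b (\<lambda>x. \<omega> * (b \<bullet> e) * (\<eta> x * plane_wave \<omega> e (\<theta> + pi / 2) x)) x
        = \<omega> * (b \<bullet> e) * partial b (\<lambda>x. \<eta> x * plane_wave \<omega> e (\<theta> + pi / 2) x) x"
      by (intro partial_scale C_k_mult C_k_plane_wave sm)
    also have "partial b (\<lambda>x. \<eta> x * plane_wave \<omega> e (\<theta> + pi / 2) x) x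
        = partial b \<eta> x * plane_wave \<omega> e (\<theta> + pi / 2) x - \<omega> * (b \<bullet> e) * (\<eta> x * plane_wave \<omega> e \<theta> x)"
      unfolding partial_modulated[OF sm] plane_wave_add_pi by simp
    finally show ?thesis by (simp add: power2_eq_square algebra_simps)
  qed
  have pick: "(\<Sum>b\<in>Basis. (b \<bullet> e) * g b) = g e" for g :: "'a \<Rightarrow> real"
  proof -
    have "(\<Sum>b\<in>Basis. (b \<bullet> e) * g b) = (\<Sum>b\<in>Basis. if b = e then g e else 0)"
      using e by (intro sum.cong) (auto simp: inner_Basis)
    then show ?thesis using e by simp
  qed
  have "(\<Sum>b\<in>Basis. partial b (partial b (\<lambda>x. \<eta> x * plane_wave \<omega> e \<theta> x)) x)
      = (\<Sum>b\<in>Basis. partial b (partial b \<eta>) x * plane_wave \<omega> e \<theta> x)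
      + (\<Sum>b\<in>Basis. (b \<bullet> e) * (2 * \<omega> * (partial b \<eta> x * plane_wave \<omega> e (\<theta> + pi / 2) x)
        - (b \<bullet> e) * (\<omega>\<^sup>2 * (\<eta> x * plane_wave \<omega> e \<theta> x))))"
    unfolding sum.distrib[symmetric] by (rule sum.cong[OF refl second])
  also have "\<dots> = (\<Sum>b\<in>Basis. partial b (partial b \<eta>) x) * plane_wave \<omega> e \<theta> x
      + (2 * \<omega> * (partial e \<eta> x * plane_wave \<omega> e (\<theta>
          + pi / 2) x) - (e \<bullet> e) * (\<omega>\<^sup>2 * (\<eta> x * plane_wave \<omega> e \<theta> x)))"
    unfolding pick by (simp add: sum_distrib_right)
  finally show ?thesis using e by simp
qed

context bounded_open
begin

lemma modulated_test_function:
  "\<eta> \<in> test_functions \<Omega> \<Longrightarrow> (\<lambda>x. \<eta> x * plane_wave \<omega> e \<theta> x) \<in> test_functions \<Omega>"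
  using test_function_mult[OF C_k_plane_wave[of _ \<omega> e \<theta>], of \<eta> \<Omega>] by (simp add: mult.commute)

lemma modulated_norm_le:
  assumes "\<eta> \<in> test_functions \<Omega>"
  shows "sqnorm M (\<lambda>x. \<eta> x * plane_wave \<omega> e \<theta> x) \<le> sqnorm M \<eta>"
  unfolding inner_L2_def
proof (rule integral_mono)
  note t = modulated_test_function[OF assms, of \<omega> e \<theta>]
  show "integrable M (\<lambda>x. \<eta> x * plane_wave \<omega> e \<theta> x * (\<eta> x * plane_wave \<omega> e \<theta> x))"
    by (rule integrable_product[OF test_square_integrable[OF t] test_square_integrable[OF t]])
  show "integrable M (\<lambda>x. \<eta> x * \<eta> x)"
    by (rule integrable_product[OF test_square_integrable[OF assms] test_square_integrable[OF
        assms]])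
  fix x
  have "(plane_wave \<omega> e \<theta> x)\<^sup>2 \<le> 1"
    unfolding plane_wave_def by (simp add: abs_square_le_1)
  then have "(\<eta> x)\<^sup>2 * (plane_wave \<omega> e \<theta> x)\<^sup>2 \<le> (\<eta> x)\<^sup>2 * 1" by (intro mult_left_mono) auto
  then show "\<eta> x * plane_wave \<omega> e \<theta> x * (\<eta> x * plane_wave \<omega> e \<theta> x) \<le> \<eta> x * \<eta> x"
    by (simp add: power2_eq_square mult_ac)
qed

text \<open>The squares of a wave and of its shift by a quarter of a period add up to one, so one of
  the two retains at least half of the \<open>L\<^sup>2\<close> norm of the bump, whatever the frequency is.\<close>

lemma modulated_norm_ge:
  assumes \<eta>: "\<eta> \<in> test_functions \<Omega>"
  shows "\<exists>\<theta>. sqnorm M \<eta> / 2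
    \<le> sqnorm M (\<lambda>x. \<eta> x * plane_wave \<omega> e \<theta> x)"
proof -
  let ?f = "\<lambda>\<theta> x. \<eta> x * plane_wave \<omega> e \<theta> x"
  have SI: "?f \<theta> \<in> SI" for \<theta> by (rule test_square_integrable[OF modulated_test_function[OF \<eta>]])
  have pt: "?f 0 x * ?f 0 x + ?f (pi / 2) x * ?f (pi / 2) x = \<eta> x * \<eta> x" for x
  proof -
    define t where "t = \<omega> * (x \<bullet> e)"
    have w: "plane_wave \<omega> e 0 x = cos t" "plane_wave \<omega> e (pi / 2) x = - sin t"
      by (simp_all add: plane_wave_def t_def cos_add)
    have "?f 0 x * ?f 0 x + ?f (pi / 2) x * ?f (pi / 2) x = \<eta> x * \<eta> x * ((cos t)\<^sup>2 + (sin t)\<^sup>2)"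
      unfolding w by algebra
    then show ?thesis by (simp only: sin_cos_squared_add2 mult_1_right)
  qed
  have "sqnorm M (?f 0) + sqnorm M (?f (pi / 2)) = sqnorm M \<eta>"
    unfolding inner_L2_def
    by (subst Bochner_Integration.integral_add[symmetric])
        (simp_all only: integrable_product[OF SI SI] pt)
  then have "sqnorm M \<eta> / 2 \<le> sqnorm M (?f 0) \<or>
      sqnorm M \<eta> / 2 \<le> sqnorm M (?f (pi / 2))" by linarith
  then show ?thesis by blast
qed

lemma plate_op_test:
  assumes "f \<in> test_functions \<Omega>"
  shows "AE x in M. plate_op \<alpha> f x = (\<Sum>b\<in>Basis. partial b (partial b f) x) + \<alpha> / 2 * f x"
proof -
  have "AE x in M. \<forall>b\<in>Basis. weak_jet f (b, b) x = classical_jet f (b, b) x"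
    by (intro eventually_ball_finite ballI test_in_H20(2)[OF assms] jet_index_mem finite_Basis)
  then show ?thesis
  proof eventually_elim
    case (elim x)
    then show ?case
      unfolding plate_op_def weak_laplacian_jet plus_fun_apply sum_fun_apply by simp
  qed
qed

text \<open>The bound grows only linearly in \<open>\<alpha>\<close>, since \<open>4 \<omega>\<^sup>2 = 2 \<alpha>\<close> for the frequency \<open>\<omega> = \<surd>(\<alpha>/2)\<close>.\<close>

lemma plate_op_modulated_le:
  assumes \<eta>: "\<eta> \<in> test_functions \<Omega>" and e: "e \<in> Basis" and \<alpha>: "\<alpha> > 0"
  defines "f \<equiv> \<lambda>\<theta> x. \<eta> x * plane_wave (sqrt (\<alpha> / 2)) e \<theta> x"
    and "L \<equiv> \<lambda>x. \<Sum>b\<in>Basis. partial b (partial b \<eta>) x"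
  shows "sqnorm M (plate_op \<alpha> (f \<theta>))
    \<le> 2 * sqnorm M L + 4 * \<alpha> * sqnorm M (partial e \<eta>)"
proof -
  define \<omega> where "\<omega> = sqrt (\<alpha> / 2)"
  have \<omega>: "\<omega>\<^sup>2 = \<alpha> / 2" using \<alpha> by (simp add: \<omega>_def)
  have ft: "f \<theta> \<in> test_functions \<Omega>" unfolding f_def by (rule modulated_test_function[OF \<eta>])
  have Lt: "L \<in> test_functions \<Omega>"
  proof -
    have "(\<lambda>x. \<Sum>b\<in>B. partial b (partial b \<eta>) x) \<in> test_functions \<Omega>" if "B \<subseteq> Basis" for B
      using finite_subset[OF that finite_Basis] that
      by (induction B rule: finite_induct) (auto intro!: test_function_zero test_function_add
          test_function_partial \<eta>)
    then show ?thesis unfolding L_def by blast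
  qed
  define p where "p x = L x * plane_wave \<omega> e \<theta> x" for x
  define q where "q x = partial e \<eta> x * plane_wave \<omega> e (\<theta> + pi / 2) x" for x
  have pq: "p \<in> SI" "q \<in> SI" unfolding p_def[abs_def] q_def[abs_def]
    by (intro test_square_integrable modulated_test_function Lt test_function_partial \<eta> e)+
  have "AE x in M. plate_op \<alpha> (f \<theta>) x = (p + (2 * \<omega>) *\<^sub>R q) x"
    using plate_op_test[OF ft, of \<alpha>]
  proof eventually_elim
    case (elim x)
    have "(\<Sum>b\<in>Basis. partial b (partial b (f \<theta>)) x) + \<omega>\<^sup>2 * f \<theta> x = p x + 2 * \<omega> * q x"
      using laplacian_modulated[OF \<eta> e, of \<omega> \<theta> x]
      by (simp add: f_def p_def q_def L_def \<omega>_def)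
    then show ?case using elim by (simp add: \<omega>)
  qed
  then have "sqnorm M (plate_op \<alpha> (f \<theta>)) = sqnorm M (p + (2 * \<omega>) *\<^sub>R q)"
    using plate_op_SI[OF test_in_H20(1)[OF ft], of \<alpha>] L2.closed(1)[OF pq(1) L2.closed(3)[OF
        pq(2)], of "2 * \<omega>"]
    by (intro inner_L2_AE_cong square_integrable_measurable)
  also have "\<dots> \<le> 2 * sqnorm M p + 2 * sqnorm M ((2 * \<omega>) *\<^sub>R q)"
    by (rule L2.quad_sum_le[OF pq(1) L2.closed(3)[OF pq(2)]])
  also have "sqnorm M ((2 * \<omega>) *\<^sub>R q) = 2 * \<alpha> * sqnorm M q"
    using pq \<omega> by (simp add: L2.bilin L2.closed(3) power2_eq_square)
  also have "2 * sqnorm M p + 2 * (2 * \<alpha> * sqnorm M q)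
      \<le> 2 * sqnorm M L + 2 * (2 * \<alpha> * sqnorm M (partial e \<eta>))"
    unfolding p_def[abs_def] q_def[abs_def] using \<alpha>
    by (intro add_mono mult_left_mono modulated_norm_le Lt test_function_partial \<eta> e) auto
  finally show ?thesis by simp
qed

lemma plate_op_off_support:
  assumes "f \<in> test_functions \<Omega>" "compact K" "\<And>x. x \<notin> K \<Longrightarrow> f x = 0"
  shows "AE x in M. x \<notin> K \<longrightarrow> plate_op \<alpha> f x = 0"
  using plate_op_test[OF assms(1), of \<alpha>]
proof eventually_elim
  case (elim x)
  have "partial b (partial b f) x = 0" if "x \<notin> K" for b
    using that by (intro partial_eq_0_off_support[OF assms(2)] partial_eq_0_off_support[OF
        assms(2,3)])
  then show ?case using elim assms(3) by auto
qed

text \<open>The bumps, and hence the constant, are chosen before \<open>\<alpha>\<close>; only frequency and phases of the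
  waves depend on \<open>\<alpha>\<close>. Orthogonality for both forms comes from the disjoint supports.\<close>

lemma plate_test_functions:
  fixes k :: nat
  assumes ne: "\<Omega> \<noteq> {}"
  shows "\<exists>C. \<forall>\<alpha>>0. \<exists>f. (\<forall>i\<le>k. f i \<in> H20 \<Omega> \<and> sqnorm M (f i) > 0 \<and>
      plate_form \<alpha> (f i) (f i) \<le> (1 + C * (1 + \<alpha>)) * sqnorm M (f i)) \<and>
    (\<forall>i\<le>k. \<forall>j\<le>k. i \<noteq> j \<longrightarrow> plate_form \<alpha> (f i) (f j) = 0 \<and> inner_L2 M (f i) (f j) = 0)"
proof -
  obtain a r where ar0: "r > 0" "\<forall>i<Suc k. ball_bump (a i) r \<in> test_functions \<Omega> \<and>
      sqnorm M (ball_bump (a i) r) > 0"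
    "\<forall>i<Suc k. \<forall>j<Suc k. i \<noteq> j \<longrightarrow> cball (a i) r \<inter> cball (a j) r = {}"
    using bump_family[OF ne, of "Suc k"] by (elim exE conjE) (rule that)
  define \<eta> where "\<eta> i = ball_bump (a i) r" for i
  have \<eta>: "\<eta> i \<in> test_functions \<Omega>" "sqnorm M (\<eta> i) > 0" if "i \<le> k" for i
    using ar0(2) that by (simp_all add: \<eta>_def)
  have \<eta>0: "\<eta> i x = 0" if "x \<notin> cball (a i) r" for i x
    using that ball_bump_nonzero_iff[OF ar0(1), of "a i" x] unfolding \<eta>_def by auto
  have disj: "x \<notin> cball (a i) r \<or> x \<notin> cball (a j) r" if "i \<le> k" "j \<le> k" "i \<noteq> j" for i j x
    using ar0(3)[rule_format, of i j] that by (auto simp only: less_Suc_eq_le disjoint_iff)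
  obtain e :: 'a where e: "e \<in> Basis" using nonempty_Basis by blast
  define L where "L i x = (\<Sum>b\<in>Basis. partial b (partial b (\<eta> i)) x)" for i x
  define K where "K i = (4 * sqnorm M (L i) + 8 * sqnorm M (partial e (\<eta> i)))
    / sqnorm M (\<eta> i)" for i
  have nn: "0 \<le> sqnorm M (L i)" "0 \<le> sqnorm M (partial e (\<eta> i))" for i
    unfolding inner_L2_self by simp_all
  have K0: "0 \<le> K i" if "i \<le> k" for i
    unfolding K_def using nn \<eta>(2)[OF that] by (intro divide_nonneg_pos) auto
  define C where "C = (\<Sum>i\<le>k. K i)"
  have KC: "K i \<le> C" if "i \<le> k" for i
    unfolding C_def using that K0 by (intro member_le_sum) auto
  show ?thesis
  proof (intro exI[of _ C] allI impI)
    fix \<alpha> :: real assume \<alpha>: "\<alpha> > 0"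
    define \<omega> where "\<omega> = sqrt (\<alpha> / 2)"
    have "\<forall>i. \<exists>\<theta>. i \<le> k \<longrightarrow> sqnorm M (\<eta> i) / 2
        \<le> sqnorm M (\<lambda>x. \<eta> i x * plane_wave \<omega> e \<theta> x)"
      using modulated_norm_ge[OF \<eta>(1)] by blast
    then obtain \<theta> where \<theta>: "\<And>i. i \<le> k \<Longrightarrow> sqnorm M (\<eta> i) / 2
        \<le> sqnorm M (\<lambda>x. \<eta> i x * plane_wave \<omega> e (\<theta> i) x)"
      by metis
    define f where "f i x = \<eta> i x * plane_wave \<omega> e (\<theta> i) x" for i x
    have ft: "f i \<in> test_functions \<Omega>" if "i \<le> k" for i
      unfolding f_def[abs_def] by (rule modulated_test_function[OF \<eta>(1)[OF that]])
    have half: "sqnorm M (\<eta> i) / 2 \<le> sqnorm M (f i)" if "i \<le> k" for i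
      using \<theta>[OF that] unfolding f_def[abs_def] .
    have f0: "f i x = 0" if "x \<notin> cball (a i) r" for i x using \<eta>0[OF that] by (simp add: f_def)
    have off: "AE x in M. x \<notin> cball (a i) r \<longrightarrow> plate_op \<alpha> (f i) x = 0" if "i \<le> k" for i
      by (rule plate_op_off_support[OF ft[OF that] compact_cball]) (rule f0)
    have "f i \<in> H20 \<Omega> \<and> sqnorm M (f i) > 0 \<and>
      plate_form \<alpha> (f i) (f i) \<le> (1 + C * (1 + \<alpha>)) * sqnorm M (f i)" if i: "i \<le> k" for i
    proof (intro conjI)
      show "f i \<in> H20 \<Omega>" by (rule test_in_H20(1)[OF ft[OF i]])
      show pos: "sqnorm M (f i) > 0" using half[OF i] \<eta>(2)[OF i] by linarith
      have "sqnorm M (plate_op \<alpha> (f i))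
          \<le> 2 * sqnorm M (L i) + 4 * \<alpha> * sqnorm M (partial e (\<eta> i))"
        using plate_op_modulated_le[OF \<eta>(1)[OF i] e \<alpha>, of "\<theta> i"]
        unfolding f_def[abs_def] L_def[abs_def] \<omega>_def .
      also have "\<dots> \<le> (1 + \<alpha>) * (2 * sqnorm M (L i) + 4 * sqnorm M (partial e (\<eta> i)))"
      proof -
        have "0 \<le> \<alpha> * sqnorm M (L i)" using \<alpha> nn(1)[of i] by simp
        then show ?thesis using nn[of i] by (simp add: distrib_left distrib_right)
      qed
      also have "\<dots> = (1 + \<alpha>) * (K i * (sqnorm M (\<eta> i) / 2))"
        using \<eta>(2)[OF i] by (simp add: K_def)
      also have "\<dots> \<le> (1 + \<alpha>) * (C * sqnorm M (f i))"
        using \<alpha> K0[OF i] KC[OF i] half[OF i] \<eta>(2)[OF i]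
        by (intro mult_left_mono mult_mono) auto
      finally show "plate_form \<alpha> (f i) (f i) \<le> (1 + C * (1 + \<alpha>)) * sqnorm M (f i)"
        unfolding plate_form_def by (simp add: algebra_simps)
    qed
    moreover have "plate_form \<alpha> (f i) (f j) = 0 \<and> inner_L2 M (f i) (f j) = 0"
      if ij: "i \<le> k" "j \<le> k" "i \<noteq> j" for i j
    proof -
      have B: "inner_L2 M (f i) (f j) = 0"
        by (rule inner_L2_eq_0_if_disjoint) (use disj[OF ij] f0 in blast)
      have "AE x in M. plate_op \<alpha> (f i) x * plate_op \<alpha> (f j) x = 0"
        using off[OF ij(1)] off[OF ij(2)]
      proof eventually_elim
        case (elim x)
        then show ?case using disj[OF ij, of x] by auto
      qed
      then have "inner_L2 M (plate_op \<alpha> (f i)) (plate_op \<alpha> (f j)) = 0"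
        unfolding inner_L2_def by (rule integral_eq_zero_AE)
      with B show ?thesis by (simp add: plate_form_def)
    qed
    ultimately show "\<exists>f. (\<forall>i\<le>k. f i \<in> H20 \<Omega> \<and> sqnorm M (f i) > 0 \<and>
        plate_form \<alpha> (f i) (f i) \<le> (1 + C * (1 + \<alpha>)) * sqnorm M (f i)) \<and>
      (\<forall>i\<le>k. \<forall>j\<le>k. i \<noteq> j \<longrightarrow> plate_form \<alpha> (f i) (f j) = 0 \<and> inner_L2 M (f i) (f j) = 0)"
      by (intro exI[of _ f]) simp
  qed
qed

section \<open>The eigenvalues\<close>

lemma clamped_eigenspace_iff:
  "u \<in> clamped_eigenspace \<Omega> \<alpha> \<mu> \<longleftrightarrow> u \<in> H20 \<Omega> \<and>
    (\<forall>v\<in>H20 \<Omega>. plate_form \<alpha> u v = (\<mu> + (\<alpha>\<^sup>2 / 4 + 1)) * inner_L2 M u v)"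
proof (cases "u \<in> H20 \<Omega>")
  case True
  show ?thesis
    unfolding clamped_eigenspace_def using True
    by (auto simp: plate_form_eq[OF True] inner_L2_def[symmetric] distrib_right)
qed (simp add: clamped_eigenspace_def)

text \<open>The spectral theorem gives the eigenvalues \<open>m j\<close> of \<open>plate_form\<close>; the shift leads back to
  the clamped plate. The last part is the min-max bound, stated for \<open>m\<close>.\<close>

lemma eigenvalue_sequence:
  assumes ne: "\<Omega> \<noteq> {}"
  shows "\<exists>m. clamped_eigenvalue_sequence \<Omega> \<alpha> (\<lambda>j. m j - (\<alpha>\<^sup>2 / 4 + 1)) \<and> (\<forall>j. 1 \<le> m j) \<and>
    (\<forall>k f C. (\<forall>i\<le>k. f i \<in> H20 \<Omega> \<and> sqnorm M (f i) > 0 \<and>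
        plate_form \<alpha> (f i) (f i) \<le> C * sqnorm M (f i)) \<longrightarrow>
      (\<forall>i\<le>k. \<forall>j\<le>k. i \<noteq> j \<longrightarrow> plate_form \<alpha> (f i) (f j) = 0 \<and> inner_L2 M (f i) (f j) = 0) \<longrightarrow>
      m k \<le> C)"
proof -
  interpret P: compact_form_pair "H20 \<Omega>" "plate_form \<alpha>" "inner_L2 M"
    by (rule compact_form_pair_plate[OF ne])
  obtain e m where em0: "\<forall>k. e k \<in> H20 \<Omega>" "\<forall>i j. inner_L2 M (e i) (e j) = (if i = j then 1 else 0)"
    "\<forall>k. \<forall>v\<in>H20 \<Omega>. plate_form \<alpha> (e k) v = m k * inner_L2 M (e k) v"
    "mono m" "filterlim m at_top sequentially"
    "\<forall>k. \<forall>v\<in>P.orth e k. m k * sqnorm M v \<le> plate_form \<alpha> v v"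
    using P.spectral by (elim exE conjE) (rule that)
  note em = em0(1-3)[rule_format] em0(4,5) em0(6)[rule_format]
  define \<beta> where "\<beta> = \<alpha>\<^sup>2 / 4 + 1"
  have dim: "finite {j. m j - \<beta> = \<mu>} \<and>
      has_ae_dim \<Omega> (clamped_eigenspace \<Omega> \<alpha> \<mu>) (card {j. m j - \<beta> = \<mu>})" for \<mu>
  proof -
    let ?S = "{j. m j = \<mu> + \<beta>}"
    have S: "{j. m j - \<beta> = \<mu>} = ?S" by auto
    have zero: "(0::'a \<Rightarrow> real) \<in> H20 \<Omega>" by (rule P.B.closed(4))
    have fin: "finite ?S"
      by (rule P.eigenvector_expansion(1)[OF em(1,2,3,5,6) zero, where \<mu> = "\<mu> + \<beta>"])
        (simp_all add: P.A.zero_left P.B.zero_left)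
    obtain g where g: "bij_betw g {..<card ?S} ?S"
      using ex_bij_betw_nat_finite[OF fin] by (auto simp: atLeast0LessThan)
    have gS: "g i \<in> ?S" if "i < card ?S" for i using g that by (auto simp: bij_betw_def)
    have ginj: "g i = g j \<longleftrightarrow> i = j" if "i < card ?S" "j < card ?S" for i j
      using g that by (auto simp: bij_betw_def inj_on_def)
    have "has_ae_dim \<Omega> (clamped_eigenspace \<Omega> \<alpha> \<mu>) (card ?S)"
      unfolding has_ae_dim_def
    proof (intro exI[of _ "\<lambda>i. e (g i)"] conjI allI impI ballI)
      fix i assume "i < card ?S"
      then show "e (g i) \<in> clamped_eigenspace \<Omega> \<alpha> \<mu>"
        using gS[of i] em(1,3) unfolding clamped_eigenspace_iff \<beta>_def by auto
    next
      fix c i assume ae: "AE x in M. (\<Sum>i<card ?S. c i * e (g i) x) = 0" and i: "i < card ?S"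
      let ?u = "\<Sum>i<card ?S. c i *\<^sub>R e (g i)"
      have "inner_L2 M ?u (e (g i)) = 0"
        unfolding inner_L2_def
      proof (rule integral_eq_zero_AE)
        show "AE x in M. ?u x * e (g i) x = 0"
          using ae by eventually_elim (simp add: sum_fun_apply)
      qed
      moreover have "inner_L2 M ?u (e (g i)) = (\<Sum>j<card ?S. c j * inner_L2 M (e (g j)) (e (g i)))"
        using em(1) by (intro P.B.sum_left) auto
      moreover have "\<dots> = (\<Sum>j<card ?S. if j = i then c i else 0)"
        using ginj i by (intro sum.cong) (auto simp: em(2))
      ultimately show "c i = 0" using i by simp
    next
      fix u assume u: "u \<in> clamped_eigenspace \<Omega> \<alpha> \<mu>"
      let ?p = "\<Sum>j\<in>?S. inner_L2 M u (e j) *\<^sub>R e j"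
      have uH: "u \<in> H20 \<Omega>" using u by (simp add: clamped_eigenspace_iff)
      have "sqnorm M (u - ?p) = 0"
        by (rule P.eigenvector_expansion(2)[OF em(1,2,3,5,6) uH])
          (use u in \<open>simp_all add: clamped_eigenspace_iff \<beta>_def\<close>)
      moreover have "u - ?p \<in> SI"
        using uH em(1) by (intro H20_SI P.B.closed(2) P.B.sum_closed P.B.closed(3))
      ultimately have "AE x in M. (u - ?p) x = 0" by (simp add: inner_L2_self_eq_0_iff)
      then have "AE x in M. u x = (\<Sum>i<card ?S. inner_L2 M u (e (g i)) * e (g i) x)"
      proof eventually_elim
        case (elim x)
        then have "u x = (\<Sum>j\<in>?S. inner_L2 M u (e j) * e j x)" by (simp add: sum_fun_apply)
        also have "\<dots> = (\<Sum>i<card ?S. inner_L2 M u (e (g i)) * e (g i) x)"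
          by (rule sum.reindex_bij_betw[OF g, symmetric])
        finally show ?case .
      qed
      then show "\<exists>c. AE x in M. u x = (\<Sum>i<card ?S. c i * e (g i) x)"
        by (rule exI[of _ "\<lambda>i. inner_L2 M u (e (g i))"])
    qed
    with fin show ?thesis unfolding S by simp
  qed
  show ?thesis
  proof (intro exI[of _ m] conjI allI impI)
    have "filterlim (\<lambda>j. - \<beta> + m j) at_top sequentially"
      by (rule filterlim_tendsto_add_at_top[OF tendsto_const em(5)])
    then show "clamped_eigenvalue_sequence \<Omega> \<alpha> (\<lambda>j. m j - (\<alpha>\<^sup>2 / 4 + 1))"
      unfolding clamped_eigenvalue_sequence_def \<beta>_def[symmetric]
      using dim em(4) by (auto simp: mono_def)
    show "1 \<le> m j" for j
    proof -
      have "sqnorm M (e j) \<le> plate_form \<alpha> (e j) (e j)" by (rule P.B_le_A[OF em(1)])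
      then show ?thesis by (simp add: em(3)[OF em(1)] em(2))
    qed
    fix k :: nat and f C
    assume f: "\<forall>i\<le>k. f i \<in> H20 \<Omega> \<and> sqnorm M (f i) > 0 \<and>
        plate_form \<alpha> (f i) (f i) \<le> C * sqnorm M (f i)"
      and orth: "\<forall>i\<le>k. \<forall>j\<le>k. i \<noteq> j \<longrightarrow> plate_form \<alpha> (f i) (f j) = 0 \<and> inner_L2 M (f i) (f j) = 0"
    show "m k \<le> C"
    proof (rule P.eigenvalue_upper_bound[where e = e and k = k and f = f])
      show "e j \<in> H20 \<Omega>" for j by (rule em(1))
      show "m k * sqnorm M v \<le> plate_form \<alpha> v v" if "v \<in> P.orth e k" for v by (rule em(6)[OF that])
    qed (use f orth in simp_all)
  qed
qed

theorem clamped_eigenvalue_bounds: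
  assumes ne: "\<Omega> \<noteq> {}"
  shows "\<exists>C. \<forall>\<alpha>>0. 0 \<le> clamped_eigenvalue \<Omega> \<alpha> k + \<alpha>\<^sup>2 / 4 \<and>
    clamped_eigenvalue \<Omega> \<alpha> k + \<alpha>\<^sup>2 / 4 \<le> C * (1 + \<alpha>)"
proof -
  obtain C where C: "\<forall>\<alpha>>0. \<exists>f. (\<forall>i\<le>k - 1. f i \<in> H20 \<Omega> \<and> sqnorm M (f i) > 0 \<and>
      plate_form \<alpha> (f i) (f i) \<le> (1 + C * (1 + \<alpha>)) * sqnorm M (f i)) \<and>
    (\<forall>i\<le>k - 1. \<forall>j\<le>k - 1. i \<noteq> j \<longrightarrow> plate_form \<alpha> (f i) (f j) = 0 \<and> inner_L2 M (f i) (f j) = 0)"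
    using plate_test_functions[OF ne, of "k - 1"] by (elim exE) (rule that)
  show ?thesis
  proof (intro exI[of _ C] allI impI)
    fix \<alpha> :: real assume \<alpha>: "\<alpha> > 0"
    obtain m where m: "clamped_eigenvalue_sequence \<Omega> \<alpha> (\<lambda>j. m j - (\<alpha>\<^sup>2 / 4 + 1))" "\<forall>j. 1 \<le> m j"
      "\<forall>k f C. (\<forall>i\<le>k. f i \<in> H20 \<Omega> \<and> sqnorm M (f i) > 0 \<and>
        plate_form \<alpha> (f i) (f i) \<le> C * sqnorm M (f i)) \<longrightarrow>
      (\<forall>i\<le>k. \<forall>j\<le>k. i \<noteq> j \<longrightarrow> plate_form \<alpha> (f i) (f j) = 0 \<and> inner_L2 M (f i) (f j) = 0) \<longrightarrow>
      m k \<le> C"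
      using eigenvalue_sequence[OF ne, of \<alpha>] by (elim exE conjE) (rule that)
    from C[rule_format, OF \<alpha>] obtain f where f: "\<forall>i\<le>k - 1. f i \<in> H20 \<Omega> \<and> sqnorm M (f i) > 0 \<and>
        plate_form \<alpha> (f i) (f i) \<le> (1 + C * (1 + \<alpha>)) * sqnorm M (f i)"
      "\<forall>i\<le>k - 1. \<forall>j\<le>k - 1. i \<noteq> j \<longrightarrow> plate_form \<alpha> (f i) (f j) = 0 \<and> inner_L2 M (f i) (f j) = 0"
      by (elim exE conjE) (rule that)
    have "m (k - 1) \<le> 1 + C * (1 + \<alpha>)"
      by (rule m(3)[rule_format, of "k - 1" f]) (use f in simp_all)
    then show "0 \<le> clamped_eigenvalue \<Omega> \<alpha> k + \<alpha>\<^sup>2 / 4 \<and> clamped_eigenvalue \<Omega> \<alpha> k + \<alpha>\<^sup>2 / 4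
        \<le> C * (1 + \<alpha>)"
      unfolding clamped_eigenvalue_eq[OF m(1)] using m(2)[rule_format, of "k - 1"] by simp
  qed
qed

end

theorem theorem1p1:
  fixes \<Omega> :: "'a::euclidean_space set"
  assumes "DIM('a) \<ge> 2"
    and "open \<Omega>" and "connected \<Omega>" and "bounded \<Omega>" and "\<Omega> \<noteq> {}"
  shows "(\<forall>k\<ge>1. (\<lambda>\<alpha>. clamped_eigenvalue \<Omega> \<alpha> k - (- (\<alpha>\<^sup>2 / 4))) \<in> o[at_top](\<lambda>\<alpha>. \<alpha>\<^sup>2))
    \<and> (\<lambda>\<alpha>. clamped_eigenvalue \<Omega> \<alpha> 1 - (- (\<alpha>\<^sup>2 / 4))) \<in> O[at_top](\<lambda>\<alpha>. \<alpha>)"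
proof -
  interpret bounded_open \<Omega> using assms by unfold_locales
  have O: "(\<lambda>\<alpha>. clamped_eigenvalue \<Omega> \<alpha> k - (- (\<alpha>\<^sup>2 / 4))) \<in> O[at_top](\<lambda>\<alpha>. \<alpha>)" for k
  proof -
    obtain C where C: "\<And>\<alpha>. \<alpha> > 0 \<Longrightarrow> 0 \<le> clamped_eigenvalue \<Omega> \<alpha> k + \<alpha>\<^sup>2 / 4"
      "\<And>\<alpha>. \<alpha> > 0 \<Longrightarrow> clamped_eigenvalue \<Omega> \<alpha> k + \<alpha>\<^sup>2 / 4 \<le> C * (1 + \<alpha>)"
      using clamped_eigenvalue_bounds[OF assms(5), of k] by blast
    have "(\<lambda>\<alpha>. clamped_eigenvalue \<Omega> \<alpha> k - (- (\<alpha>\<^sup>2 / 4))) \<in> O[at_top](\<lambda>\<alpha>. C * (1 + \<alpha>))"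
    proof (rule bigoI[where c = 1])
      show "\<forall>\<^sub>F \<alpha> in at_top. norm (clamped_eigenvalue \<Omega> \<alpha> k - (- (\<alpha>\<^sup>2 / 4))) \<le> 1 * norm (C * (1
          + \<alpha>))"
        using eventually_gt_at_top[of 0]
      proof eventually_elim
        case (elim \<alpha>)
        then show ?case using C[of \<alpha>] by simp
      qed
    qed
    also have "(\<lambda>\<alpha>. C * (1 + \<alpha>)) \<in> O[at_top](\<lambda>\<alpha>::real. \<alpha>)" by real_asymp
    finally show ?thesis .
  qed
  have "(\<lambda>\<alpha>::real. \<alpha>) \<in> o[at_top](\<lambda>\<alpha>. \<alpha>\<^sup>2)" by real_asymp
  from landau_o.big_small_trans[OF O this] O[of 1] show ?thesis by blast
qed

end
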